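(* Let $(X,\rho,\mu)$ be a space of homogeneous type (with the standing assumptions listed in the context), $q\in(1,\infty)$, and $\gamma\in[0,1)$. Assume that $\omega\in A^+_q(\gamma)$. Then there exists a positive constant $C$ such that, for any $f\in L^q(X\times\mathbb R,\omega)$ and $\xi\in(0,\infty)$, $$\omega\left(\{(x,t)\in X\times\mathbb R:\ \mathcal M^{\gamma+}f(x,t)>\xi\}\right)\le C\,\xi^{-q}\int_{X\times\mathbb R}|f|^q\omega .$$
   Context: Setting. $(X,\rho)$ is a quasi-metric space: $\rho:X\times X\to[0,\infty)$, $\rho(x,y)=0$ iff $x=y$, $\rho(x,y)=\rho(y,x)$, and $\rho(x,y)\le K_0[\rho(x,z)+\rho(z,y)]$ for all $x,y,z\in X$, with a constant $K_0\in[1,\infty)$. Balls are $B(x,r)=\{y\in X:\rho(x,y)<r\}$. $\mu$ is a nonnegative measure on a $\sigma$-algebra containing the balls which is doubling: $\mu(B(x,2r))\le C_\mu\mu(B(x,r))$ for all $x\in X$, $r\in(0,\infty)$; then $(X,\rho,\mu)$ is called a space of homogeneous type. Standing assumptions: (a) for each $x$ the balls $\{B(x,r)\}_{r>0}$ form a basis of open neighborhoods of $x$; (b) $\mu$ is Borel regular (open sets are measurable and every $A\subset X$ lies in a Borel set $E$ with $\mu(A)=\mu(E)$); (c) $0<\mu(B(x,r))<\infty$ for all balls; (d) $\operatorname{diam}(X)=\infty$ and $\mu(\{x\})=0$ for all $x$; (e) monotone geodesic property: there is a constant $\widetilde K>0$ such that for all $s\in(0,\infty)$ and $x,y\in X$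 with $\rho(x,y)\ge s$ there are $m\in\mathbb N$ and points $x_0=x,x_1,\dots,x_m=y$ with $\rho(x_i,x_{i+1})\le\widetilde K s$ and $\rho(x_{i+1},x_m)\le\rho(x_i,x_m)-s$ for $i=0,\dots,m-1$. Fix $p\in(1,\infty)$. $X\times\mathbb R$ carries the quasi-metric $d((x,t),(y,s))=\max\{\rho(x,y),|t-s|^{1/p}\}$ and the product measure $\lambda=\mu\times m$, $m$ being Lebesgue measure on $\mathbb R$; the same basic assumptions (a)-(d) are made for $(X\times\mathbb R,d,\lambda)$. All integrals are with respect to $\lambda$, and $⨍_E f:=\frac1{\lambda(E)}\int_E f$ denotes the average. Parabolic cylinders. For $x\in X$, $t\in\mathbb R$, $l\in(0,\infty)$, $\gamma\in[0,1)$ put $R=R(x,t,l)=B(x,l)\times(t-l^p,t+l^p)$, $R^-(\gamma)=B(x,l)\times(t-l^p,t-\gamma l^p)$, $R^+(\gamma)=B(x,l)\times(t+\gamma l^p,t+l^p)$. Weights. A weight is a real-valued, $\lambda$-almost everywhere positive, locally integrable function on $X\times\mathbb R$ (integrable on some cylinder $R(x,t,r)$ around each point). For $q\in(1,\infty)$, with $1/q+1/q'=1$, and $\gamma\in[0,1)$, a weight $\omega$ belongs to $A^+_q(\gamma)$ if $\sup_{R}\left[⨍_{R^-(\gamma)}\omega\right]\left[⨍_{R^+(\gamma)}\omega^{1-q'}\right]^{q-1}<\infty$, the supremum being over all parabolic cylinders $R(x,t,l)$. We write $\omega(E)=\int_E\omega$, and $L^q(X\times\mathbb R,\omega)$ is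 the set of measurable $f$ with $\int|f|^q\omega<\infty$. Adjacent dyadic systems and parabolic rectangles. Fix $\delta\in(0,1)$ with $96K_0^6\delta\le1$ and constants $0<c_0\le C_0<\infty$ with $12K_0^3C_0\delta\le c_0$; let $c_1=(3K_0^2)^{-1}c_0$, $C_1=2K_0C_0$. Fix (they exist by a theorem of Hytönen and Kairema) $K\in\mathbb N$ and, for $\tau\in\{1,\dots,K\}$, points $\{z^{k,\tau}_\alpha\}$ and families $\mathfrak D^\tau=\{Q^{k,\tau}_\alpha: k\in\mathbb Z,\alpha\in I_{k,\tau}\}$ of subsets of $X$ (dyadic cubes) such that for each $\tau$: $\rho(z^{k,\tau}_\alpha,z^{k,\tau}_\beta)\ge c_0\delta^k$ for $\alpha\ne\beta$ and $\min_\alpha\rho(x,z^{k,\tau}_\alpha)<C_0\delta^k$ for all $x\in X$; if $l\ge k$, then either $Q^{l,\tau}_\beta\subset Q^{k,\tau}_\alpha$ or they are disjoint; for each $k$, $X$ is the disjoint union of $Q^{k,\tau}_\alpha$, $\alpha\in I_{k,\tau}$; $B(z^{k,\tau}_\alpha,c_1\delta^k)\subset Q^{k,\tau}_\alpha\subset B(z^{k,\tau}_\alpha,C_1\delta^k)$; if $l\ge k$ and $Q^{l,\tau}_\beta\subset Q^{k,\tau}_\alpha$, then $B(z^{l,\tau}_\beta,C_1\delta^l)\subset B(z^{k,\tau}_\alpha,C_1\delta^k)$; moreover there is a constant $C_*>0$ such that every ball $B(x,r)$ is contained in some $Q^{k,\tau}_\alpha$ (for some $\tau$) with $\operatorname{diam}(Q^{k,\tau}_\alpha)\le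 C_*r$. A parabolic rectangle is $P=P(\tau,k,\alpha,t)=Q^{k,\tau}_\alpha\times(t-\delta^{kp},t+\delta^{kp})$, with $P^-(\gamma)=Q^{k,\tau}_\alpha\times(t-\delta^{kp},t-\gamma\delta^{kp})$, $P^+(\gamma)=Q^{k,\tau}_\alpha\times(t+\gamma\delta^{kp},t+\delta^{kp})$. Maximal function. $\mathcal M^{\gamma+}f(x,t)=\sup ⨍_{P^+(\gamma)}|f|$, the supremum being over all $\tau,k,\alpha$ with $(x,t)\in P=P(\tau,k,\alpha,t)$ (i.e. $x\in Q^{k,\tau}_\alpha$; the same $t$). *)

theory Defs
  imports "HOL-Analysis.Analysis"
begin

text \<open>The underlying set \<open>X\<close> is the type \<open>'a\<close>; a quasi-metric is an
  explicit function \<open>rho\<close>, unrelated to any type class structure on \<open>'a\<close>.\<close>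

definition quasi_metric :: "real \<Rightarrow> ('a \<Rightarrow> 'a \<Rightarrow> real) \<Rightarrow> bool" where
  "quasi_metric K0 rho \<longleftrightarrow> 1 \<le> K0
     \<and> (\<forall>x y. 0 \<le> rho x y)
     \<and> (\<forall>x y. rho x y = 0 \<longleftrightarrow> x = y)
     \<and> (\<forall>x y. rho x y = rho y x)
     \<and> (\<forall>x y z. rho x y \<le> K0 * (rho x z + rho z y))"

definition qball :: "('a \<Rightarrow> 'a \<Rightarrow> real) \<Rightarrow> 'a \<Rightarrow> real \<Rightarrow> 'a set" where
  "qball rho x r = {y. rho x y < r}"

definition qdiam :: "('a \<Rightarrow> 'a \<Rightarrow> real) \<Rightarrow> 'a set \<Rightarrow> ennreal" where
  "qdiam rho A = (SUP x\<in>A. SUP y\<in>A. ennreal (rho x y))"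

definition quasi_topology :: "('a \<Rightarrow> 'a \<Rightarrow> real) \<Rightarrow> 'a topology" where
  "quasi_topology rho = topology (\<lambda>U. \<forall>x\<in>U. \<exists>r>0. qball rho x r \<subseteq> U)"

lemma openin_quasi_topology:
  "openin (quasi_topology rho) U \<longleftrightarrow> (\<forall>x\<in>U. \<exists>r>0. qball rho x r \<subseteq> U)"
proof -
  have "istopology (\<lambda>U. \<forall>x\<in>U. \<exists>r>0. qball rho x r \<subseteq> U)"
    unfolding istopology_def
  proof (intro conjI allI impI ballI)
    fix S T x
    assume S: "\<forall>x\<in>S. \<exists>r>0. qball rho x r \<subseteq> S" and T: "\<forall>x\<in>T. \<exists>r>0. qball rho x r \<subseteq> T"
      and x: "x \<in> S \<inter> T"
    obtain r s where "r > 0" "qball rho x r \<subseteq> S" "s > 0" "qball rho x s \<subseteq> T"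
      using S T x by blast
    then have "min r s > 0 \<and> qball rho x (min r s) \<subseteq> S \<inter> T"
      by (auto simp: qball_def)
    then show "\<exists>r>0. qball rho x r \<subseteq> S \<inter> T"
      by blast
  next
    fix \<K> x
    assume K: "\<forall>S\<in>\<K>. \<forall>x\<in>S. \<exists>r>0. qball rho x r \<subseteq> S" and "x \<in> \<Union>\<K>"
    then obtain S where S: "S \<in> \<K>" "x \<in> S"
      by blast
    with K obtain r where "r > 0" "qball rho x r \<subseteq> S"
      by blast
    with S show "\<exists>r>0. qball rho x r \<subseteq> \<Union>\<K>"
      by blast
  qed
  then show ?thesis
    by (simp add: quasi_topology_def topology_inverse')
qed

definition homogeneous_type :: "real \<Rightarrow> ('a \<Rightarrow> 'a \<Rightarrow> real) \<Rightarrow> 'a measure \<Rightarrow> bool" where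
  "homogeneous_type K0 rho mu \<longleftrightarrow> quasi_metric K0 rho
     \<and> space mu = UNIV
     \<and> (\<forall>x. \<forall>r>0. qball rho x r \<in> sets mu)
     \<and> (\<exists>Cmu::real. \<forall>x. \<forall>r>0. emeasure mu (qball rho x (2 * r)) \<le> ennreal Cmu * emeasure mu (qball rho x r))"

definition balls_open_basis :: "('a \<Rightarrow> 'a \<Rightarrow> real) \<Rightarrow> bool" where
  "balls_open_basis rho \<longleftrightarrow>
     (\<forall>x. (\<forall>r>0. openin (quasi_topology rho) (qball rho x r))
        \<and> (\<forall>U. openin (quasi_topology rho) U \<and> x \<in> U \<longrightarrow> (\<exists>r>0. qball rho x r \<subseteq> U)))"

text \<open>In \<open>borel_regular\<close> the set \<open>A\<close> is arbitrary, so its measure is the outer measure;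
  on measurable sets this agrees with \<^const>\<open>emeasure\<close>.\<close>

definition borel_regular :: "('a \<Rightarrow> 'a \<Rightarrow> real) \<Rightarrow> 'a measure \<Rightarrow> bool" where
  "borel_regular rho mu \<longleftrightarrow>
     (\<forall>U. openin (quasi_topology rho) U \<longrightarrow> U \<in> sets mu)
     \<and> (\<forall>A. \<exists>E \<in> sigma_sets UNIV {U. openin (quasi_topology rho) U}.
            A \<subseteq> E \<and> outer_measure_of mu A = emeasure mu E)"

definition basic_assumptions :: "('a \<Rightarrow> 'a \<Rightarrow> real) \<Rightarrow> 'a measure \<Rightarrow> bool" where
  "basic_assumptions rho mu \<longleftrightarrow> balls_open_basis rho
     \<and> borel_regular rho mu
     \<and> (\<forall>x. \<forall>r>0. 0 < emeasure mu (qball rho x r) \<and> emeasure mu (qball rho x r) < \<infinity>)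
     \<and> qdiam rho UNIV = \<infinity>
     \<and> (\<forall>x. emeasure mu {x} = 0)"

definition monotone_geodesic :: "('a \<Rightarrow> 'a \<Rightarrow> real) \<Rightarrow> bool" where
  "monotone_geodesic rho \<longleftrightarrow>
     (\<exists>Kt>0. \<forall>s>0. \<forall>x y. s \<le> rho x y \<longrightarrow>
        (\<exists>(m::nat) w. w 0 = x \<and> w m = y
           \<and> (\<forall>i<m. rho (w i) (w (Suc i)) \<le> Kt * s
                   \<and> rho (w (Suc i)) (w m) \<le> rho (w i) (w m) - s)))"

definition parabolic_dist :: "real \<Rightarrow> ('a \<Rightarrow> 'a \<Rightarrow> real) \<Rightarrow> 'a \<times> real \<Rightarrow> 'a \<times> real \<Rightarrow> real" where
  "parabolic_dist p rho = (\<lambda>(x, t) (y, s). max (rho x y) (\<bar>t - s\<bar> powr (1 / p)))"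

definition parabolic_measure :: "'a measure \<Rightarrow> ('a \<times> real) measure" where
  "parabolic_measure mu = mu \<Otimes>\<^sub>M lebesgue"

definition cylinder :: "real \<Rightarrow> ('a \<Rightarrow> 'a \<Rightarrow> real) \<Rightarrow> 'a \<Rightarrow> real \<Rightarrow> real \<Rightarrow> ('a \<times> real) set" where
  "cylinder p rho x t l = qball rho x l \<times> {t - l powr p <..< t + l powr p}"

definition cylinder_minus ::
  "real \<Rightarrow> ('a \<Rightarrow> 'a \<Rightarrow> real) \<Rightarrow> real \<Rightarrow> 'a \<Rightarrow> real \<Rightarrow> real \<Rightarrow> ('a \<times> real) set" where
  "cylinder_minus p rho \<gamma> x t l = qball rho x l \<times> {t - l powr p <..< t - \<gamma> * l powr p}"

definition cylinder_plus ::
  "real \<Rightarrow> ('a \<Rightarrow> 'a \<Rightarrow> real) \<Rightarrow> real \<Rightarrow> 'a \<Rightarrow> real \<Rightarrow> real \<Rightarrow> ('a \<times> real) set" where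
  "cylinder_plus p rho \<gamma> x t l = qball rho x l \<times> {t + \<gamma> * l powr p <..< t + l powr p}"

text \<open>Averages and weighted measures take values in \<^typ>\<open>ennreal\<close>, so that
  suprema and divergent integrals keep their usual meaning. Note that \<^const>\<open>ennreal\<close> sends negative
  reals to \<open>0\<close>; this only matters for a weight on a null set.\<close>

definition average :: "'b measure \<Rightarrow> 'b set \<Rightarrow> ('b \<Rightarrow> real) \<Rightarrow> ennreal" where
  "average M E f = (\<integral>\<^sup>+z\<in>E. ennreal (f z) \<partial>M) / emeasure M E"

definition weighted :: "'b measure \<Rightarrow> ('b \<Rightarrow> real) \<Rightarrow> 'b set \<Rightarrow> ennreal" where
  "weighted M \<omega> E = (\<integral>\<^sup>+z\<in>E. ennreal (\<omega> z) \<partial>M)"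

text \<open>Real powers of extended nonnegative reals, for positive exponents.\<close>

definition ennreal_powr :: "ennreal \<Rightarrow> real \<Rightarrow> ennreal" where
  "ennreal_powr x a = (if x = \<infinity> then \<infinity> else ennreal (enn2real x powr a))"

definition conjugate_exponent :: "real \<Rightarrow> real" where
  "conjugate_exponent q = q / (q - 1)"

lemma conjugate_exponent: "1 < q \<Longrightarrow> 1 / q + 1 / q' = 1 \<longleftrightarrow> q' = conjugate_exponent q"
  by (cases "q' = 0") (auto simp: conjugate_exponent_def field_simps)

definition weight :: "real \<Rightarrow> ('a \<Rightarrow> 'a \<Rightarrow> real) \<Rightarrow> 'a measure \<Rightarrow> ('a \<times> real \<Rightarrow> real) \<Rightarrow> bool" where
  "weight p rho mu \<omega> \<longleftrightarrow> \<omega> \<in> borel_measurable (parabolic_measure mu)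
     \<and> (AE z in parabolic_measure mu. 0 < \<omega> z)
     \<and> (\<forall>x t. \<exists>r>0. set_integrable (parabolic_measure mu) (cylinder p rho x t r) \<omega>)"

definition A_plus ::
  "real \<Rightarrow> ('a \<Rightarrow> 'a \<Rightarrow> real) \<Rightarrow> 'a measure \<Rightarrow> real \<Rightarrow> real \<Rightarrow> ('a \<times> real \<Rightarrow> real) set" where
  "A_plus p rho mu q \<gamma> = {\<omega>. weight p rho mu \<omega> \<and>
     (SUP (x, t, l) \<in> UNIV \<times> UNIV \<times> {0<..}.
        average (parabolic_measure mu) (cylinder_minus p rho \<gamma> x t l) \<omega>
        * ennreal_powr
            (average (parabolic_measure mu) (cylinder_plus p rho \<gamma> x t l)
               (\<lambda>z. \<omega> z powr (1 - conjugate_exponent q)))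
            (q - 1)) < \<infinity>}"

definition weighted_Lq :: "'b measure \<Rightarrow> real \<Rightarrow> ('b \<Rightarrow> real) \<Rightarrow> ('b \<Rightarrow> real) set" where
  "weighted_Lq M q \<omega> = {f \<in> borel_measurable M. (\<integral>\<^sup>+z. ennreal (\<bar>f z\<bar> powr q * \<omega> z) \<partial>M) < \<infinity>}"

text \<open>\<open>z \<tau> k \<alpha>\<close> and \<open>Q \<tau> k \<alpha>\<close>, for \<open>\<alpha> \<in> I \<tau> k\<close>, are the centres and cubes of generation \<open>k\<close> in the
  system \<open>\<tau> \<in> {1..K}\<close>. Measurability of the cubes is implicit in averaging over them
  (Hytonen and Kairema construct them as Borel sets); it has to be required
  because \<open>mu\<close> is not assumed to be complete.\<close>

definition adjacent_dyadic_systems ::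
  "real \<Rightarrow> ('a \<Rightarrow> 'a \<Rightarrow> real) \<Rightarrow> 'a measure \<Rightarrow> real \<Rightarrow> real \<Rightarrow> real \<Rightarrow> nat
   \<Rightarrow> (nat \<Rightarrow> int \<Rightarrow> 'i set) \<Rightarrow> (nat \<Rightarrow> int \<Rightarrow> 'i \<Rightarrow> 'a) \<Rightarrow> (nat \<Rightarrow> int \<Rightarrow> 'i \<Rightarrow> 'a set) \<Rightarrow> bool" where
  "adjacent_dyadic_systems K0 rho mu \<delta> c0 C0 K I z Q \<longleftrightarrow>
     0 < \<delta> \<and> \<delta> < 1 \<and> 96 * K0 ^ 6 * \<delta> \<le> 1
     \<and> 0 < c0 \<and> c0 \<le> C0 \<and> 12 * K0 ^ 3 * C0 * \<delta> \<le> c0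
     \<and> (let c1 = c0 / (3 * K0\<^sup>2); C1 = 2 * K0 * C0 in
          (\<forall>\<tau>\<in>{1..K}.
             (\<forall>k. \<forall>\<alpha>\<in>I \<tau> k. \<forall>\<beta>\<in>I \<tau> k. \<alpha> \<noteq> \<beta> \<longrightarrow> c0 * \<delta> powi k \<le> rho (z \<tau> k \<alpha>) (z \<tau> k \<beta>))
           \<and> (\<forall>k x. \<exists>\<alpha>\<in>I \<tau> k. rho x (z \<tau> k \<alpha>) < C0 * \<delta> powi k)
           \<and> (\<forall>k. \<forall>\<alpha>\<in>I \<tau> k. Q \<tau> k \<alpha> \<in> sets mu)
           \<and> (\<forall>k l. k \<le> l \<longrightarrow> (\<forall>\<alpha>\<in>I \<tau> k. \<forall>\<beta>\<in>I \<tau> l.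
                Q \<tau> l \<beta> \<subseteq> Q \<tau> k \<alpha> \<or> Q \<tau> l \<beta> \<inter> Q \<tau> k \<alpha> = {}))
           \<and> (\<forall>k. (\<Union>\<alpha>\<in>I \<tau> k. Q \<tau> k \<alpha>) = UNIV \<and> disjoint_family_on (Q \<tau> k) (I \<tau> k))
           \<and> (\<forall>k. \<forall>\<alpha>\<in>I \<tau> k. qball rho (z \<tau> k \<alpha>) (c1 * \<delta> powi k) \<subseteq> Q \<tau> k \<alpha>
                \<and> Q \<tau> k \<alpha> \<subseteq> qball rho (z \<tau> k \<alpha>) (C1 * \<delta> powi k))
           \<and> (\<forall>k l. k \<le> l \<longrightarrow> (\<forall>\<alpha>\<in>I \<tau> k. \<forall>\<beta>\<in>I \<tau> l. Q \<tau> l \<beta> \<subseteq> Q \<tau> k \<alpha> \<longrightarrow>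
                qball rho (z \<tau> l \<beta>) (C1 * \<delta> powi l) \<subseteq> qball rho (z \<tau> k \<alpha>) (C1 * \<delta> powi k))))
        \<and> (\<exists>Cstar::real. 0 < Cstar \<and> (\<forall>x. \<forall>r>0. \<exists>\<tau>\<in>{1..K}. \<exists>k. \<exists>\<alpha>\<in>I \<tau> k.
             qball rho x r \<subseteq> Q \<tau> k \<alpha> \<and> qdiam rho (Q \<tau> k \<alpha>) \<le> ennreal (Cstar * r))))"

text \<open>The rectangle over a cube \<open>D\<close> of generation \<open>k\<close>.\<close>

definition rectangle :: "real \<Rightarrow> real \<Rightarrow> 'a set \<Rightarrow> int \<Rightarrow> real \<Rightarrow> ('a \<times> real) set" where
  "rectangle p \<delta> D k t = D \<times> {t - \<delta> powr (k * p) <..< t + \<delta> powr (k * p)}"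

definition rectangle_plus :: "real \<Rightarrow> real \<Rightarrow> real \<Rightarrow> 'a set \<Rightarrow> int \<Rightarrow> real \<Rightarrow> ('a \<times> real) set" where
  "rectangle_plus p \<delta> \<gamma> D k t = D \<times> {t + \<gamma> * \<delta> powr (k * p) <..< t + \<delta> powr (k * p)}"

definition maximal_plus ::
  "real \<Rightarrow> 'a measure \<Rightarrow> real \<Rightarrow> nat \<Rightarrow> (nat \<Rightarrow> int \<Rightarrow> 'i set) \<Rightarrow> (nat \<Rightarrow> int \<Rightarrow> 'i \<Rightarrow> 'a set)
   \<Rightarrow> real \<Rightarrow> ('a \<times> real \<Rightarrow> real) \<Rightarrow> 'a \<times> real \<Rightarrow> ennreal" where
  "maximal_plus p mu \<delta> K I Q \<gamma> f = (\<lambda>(x, t).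
     SUP (\<tau>, k, \<alpha>) \<in> {(\<tau>, k, \<alpha>). \<tau> \<in> {1..K} \<and> \<alpha> \<in> I \<tau> k \<and> (x, t) \<in> rectangle p \<delta> (Q \<tau> k \<alpha>) k t}.
       average (parabolic_measure mu) (rectangle_plus p \<delta> \<gamma> (Q \<tau> k \<alpha>) k t) (\<lambda>y. \<bar>f y\<bar>))"

end

theory Submission
  imports Defs
begin

text \<open>Every rectangle with average of \<open>|f|\<close> above \<open>\<xi>\<close> gives, by the weight condition,
  an estimate of the \<open>\<omega>\<close>-mass of the set \<open>Q \<times> (t - b L, t]\<close> by \<open>\<xi>\<^sup>-\<^sup>q\<close> times the integral of
  \<open>|f|\<^sup>q \<omega>\<close> over any part \<open>S\<close> of the upper rectangle that carries half of the mass of \<open>|f|\<close>. For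
  \<open>\<gamma> > 0\<close> the time lags of the two rectangles do not fit, and one has to move the lower cylinders
  forward in time; because \<open>p > 1\<close>, small cylinders can be moved along a geodesic chain in an
  arbitrarily small amount of time.

  For a fixed dyadic system and a fixed level (averages between \<open>\<xi>\<close> and \<open>2\<xi>\<close>), rectangles are
  selected greedily, largest cubes first and latest times first, so that the sets
  \<open>Q \<times> (t - b L, t]\<close> cover and their lower halves overlap at most twice. The latter is a packing
  condition, which yields the sets \<open>S\<close> with bounded overlap. It remains to let the size of the
  largest cubes tend to infinity and to sum over the levels \<open>2\<^sup>n \<xi>\<close> and the dyadic systems.\<close>

section \<open>The weight condition in testing form\<close>

text \<open>A dual form of the \<open>A\<^sub>q\<close> condition for the pair \<open>(U, V)\<close>: it avoids the dual weight and is stable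
  under finite unions in both arguments.\<close>

definition tests :: "'b measure \<Rightarrow> ('b \<Rightarrow> real) \<Rightarrow> real \<Rightarrow> 'b set \<Rightarrow> 'b set \<Rightarrow> real \<Rightarrow> bool" where
  "tests M \<omega> q U V c \<longleftrightarrow> (\<forall>g \<in> borel_measurable M. \<forall>m::real. 0 < m \<longrightarrow>
     ennreal m \<le> (\<integral>\<^sup>+y\<in>V. ennreal \<bar>g y\<bar> \<partial>M) \<longrightarrow>
     ennreal (m powr q) * weighted M \<omega> U \<le> ennreal c * (\<integral>\<^sup>+y\<in>V. ennreal (\<bar>g y\<bar> powr q * \<omega> y) \<partial>M))"

lemma testsD:
  assumes "tests M \<omega> q U V c" "g \<in> borel_measurable M" "0 < m"
    "ennreal m \<le> (\<integral>\<^sup>+y\<in>V. ennreal \<bar>g y\<bar> \<partial>M)"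
  shows "ennreal (m powr q) * weighted M \<omega> U \<le> ennreal c * (\<integral>\<^sup>+y\<in>V. ennreal (\<bar>g y\<bar> powr q * \<omega> y) \<partial>M)"
  using assms unfolding tests_def by blast

lemma weighted_mono: "A \<subseteq> B \<Longrightarrow> weighted M \<omega> A \<le> weighted M \<omega> B"
  unfolding weighted_def by (intro nn_integral_mono) (auto simp: indicator_def)

lemma weighted_eq_emeasure_density:
  assumes "\<omega> \<in> borel_measurable M" "A \<in> sets M"
  shows "weighted M \<omega> A = emeasure (density M (\<lambda>y. ennreal (\<omega> y))) A"
  using assms by (simp add: weighted_def emeasure_density)

lemma testsD_subset:
  assumes t: "tests M \<omega> q U V c" and g: "g \<in> borel_measurable M" and S: "S \<in> sets M" "S \<subseteq> V"
    and m: "0 < m" "ennreal m \<le> (\<integral>\<^sup>+y\<in>S. ennreal \<bar>g y\<bar> \<partial>M)"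
  shows "ennreal (m powr q) * weighted M \<omega> U \<le> ennreal c * (\<integral>\<^sup>+y\<in>S. ennreal (\<bar>g y\<bar> powr q * \<omega> y) \<partial>M)"
proof -
  let ?g = "\<lambda>y. g y * indicator S y"
  have gm: "?g \<in> borel_measurable M"
    using g S by measurable
  have 1: "(\<integral>\<^sup>+y\<in>V. ennreal \<bar>?g y\<bar> \<partial>M) = (\<integral>\<^sup>+y\<in>S. ennreal \<bar>g y\<bar> \<partial>M)"
    using S(2) by (intro nn_integral_cong) (auto simp: indicator_def)
  have 2: "(\<integral>\<^sup>+y\<in>V. ennreal (\<bar>?g y\<bar> powr q * \<omega> y) \<partial>M) = (\<integral>\<^sup>+y\<in>S. ennreal (\<bar>g y\<bar> powr q * \<omega> y) \<partial>M)"
    using S(2) by (intro nn_integral_cong) (auto simp: indicator_def)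
  show ?thesis
    using testsD[OF t gm m(1)] m(2) by (simp only: 1 2)
qed

lemma tests_mono:
  assumes t: "tests M \<omega> q U V c" and "U' \<subseteq> U" "V' \<subseteq> V" "V' \<in> sets M" "c \<le> c'"
  shows "tests M \<omega> q U' V' c'"
  unfolding tests_def
proof (intro ballI allI impI)
  fix g :: "_ \<Rightarrow> real" and m :: real
  assume g: "g \<in> borel_measurable M" and m: "0 < m" "ennreal m \<le> (\<integral>\<^sup>+y\<in>V'. ennreal \<bar>g y\<bar> \<partial>M)"
  have "ennreal (m powr q) * weighted M \<omega> U' \<le> ennreal (m powr q) * weighted M \<omega> U"
    using assms(2) by (intro mult_left_mono weighted_mono) auto
  also have "\<dots> \<le> ennreal c * (\<integral>\<^sup>+y\<in>V'. ennreal (\<bar>g y\<bar> powr q * \<omega> y) \<partial>M)"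
    by (rule testsD_subset[OF t g assms(4,3) m])
  also have "\<dots> \<le> ennreal c' * (\<integral>\<^sup>+y\<in>V'. ennreal (\<bar>g y\<bar> powr q * \<omega> y) \<partial>M)"
    using assms(5) by (intro mult_right_mono ennreal_leI) auto
  finally show "ennreal (m powr q) * weighted M \<omega> U'
    \<le> ennreal c' * (\<integral>\<^sup>+y\<in>V'. ennreal (\<bar>g y\<bar> powr q * \<omega> y) \<partial>M)" .
qed

lemma tests_trans:
  assumes t: "tests M \<omega> q U' V c" and U: "weighted M \<omega> U \<le> ennreal c1 * weighted M \<omega> U'" and c1: "0 \<le> c1"
  shows "tests M \<omega> q U V (c1 * c)"
  unfolding tests_def
proof (intro ballI allI impI)
  fix g :: "_ \<Rightarrow> real" and m :: real
  assume g: "g \<in> borel_measurable M" and m: "0 < m" "ennreal m \<le> (\<integral>\<^sup>+y\<in>V. ennreal \<bar>g y\<bar> \<partial>M)"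
  have "ennreal (m powr q) * weighted M \<omega> U \<le> ennreal (m powr q) * (ennreal c1 * weighted M \<omega> U')"
    using U by (intro mult_left_mono) auto
  also have "\<dots> = ennreal c1 * (ennreal (m powr q) * weighted M \<omega> U')"
    by (simp add: mult_ac)
  also have "\<dots> \<le> ennreal c1 * (ennreal c * (\<integral>\<^sup>+y\<in>V. ennreal (\<bar>g y\<bar> powr q * \<omega> y) \<partial>M))"
    by (intro mult_left_mono testsD[OF t g m]) auto
  also have "\<dots> = ennreal (c1 * c) * (\<integral>\<^sup>+y\<in>V. ennreal (\<bar>g y\<bar> powr q * \<omega> y) \<partial>M)"
    by (simp add: ennreal_mult'[OF c1] mult.assoc)
  finally show "ennreal (m powr q) * weighted M \<omega> U
    \<le> ennreal (c1 * c) * (\<integral>\<^sup>+y\<in>V. ennreal (\<bar>g y\<bar> powr q * \<omega> y) \<partial>M)" .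
qed

lemma nn_set_integral_UN_le:
  fixes h :: "'b \<Rightarrow> ennreal"
  assumes "finite J" "V \<subseteq> (\<Union>j\<in>J. A j)" "h \<in> borel_measurable M" "\<And>j. j \<in> J \<Longrightarrow> A j \<in> sets M"
  shows "(\<integral>\<^sup>+y\<in>V. h y \<partial>M) \<le> (\<Sum>j\<in>J. \<integral>\<^sup>+y\<in>A j. h y \<partial>M)"
proof -
  have "(\<integral>\<^sup>+y\<in>V. h y \<partial>M) \<le> (\<integral>\<^sup>+y. (\<Sum>j\<in>J. h y * indicator (A j) y) \<partial>M)"
  proof (rule nn_integral_mono)
    fix y
    show "h y * indicator V y \<le> (\<Sum>j\<in>J. h y * indicator (A j) y)"
    proof (cases "y \<in> V")
      case True
      then obtain j where j: "j \<in> J" "y \<in> A j"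
        using assms(2) by blast
      have "h y * indicator (A j) y \<le> (\<Sum>j\<in>J. h y * indicator (A j) y)"
        using j assms(1) by (intro member_le_sum) auto
      with j True show ?thesis
        by simp
    qed simp
  qed
  also have "\<dots> = (\<Sum>j\<in>J. \<integral>\<^sup>+y\<in>A j. h y \<partial>M)"
    using assms by (intro nn_integral_sum) auto
  finally show ?thesis .
qed

lemma tests_UN_right:
  assumes t: "\<And>j. j \<in> J \<Longrightarrow> tests M \<omega> q U (A j) c" and J: "finite J" "real (card J) \<le> n"
    and V: "V \<subseteq> (\<Union>j\<in>J. A j)" "V \<in> sets M" "\<And>j. j \<in> J \<Longrightarrow> A j \<in> sets M" and q: "0 < q" and c: "0 \<le> c"
  shows "tests M \<omega> q U V (n powr q * c)"
  unfolding tests_def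
proof (intro ballI allI impI)
  fix g :: "_ \<Rightarrow> real" and m :: real
  assume g: "g \<in> borel_measurable M" and m: "0 < m" "ennreal m \<le> (\<integral>\<^sup>+y\<in>V. ennreal \<bar>g y\<bar> \<partial>M)"
  note m(2)
  also have "(\<integral>\<^sup>+y\<in>V. ennreal \<bar>g y\<bar> \<partial>M) \<le> (\<Sum>j\<in>J. \<integral>\<^sup>+y\<in>A j \<inter> V. ennreal \<bar>g y\<bar> \<partial>M)"
    using V J g by (intro nn_set_integral_UN_le) auto
  finally have m2: "ennreal m \<le> (\<Sum>j\<in>J. \<integral>\<^sup>+y\<in>A j \<inter> V. ennreal \<bar>g y\<bar> \<partial>M)" .
  have "card J \<noteq> 0"
    using m2 m(1) J by (auto)
  with J have n: "n > 0" by linarith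
  have "\<exists>j\<in>J. ennreal (m / n) \<le> (\<integral>\<^sup>+y\<in>A j \<inter> V. ennreal \<bar>g y\<bar> \<partial>M)"
  proof (rule ccontr)
    assume "\<not> ?thesis"
    then have *: "\<And>j. j \<in> J \<Longrightarrow> (\<integral>\<^sup>+y\<in>A j \<inter> V. ennreal \<bar>g y\<bar> \<partial>M) < ennreal (m / n)"
      by auto
    have "(\<Sum>j\<in>J. \<integral>\<^sup>+y\<in>A j \<inter> V. ennreal \<bar>g y\<bar> \<partial>M) < (\<Sum>j\<in>J. ennreal (m / n))"
    proof -
      have fin: "\<And>j. j \<in> J \<Longrightarrow> (\<integral>\<^sup>+y\<in>A j \<inter> V. ennreal \<bar>g y\<bar> \<partial>M) = ennreal (enn2real (\<integral>\<^sup>+y\<in>A j \<inter> V. ennreal \<bar>g y\<bar> \<partial>M))"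
        by (rule ennreal_enn2real[symmetric]) (use * ennreal_less_top order_less_trans in blast)
      have "(\<Sum>j\<in>J. enn2real (\<integral>\<^sup>+y\<in>A j \<inter> V. ennreal \<bar>g y\<bar> \<partial>M)) < (\<Sum>j\<in>J. m / n)"
      proof (rule sum_strict_mono)
        fix j assume "j \<in> J"
        with *[OF this] fin[OF this] show "enn2real (\<integral>\<^sup>+y\<in>A j \<inter> V. ennreal \<bar>g y\<bar> \<partial>M) < m / n"
          by (subst ennreal_less_iff[symmetric]) auto
      qed (use J \<open>card J \<noteq> 0\<close> in auto)
      then have "ennreal (\<Sum>j\<in>J. enn2real (\<integral>\<^sup>+y\<in>A j \<inter> V. ennreal \<bar>g y\<bar> \<partial>M)) < ennreal (\<Sum>j\<in>J. m / n)"
        by (subst ennreal_less_iff) (auto intro: sum_nonneg)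
      moreover have "ennreal (\<Sum>j\<in>J. enn2real (\<integral>\<^sup>+y\<in>A j \<inter> V. ennreal \<bar>g y\<bar> \<partial>M)) = (\<Sum>j\<in>J. \<integral>\<^sup>+y\<in>A j \<inter> V. ennreal \<bar>g y\<bar> \<partial>M)"
        by (subst sum_ennreal[symmetric]) (use fin in \<open>auto intro!: sum.cong\<close>)
      moreover have "ennreal (\<Sum>j\<in>J. m / n) = (\<Sum>j\<in>J. ennreal (m / n))"
        by (subst sum_ennreal) (use m n in auto)
      ultimately show ?thesis by simp
    qed
    also have "\<dots> = ennreal (card J * (m / n))"
      using m n by (simp only: ennreal_mult' of_nat_0_le_iff sum_constant ennreal_of_nat_eq_real_of_nat)
    also have "\<dots> \<le> ennreal m"
      using m n J by (intro ennreal_leI) (simp add: field_simps)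
    finally show False
      using m2 by simp
  qed
  then obtain j where j: "j \<in> J" "ennreal (m / n) \<le> (\<integral>\<^sup>+y\<in>A j \<inter> V. ennreal \<bar>g y\<bar> \<partial>M)"
    by blast
  have "ennreal (m powr q) * weighted M \<omega> U = ennreal (n powr q) * (ennreal ((m / n) powr q) * weighted M \<omega> U)"
    using n m by (simp add: powr_divide mult.assoc[symmetric] ennreal_mult'[symmetric])
  also have "\<dots> \<le> ennreal (n powr q) * (ennreal c * (\<integral>\<^sup>+y\<in>A j \<inter> V. ennreal (\<bar>g y\<bar> powr q * \<omega> y) \<partial>M))"
    using j V m n by (intro mult_left_mono testsD_subset[OF t[OF j(1)] g]) auto
  also have "\<dots> \<le> ennreal (n powr q) * (ennreal c * (\<integral>\<^sup>+y\<in>V. ennreal (\<bar>g y\<bar> powr q * \<omega> y) \<partial>M))"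
    by (intro mult_left_mono nn_integral_mono) (auto simp: indicator_def)
  also have "\<dots> = ennreal (n powr q * c) * (\<integral>\<^sup>+y\<in>V. ennreal (\<bar>g y\<bar> powr q * \<omega> y) \<partial>M)"
    using c by (simp add: ennreal_mult mult_ac)
  finally show "ennreal (m powr q) * weighted M \<omega> U
    \<le> ennreal (n powr q * c) * (\<integral>\<^sup>+y\<in>V. ennreal (\<bar>g y\<bar> powr q * \<omega> y) \<partial>M)" .
qed

lemma weighted_UN_le:
  assumes "\<omega> \<in> borel_measurable M" "finite J" "U \<subseteq> (\<Union>j\<in>J. A j)" "\<And>j. j \<in> J \<Longrightarrow> A j \<in> sets M"
  shows "weighted M \<omega> U \<le> (\<Sum>j\<in>J. weighted M \<omega> (A j))"
  unfolding weighted_def using assms by (intro nn_set_integral_UN_le) auto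

lemma tests_UN_left:
  assumes t: "\<And>j. j \<in> J \<Longrightarrow> tests M \<omega> q (A j) V c" and J: "finite J" "real (card J) \<le> n"
    and U: "U \<subseteq> (\<Union>j\<in>J. A j)" "\<And>j. j \<in> J \<Longrightarrow> A j \<in> sets M" and c: "0 \<le> c"
    and w: "\<omega> \<in> borel_measurable M"
  shows "tests M \<omega> q U V (n * c)"
  unfolding tests_def
proof (intro ballI allI impI)
  fix g :: "_ \<Rightarrow> real" and m :: real
  assume g: "g \<in> borel_measurable M" and m: "0 < m" "ennreal m \<le> (\<integral>\<^sup>+y\<in>V. ennreal \<bar>g y\<bar> \<partial>M)"
  let ?I = "\<integral>\<^sup>+y\<in>V. ennreal (\<bar>g y\<bar> powr q * \<omega> y) \<partial>M"
  have "ennreal (m powr q) * weighted M \<omega> U \<le> ennreal (m powr q) * (\<Sum>j\<in>J. weighted M \<omega> (A j))"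
    by (intro mult_left_mono weighted_UN_le w J U) auto
  also have "\<dots> = (\<Sum>j\<in>J. ennreal (m powr q) * weighted M \<omega> (A j))"
    by (simp add: sum_distrib_left)
  also have "\<dots> \<le> (\<Sum>j\<in>J. ennreal c * ?I)"
    by (intro sum_mono testsD[OF t g m])
  also have "\<dots> = ennreal (card J * c) * ?I"
    using c by (simp add: ennreal_mult ennreal_of_nat_eq_real_of_nat mult_ac)
  also have "\<dots> \<le> ennreal (n * c) * ?I"
    using c J by (intro mult_right_mono ennreal_leI) auto
  finally show "ennreal (m powr q) * weighted M \<omega> U \<le> ennreal (n * c) * ?I" .
qed

text \<open>Young's inequality with a free parameter \<open>\<kappa>\<close> replaces Hoelder's inequality: it costs a factor
  \<open>2\<^sup>q\<close> but holds pointwise.\<close>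

lemma abs_le_weighted_power:
  fixes a w q \<kappa> :: real
  assumes "0 < w" "1 < q" "0 < \<kappa>"
  shows "\<bar>a\<bar> \<le> \<kappa> * (\<bar>a\<bar> powr q * w) + \<kappa> powr (- 1 / (q - 1)) * w powr (1 - conjugate_exponent q)"
proof (cases "\<bar>a\<bar> \<le> \<kappa> * (\<bar>a\<bar> powr q * w)")
  case False
  then have a: "0 < \<bar>a\<bar>" "\<kappa> * (\<bar>a\<bar> powr q * w) < \<bar>a\<bar>"
    using assms by auto
  have "\<bar>a\<bar> powr q = \<bar>a\<bar> * \<bar>a\<bar> powr (q - 1)"
    using a(1) by (simp add: powr_diff)
  with a have "\<bar>a\<bar> * (\<kappa> * (\<bar>a\<bar> powr (q - 1) * w)) < \<bar>a\<bar> * 1"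
    by (simp add: mult_ac)
  then have "\<kappa> * (\<bar>a\<bar> powr (q - 1) * w) < 1"
    using a(1) mult_less_cancel_left_pos by blast
  then have "\<bar>a\<bar> powr (q - 1) < 1 / (\<kappa> * w)"
    using assms by (simp add: field_simps)
  then have "(\<bar>a\<bar> powr (q - 1)) powr (1 / (q - 1)) < (1 / (\<kappa> * w)) powr (1 / (q - 1))"
    using assms by (intro powr_less_mono2) auto
  then have "\<bar>a\<bar> < (1 / (\<kappa> * w)) powr (1 / (q - 1))"
    using a assms by (simp add: powr_powr)
  also have "\<dots> = \<kappa> powr (- 1 / (q - 1)) * w powr (- 1 / (q - 1))"
  proof -
    have "x powr (- 1 / (q - 1)) = 1 / x powr (1 / (q - 1))" for x :: real
      using powr_minus_divide[of x "1 / (q - 1)"] by simp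
    then show ?thesis
      by (simp only: powr_divide powr_one_eq_one powr_mult) simp
  qed
  also have "\<dots> = \<kappa> powr (- 1 / (q - 1)) * w powr (1 - conjugate_exponent q)"
  proof -
    have "- 1 / (q - 1) = 1 - conjugate_exponent q"
      using assms by (simp add: conjugate_exponent_def field_simps)
    then show ?thesis
      by simp
  qed
  finally have "\<bar>a\<bar> < \<kappa> powr (- 1 / (q - 1)) * w powr (1 - conjugate_exponent q)" .
  moreover have "0 \<le> \<kappa> * (\<bar>a\<bar> powr q * w)"
    using assms by simp
  ultimately show ?thesis
    by linarith
qed (auto intro: add_increasing2)

lemma tests_of_dual_weight:
  assumes w: "\<omega> \<in> borel_measurable M" "AE y in M. 0 < \<omega> y" and q: "1 < q" and V: "V \<in> sets M"
    and U: "weighted M \<omega> U = ennreal u" "0 \<le> u"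
    and s: "(\<integral>\<^sup>+y\<in>V. ennreal (\<omega> y powr (1 - conjugate_exponent q)) \<partial>M) = ennreal s" "0 < s"
    and c: "u * s powr (q - 1) \<le> c"
  shows "tests M \<omega> q U V (2 powr q * c)"
  unfolding tests_def
proof (intro ballI allI impI)
  fix g :: "_ \<Rightarrow> real" and m :: real
  assume g: "g \<in> borel_measurable M" and m: "0 < m" "ennreal m \<le> (\<integral>\<^sup>+y\<in>V. ennreal \<bar>g y\<bar> \<partial>M)"
  let ?I = "\<integral>\<^sup>+y\<in>V. ennreal (\<bar>g y\<bar> powr q * \<omega> y) \<partial>M"
  let ?\<sigma> = "\<lambda>y. \<omega> y powr (1 - conjugate_exponent q)"
  define \<kappa> where "\<kappa> = (2 * s / m) powr (q - 1)"
  have \<kappa>: "\<kappa> > 0"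
    using s m by (simp add: \<kappa>_def)
  have ls: "\<kappa> powr (- 1 / (q - 1)) * s = m / 2"
    using s m q by (simp add: \<kappa>_def powr_powr powr_minus_divide)
  have "(\<integral>\<^sup>+y\<in>V. ennreal \<bar>g y\<bar> \<partial>M) \<le>
     (\<integral>\<^sup>+y. ennreal \<kappa> * (ennreal (\<bar>g y\<bar> powr q * \<omega> y) * indicator V y)
       + ennreal (\<kappa> powr (- 1 / (q - 1))) * (ennreal (?\<sigma> y) * indicator V y) \<partial>M)"
  proof (rule nn_integral_mono_AE, use w(2) in eventually_elim)
    fix y assume y: "0 < \<omega> y"
    have "ennreal \<bar>g y\<bar> \<le> ennreal (\<kappa> * (\<bar>g y\<bar> powr q * \<omega> y) + \<kappa> powr (- 1 / (q - 1)) * ?\<sigma> y)"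
      by (intro ennreal_leI abs_le_weighted_power y q \<kappa>)
    also have "\<dots> = ennreal \<kappa> * ennreal (\<bar>g y\<bar> powr q * \<omega> y) + ennreal (\<kappa> powr (- 1 / (q - 1))) * ennreal (?\<sigma> y)"
      using y \<kappa> by (simp add: ennreal_mult ennreal_plus)
    finally show "ennreal \<bar>g y\<bar> * indicator V y \<le> ennreal \<kappa> * (ennreal (\<bar>g y\<bar> powr q * \<omega> y) * indicator V y)
       + ennreal (\<kappa> powr (- 1 / (q - 1))) * (ennreal (?\<sigma> y) * indicator V y)"
      by (auto simp: indicator_def)
  qed
  also have "\<dots> = ennreal \<kappa> * ?I + ennreal (\<kappa> powr (- 1 / (q - 1))) * ennreal s"
  proof -
    have 1: "(\<lambda>y. ennreal (\<bar>g y\<bar> powr q * \<omega> y) * indicator V y) \<in> borel_measurable M"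
      using g w(1) V by measurable
    have 2: "(\<lambda>y. ennreal (?\<sigma> y) * indicator V y) \<in> borel_measurable M"
      using w(1) V by measurable
    show ?thesis
      using 1 2 by (simp add: nn_integral_add nn_integral_cmult s(1))
  qed
  also have "ennreal (\<kappa> powr (- 1 / (q - 1))) * ennreal s = ennreal (m / 2)"
    by (simp only: ls[symmetric] ennreal_mult'[OF powr_ge_zero])
  finally have "ennreal m \<le> ennreal \<kappa> * ?I + ennreal (m / 2)"
    using m by (auto intro: order_trans)
  moreover have "ennreal m = ennreal (m / 2) + ennreal (m / 2)"
    using m by (subst ennreal_plus[symmetric]) auto
  ultimately have "ennreal (m / 2) + ennreal (m / 2) \<le> ennreal (m / 2) + ennreal \<kappa> * ?I"
    by (simp add: add.commute)
  then have half: "ennreal (m / 2) \<le> ennreal \<kappa> * ?I"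
    by (simp add: ennreal_add_left_cancel_le)
  have id: "m powr q * u = 2 powr q * (u * s powr (q - 1)) * ((m / 2) / \<kappa>)"
  proof -
    have k: "\<kappa> * m powr (q - 1) = 2 powr (q - 1) * s powr (q - 1)"
      using s m by (simp add: \<kappa>_def powr_divide powr_mult)
    have 2: "2 powr q = 2 * 2 powr (q - 1)" and m': "m powr q = m * m powr (q - 1)"
      using m by (simp_all add: powr_diff)
    have "2 powr q * (u * s powr (q - 1)) * ((m / 2) / \<kappa>) = (2 powr (q - 1) * s powr (q - 1)) * (u * m) / \<kappa>"
      by (simp add: 2)
    also have "\<dots> = m powr q * u"
      using \<kappa> by (simp add: k[symmetric] m')
    finally show ?thesis ..
  qed
  have "ennreal (m powr q) * weighted M \<omega> U = ennreal (2 powr q * (u * s powr (q - 1)) * ((m / 2) / \<kappa>))"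
    using U by (simp only: id[symmetric]) (simp add: ennreal_mult)
  also have "\<dots> = ennreal (2 powr q * (u * s powr (q - 1))) * ennreal (1 / \<kappa>) * ennreal (m / 2)"
    using U s m \<kappa> by (simp add: ennreal_mult'[symmetric])
  also have "\<dots> \<le> ennreal (2 powr q * c) * ennreal (1 / \<kappa>) * (ennreal \<kappa> * ?I)"
    using half c U s by (intro mult_mono ennreal_leI) auto
  also have "\<dots> = ennreal (2 powr q * c) * (ennreal (1 / \<kappa>) * ennreal \<kappa>) * ?I"
    by (simp add: mult_ac)
  also have "ennreal (1 / \<kappa>) * ennreal \<kappa> = 1"
    using \<kappa> by (simp add: ennreal_mult'[symmetric])
  finally show "ennreal (m powr q) * weighted M \<omega> U \<le> ennreal (2 powr q * c) * ?I"
    by simp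
qed

lemma tests_indicator:
  assumes "tests M \<omega> q U V c" "S \<in> sets M" "S \<subseteq> V" "emeasure M S = ennreal m" "0 < m"
  shows "ennreal (m powr q) * weighted M \<omega> U \<le> ennreal c * weighted M \<omega> S"
proof -
  have "ennreal (m powr q) * weighted M \<omega> U \<le> ennreal c * (\<integral>\<^sup>+y\<in>S. ennreal (\<bar>1\<bar> powr q * \<omega> y) \<partial>M)"
    by (rule testsD_subset[OF assms(1)]) (use assms in auto)
  then show ?thesis
    by (simp add: weighted_def)
qed

section \<open>Parabolic cylinders and transport along geodesic chains\<close>

locale homogeneous_space =
  fixes K0 :: real and rho :: "'a \<Rightarrow> 'a \<Rightarrow> real" and mu :: "'a measure" and Cd :: real
  assumes qm: "quasi_metric K0 rho"
    and space_mu: "space mu = UNIV"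
    and sets_ball: "0 < r \<Longrightarrow> qball rho x r \<in> sets mu"
    and doubling: "0 < r \<Longrightarrow> emeasure mu (qball rho x (2 * r)) \<le> ennreal Cd * emeasure mu (qball rho x r)"
    and Cd: "1 \<le> Cd"
    and ball_pos: "0 < r \<Longrightarrow> 0 < emeasure mu (qball rho x r)"
    and ball_finite: "0 < r \<Longrightarrow> emeasure mu (qball rho x r) < \<infinity>"
begin

abbreviation "B \<equiv> qball rho"

lemma K0: "1 \<le> K0"
  and rho_nonneg [simp]: "0 \<le> rho x y"
  and rho_refl [simp]: "rho x x = 0"
  and rho_sym: "rho x y = rho y x"
  and rho_triangle: "rho x y \<le> K0 * (rho x w + rho w y)"
  using qm unfolding quasi_metric_def by blast+

lemma emeasure_ball: "0 < r \<Longrightarrow> emeasure mu (B x r) = ennreal (measure mu (B x r))"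
  using ball_finite[of r x] by (simp add: emeasure_eq_ennreal_measure)

lemma measure_ball_pos: "0 < r \<Longrightarrow> 0 < measure mu (B x r)"
  using ball_pos[of r x] ball_finite[of r x] by (simp add: emeasure_ball)

lemma ball_mono: "r \<le> s \<Longrightarrow> B x r \<subseteq> B x s"
  by (auto simp: qball_def)

lemma ball_subset_ball:
  assumes "K0 * (rho x y + r) \<le> s"
  shows "B y r \<subseteq> B x s"
proof
  fix w assume "w \<in> B y r"
  then have "K0 * (rho x y + rho y w) < K0 * (rho x y + r)"
    using K0 by (auto simp: qball_def)
  then show "w \<in> B x s"
    using rho_triangle[of x w y] assms by (auto simp: qball_def)
qed

lemma measure_ball_mono:
  assumes "B x r \<subseteq> B y s" "0 < r" "0 < s"
  shows "measure mu (B x r) \<le> measure mu (B y s)"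
  using assms emeasure_mono[OF assms(1) sets_ball] by (simp add: emeasure_ball)

lemma doubling_iterate:
  assumes "0 < r"
  shows "measure mu (B x (2 ^ n * r)) \<le> Cd ^ n * measure mu (B x r)"
proof (induction n)
  case (Suc n)
  have "emeasure mu (B x (2 * (2 ^ n * r))) \<le> ennreal Cd * emeasure mu (B x (2 ^ n * r))"
    using assms by (intro doubling) simp
  then have "measure mu (B x (2 * (2 ^ n * r))) \<le> Cd * measure mu (B x (2 ^ n * r))"
    using assms Cd by (simp add: emeasure_ball ennreal_mult'[symmetric])
  also have "\<dots> \<le> Cd * (Cd ^ n * measure mu (B x r))"
    using Cd Suc by (intro mult_left_mono) auto
  finally show ?case
    by (simp add: mult.assoc)
qed simp

lemma ball_comparison:
  assumes "0 < a"
  obtains C where "1 \<le> C"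
    "\<And>x y r. 0 < r \<Longrightarrow> rho x y \<le> a * r \<Longrightarrow> measure mu (B x (a * r)) \<le> C * measure mu (B y r)"
proof -
  obtain n where n: "2 * K0 * a < 2 ^ n"
    using real_arch_pow[of 2 "2 * K0 * a"] by auto
  have "measure mu (B x (a * r)) \<le> Cd ^ n * measure mu (B y r)" if "0 < r" "rho x y \<le> a * r" for x y r
  proof -
    have "K0 * (rho y x + a * r) \<le> K0 * (a * r + a * r)"
      using that K0 by (intro mult_left_mono) (auto simp: rho_sym)
    also have "\<dots> = 2 * K0 * a * r" by simp
    also have "\<dots> \<le> 2 ^ n * r"
      using n that by simp
    finally have "B x (a * r) \<subseteq> B y (2 ^ n * r)"
      by (rule ball_subset_ball)
    then have "measure mu (B x (a * r)) \<le> measure mu (B y (2 ^ n * r))"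
      using that assms by (intro measure_ball_mono) auto
    also have "\<dots> \<le> Cd ^ n * measure mu (B y r)"
      by (rule doubling_iterate[OF that(1)])
    finally show ?thesis .
  qed
  with Cd show ?thesis
    by (intro that[of "Cd ^ n"]) auto
qed

abbreviation "lam \<equiv> parabolic_measure mu"

lemma sets_times [measurable]: "A \<in> sets mu \<Longrightarrow> T \<in> sets lebesgue \<Longrightarrow> A \<times> T \<in> sets lam"
  unfolding parabolic_measure_def by (rule pair_measureI)

lemma sigma_finite_lebesgue: "sigma_finite_measure (lebesgue :: real measure)"
proof (rule sigma_finite_measure.intro, intro exI conjI ballI)
  show "\<Union> (range (\<lambda>n. {- real n..real n})) = space lebesgue"
  proof -
    have "\<exists>n. - real n \<le> x \<and> x \<le> real n" for x
      using real_arch_simple[of "\<bar>x\<bar>"] by (metis abs_le_iff minus_le_iff)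
    then show ?thesis
      by fastforce
  qed
qed auto

lemma emeasure_times:
  assumes "A \<in> sets mu" "T \<in> sets lebesgue"
  shows "emeasure lam (A \<times> T) = emeasure mu A * emeasure lebesgue T"
  unfolding parabolic_measure_def
  by (rule sigma_finite_measure.emeasure_pair_measure_Times[OF sigma_finite_lebesgue assms])

lemma emeasure_times_Ioo:
  assumes "A \<in> sets mu" "a \<le> b"
  shows "emeasure lam (A \<times> {a<..<b}) = emeasure mu A * ennreal (b - a)"
  using assms by (simp add: emeasure_times)

lemma emeasure_ball_times_Ioo:
  assumes "0 < r" "a \<le> b"
  shows "emeasure lam (B x r \<times> {a<..<b}) = ennreal (measure mu (B x r) * (b - a))"
  using assms by (simp add: emeasure_times_Ioo sets_ball emeasure_ball ennreal_mult)

end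

locale parabolic_space = homogeneous_space +
  fixes p :: real
  assumes geodesic: "monotone_geodesic rho" and p: "1 < p"
begin

lemma chain_of_balls:
  obtains M where "1 \<le> M"
    "\<And>x y l. 0 < l \<Longrightarrow> \<exists>m w. w 0 = x \<and> w m = y \<and> real m \<le> M * rho x y / l + 1
       \<and> (\<forall>i<m. rho (w i) (w (Suc i)) \<le> l / (2 * K0))"
proof -
  from geodesic[unfolded monotone_geodesic_def] obtain Kt where Kt: "Kt > 0" and
    geo: "\<forall>s>0. \<forall>x y. s \<le> rho x y \<longrightarrow> (\<exists>(m::nat) w. w 0 = x \<and> w m = y
           \<and> (\<forall>i<m. rho (w i) (w (Suc i)) \<le> Kt * s \<and> rho (w (Suc i)) (w m) \<le> rho (w i) (w m) - s))"
    by (elim exE conjE) (rule that)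
  define N where "N = 2 * K0 * max Kt 1"
  have N: "N \<ge> 1" "N > 0"
  proof -
    have "1 * 1 \<le> K0 * max Kt 1"
      using K0 by (intro mult_mono) auto
    then show "N \<ge> 1" "N > 0" by (simp_all add: N_def)
  qed
  show ?thesis
  proof (rule that[OF N(1)])
    fix x y and l :: real assume l: "0 < l"
    define s where "s = l / N"
    have s: "s > 0" using l N by (simp add: s_def)
    have sK: "max Kt 1 * s = l / (2 * K0)"
      using Kt K0 by (simp add: s_def N_def)
    have Ks: "Kt * s \<le> l / (2 * K0)" "s \<le> l / (2 * K0)"
      using s by (auto simp: sK[symmetric])
    show "\<exists>m w. w 0 = x \<and> w m = y \<and> real m \<le> N * rho x y / l + 1
       \<and> (\<forall>i<m. rho (w i) (w (Suc i)) \<le> l / (2 * K0))"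
    proof (cases "s \<le> rho x y")
      case False
      have "rho x y \<le> l / (2 * K0)" "0 \<le> N * rho x y / l"
        using False Ks N l by (linarith, simp)
      then show ?thesis
        by (intro exI[of _ 1] exI[of _ "\<lambda>i. if i = 0 then x else y"]) simp
    next
      case True
      from geo[rule_format, OF s True] obtain m w where w01: "w 0 = x" "w (m::nat) = y" and
        step: "\<forall>i<m. rho (w i) (w (Suc i)) \<le> Kt * s \<and> rho (w (Suc i)) (w m) \<le> rho (w i) (w m) - s"
        by (elim exE conjE) (rule that)
      note w = w01 step[rule_format, THEN conjunct1] step[rule_format, THEN conjunct2]
      have "i \<le> m \<Longrightarrow> rho (w i) y \<le> rho x y - real i * s" for i
      proof (induction i)
        case (Suc i)
        then show ?case
          using w(4)[of i] w(2) by (simp add: algebra_simps)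
      qed (use w in simp)
      from this[of m] have "real m * s \<le> rho x y"
        using rho_nonneg[of "w m" y] by linarith
      then have "real m \<le> N * rho x y / l + 1"
        using l N by (simp add: s_def field_simps)
      moreover have "rho (w i) (w (Suc i)) \<le> l / (2 * K0)" if "i < m" for i
        using w(3)[OF that] Ks by linarith
      ultimately show ?thesis
        using w(1,2) by blast
    qed
  qed
qed

end

locale one_sided_weight = parabolic_space K0 rho mu Cd p
  for K0 :: real and rho :: "'a \<Rightarrow> 'a \<Rightarrow> real" and mu :: "'a measure" and Cd p :: real +
  fixes \<omega> :: "'a \<times> real \<Rightarrow> real" and q \<gamma> :: real
  assumes A_plus: "\<omega> \<in> A_plus p rho mu q \<gamma>" and q: "1 < q" and \<gamma>: "0 \<le> \<gamma>" "\<gamma> < 1"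
begin

abbreviation "R\<^sub>m \<equiv> cylinder_minus p rho \<gamma>"
abbreviation "R\<^sub>p \<equiv> cylinder_plus p rho \<gamma>"
abbreviation "W \<equiv> weighted lam \<omega>"

lemma weight_measurable [measurable]: "\<omega> \<in> borel_measurable lam"
  and weight_pos: "AE y in lam. 0 < \<omega> y"
  using A_plus unfolding A_plus_def weight_def by auto

lemma nn_set_integral_pos:
  fixes h :: "'a \<times> real \<Rightarrow> real"
  assumes [measurable]: "h \<in> borel_measurable lam" "U \<in> sets lam"
    and "AE y in lam. 0 < h y" "0 < emeasure lam U"
  shows "0 < (\<integral>\<^sup>+y\<in>U. ennreal (h y) \<partial>lam)"
proof (rule ccontr)
  assume "\<not> ?thesis"
  then have "(\<integral>\<^sup>+y. ennreal (h y) * indicator U y \<partial>lam) = 0"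
    by simp
  then have "AE y in lam. ennreal (h y) * indicator U y = 0"
    by (subst (asm) nn_integral_0_iff_AE) auto
  with assms(3) have "AE y in lam. y \<notin> U"
    by eventually_elim (auto simp: indicator_def)
  then have "U \<in> null_sets lam"
    by (simp add: AE_iff_null_sets)
  with assms(4) show False
    by (simp add: null_sets_def)
qed

lemma W_pos: "U \<in> sets lam \<Longrightarrow> 0 < emeasure lam U \<Longrightarrow> 0 < W U"
  unfolding weighted_def by (rule nn_set_integral_pos) (auto simp: weight_pos)

lemma sets_cylinder_minus: "0 < l \<Longrightarrow> R\<^sub>m x t l \<in> sets lam"
  and sets_cylinder_plus: "0 < l \<Longrightarrow> R\<^sub>p x t l \<in> sets lam"
  unfolding cylinder_minus_def cylinder_plus_def by (auto intro!: sets_times sets_ball)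

lemma lag_mono: "0 < l \<Longrightarrow> \<gamma> * l powr p \<le> l powr p"
  using \<gamma> mult_right_mono[of \<gamma> 1 "l powr p"] by simp

lemma emeasure_cylinder_minus:
    "0 < l \<Longrightarrow> emeasure lam (R\<^sub>m x t l) = ennreal ((1 - \<gamma>) * l powr p * measure mu (B x l))"
  and emeasure_cylinder_plus:
    "0 < l \<Longrightarrow> emeasure lam (R\<^sub>p x t l) = ennreal ((1 - \<gamma>) * l powr p * measure mu (B x l))"
  using lag_mono unfolding cylinder_minus_def cylinder_plus_def
  by (simp_all add: emeasure_ball_times_Ioo algebra_simps)

lemma cylinder_tests:
  obtains A where "0 < A"
    "\<And>x t l. 0 < l \<Longrightarrow> tests lam \<omega> q (R\<^sub>m x t l) (R\<^sub>p x t l) (A * (l powr p * measure mu (B x l)) powr q)"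
proof -
  let ?\<sigma> = "\<lambda>y. \<omega> y powr (1 - conjugate_exponent q)"
  let ?P = "\<lambda>x t l. average lam (R\<^sub>m x t l) \<omega> * ennreal_powr (average lam (R\<^sub>p x t l) ?\<sigma>) (q - 1)"
  let ?S = "SUP (x, t, l) \<in> UNIV \<times> UNIV \<times> {0<..}. ?P x t l"
  have S: "?S < \<infinity>"
    using A_plus unfolding A_plus_def by blast
  define T where "T = enn2real ?S"
  have T: "?S = ennreal T" "0 \<le> T"
    using S unfolding T_def by (auto simp: less_top)
  have le: "?P x t l \<le> ennreal T" if "0 < l" for x t l
  proof -
    have "(\<lambda>(x, t, l). ?P x t l) (x, t, l) \<le> ?S"
      by (rule SUP_upper) (use that in auto)
    then show ?thesis
      using T by simp
  qed
  show ?thesis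
  proof (rule that[of "2 powr q * (T + 1)"])
    show "0 < 2 powr q * (T + 1)"
      using T by simp
  next
    fix x and t l :: real assume l: "0 < l"
    define a where "a = (1 - \<gamma>) * l powr p * measure mu (B x l)"
    have a: "0 < a"
      using \<gamma> l measure_ball_pos[OF l, of x] by (simp add: a_def)
    have a_le: "a \<le> l powr p * measure mu (B x l)"
      unfolding a_def using \<gamma> l measure_ball_pos[OF l, of x]
      by (simp add: mult_le_cancel_right1)
    have m: "emeasure lam (R\<^sub>m x t l) = ennreal a" "emeasure lam (R\<^sub>p x t l) = ennreal a"
      unfolding a_def using l by (simp_all add: emeasure_cylinder_minus emeasure_cylinder_plus)
    let ?s = "\<integral>\<^sup>+y\<in>R\<^sub>p x t l. ennreal (?\<sigma> y) \<partial>lam"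
    have u0: "0 < W (R\<^sub>m x t l)"
      using m a l by (intro W_pos sets_cylinder_minus) auto
    have s0: "0 < ?s"
    proof (rule nn_set_integral_pos)
      show "AE y in lam. 0 < ?\<sigma> y"
        using weight_pos by eventually_elim simp
    qed (use m a l sets_cylinder_plus in auto)
    have av: "average lam (R\<^sub>m x t l) \<omega> = W (R\<^sub>m x t l) / ennreal a" "average lam (R\<^sub>p x t l) ?\<sigma> = ?s / ennreal a"
      by (simp_all add: average_def weighted_def m)
    have P: "W (R\<^sub>m x t l) / ennreal a * ennreal_powr (?s / ennreal a) (q - 1) \<le> ennreal T"
      using le[OF l, of x t] by (simp add: av)
    have s_fin: "?s \<noteq> \<infinity>"
    proof
      assume "?s = \<infinity>"
      then have "ennreal_powr (?s / ennreal a) (q - 1) = \<infinity>"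
        by (simp add: ennreal_powr_def ennreal_top_divide)
      moreover have "W (R\<^sub>m x t l) / ennreal a \<noteq> 0"
        using u0 by (simp add: ennreal_divide_eq_0_iff)
      ultimately show False
        using P by (simp add: ennreal_mult_top top_unique)
    qed
    then obtain s where s: "?s = ennreal s" "0 < s"
      using s0 by (cases ?s) auto
    have pw: "ennreal_powr (ennreal s / ennreal a) (q - 1) = ennreal ((s / a) powr (q - 1))"
      using s a by (simp add: ennreal_powr_def divide_ennreal)
    note P = P[unfolded s(1) pw]
    have "W (R\<^sub>m x t l) \<noteq> \<infinity>"
    proof
      assume "W (R\<^sub>m x t l) = \<infinity>"
      then show False
        using P s a by (simp add: ennreal_top_divide ennreal_top_mult top_unique)
    qed
    then obtain u where u: "W (R\<^sub>m x t l) = ennreal u" "0 < u"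
      using u0 by (cases "W (R\<^sub>m x t l)") auto
    have eq: "u / a * (s / a) powr (q - 1) = u * s powr (q - 1) / a powr q"
      using u s a q by (simp add: powr_divide powr_diff)
    have "u / a * (s / a) powr (q - 1) \<le> T"
      using P T u s a by (simp add: divide_ennreal ennreal_mult'[symmetric])
    then have "u * s powr (q - 1) \<le> T * a powr q"
      unfolding eq using a by (simp add: pos_divide_le_eq)
    also have "\<dots> \<le> (T + 1) * (l powr p * measure mu (B x l)) powr q"
      using T a a_le q by (intro mult_mono powr_mono2) auto
    finally have "tests lam \<omega> q (R\<^sub>m x t l) (R\<^sub>p x t l)
      (2 powr q * ((T + 1) * (l powr p * measure mu (B x l)) powr q))"
      using u s l by (intro tests_of_dual_weight[OF _ _ q _ u(1) _ s]) (auto simp: weight_pos sets_cylinder_plus)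
    then show "tests lam \<omega> q (R\<^sub>m x t l) (R\<^sub>p x t l) (2 powr q * (T + 1) * (l powr p * measure mu (B x l)) powr q)"
      by (simp add: mult.assoc)
  qed
qed


lemma forward_step:
  obtains C where "1 \<le> C"
    "\<And>x x' t t' l. 0 < l \<Longrightarrow> rho x x' \<le> l / (2 * K0) \<Longrightarrow>
       \<bar>t' - t - (1 + \<gamma>) * l powr p\<bar> \<le> (1 - \<gamma>) / 2 * l powr p \<Longrightarrow>
       W (R\<^sub>m x t l) \<le> ennreal C * W (R\<^sub>m x' t' l)"
proof -
  obtain A where A: "0 < A" and tests: "\<And>x t l. 0 < l \<Longrightarrow>
      tests lam \<omega> q (R\<^sub>m x t l) (R\<^sub>p x t l) (A * (l powr p * measure mu (B x l)) powr q)"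
    by (rule cylinder_tests) (rule that)
  obtain D where D: "1 \<le> D" and cmp: "\<And>x y r. 0 < r \<Longrightarrow> rho x y \<le> 2 * K0 * r \<Longrightarrow>
      measure mu (B x (2 * K0 * r)) \<le> D * measure mu (B y r)"
    by (rule ball_comparison[of "2 * K0"]) (use K0 in simp, rule that)
  define C where "C = A * (2 * D / (1 - \<gamma>)) powr q"
  show ?thesis
  proof (rule that[of "max 1 C"])
    fix x x' and t t' l :: real
    assume l: "0 < l" and xx: "rho x x' \<le> l / (2 * K0)"
      and tt: "\<bar>t' - t - (1 + \<gamma>) * l powr p\<bar> \<le> (1 - \<gamma>) / 2 * l powr p"
    define L where "L = l powr p"
    have L: "L > 0" using l by (simp add: L_def)
    define r where "r = l / (2 * K0)"
    have r: "0 < r" "r \<le> l" "l = 2 * K0 * r"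
    proof -
      show "0 < r" "l = 2 * K0 * r" using l K0 by (auto simp: r_def)
      then show "r \<le> l" using K0 by simp
    qed
    define a where "a = max (t + \<gamma> * L) (t' - L)"
    define b where "b = min (t + L) (t' - \<gamma> * L)"
    have ab: "(1 - \<gamma>) / 2 * L \<le> b - a"
    proof -
      define g where "g = \<gamma> * L"
      have "(1 + \<gamma>) * L = L + g" "(1 - \<gamma>) / 2 * L = (L - g) / 2" "g \<le> L"
        using lag_mono[OF l] by (simp_all add: g_def L_def field_simps)
      then show ?thesis
        using tt unfolding a_def b_def L_def[symmetric] g_def[symmetric]
        by (auto simp: abs_le_iff min_def max_def field_simps)
    qed
    have Bsub: "B x' r \<subseteq> B x l"
    proof (rule ball_subset_ball)
      have "K0 * (rho x x' + r) \<le> K0 * (r + r)"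
        using xx K0 by (intro mult_left_mono) (auto simp: r_def)
      then show "K0 * (rho x x' + r) \<le> l"
        using r(3) by simp
    qed
    define S where "S = B x' r \<times> {a<..<b}"
    define m where "m = measure mu (B x' r) * (b - a)"
    have ab0: "0 < b - a"
    proof -
      have "0 < (1 - \<gamma>) / 2 * L" using \<gamma> L by simp
      with ab show ?thesis by linarith
    qed
    have m0: "0 < m"
      using ab0 measure_ball_pos[OF r(1)] by (simp add: m_def)
    have S: "S \<in> sets lam" "emeasure lam S = ennreal m"
      using r ab0 by (auto simp: S_def m_def emeasure_ball_times_Ioo intro!: sets_times sets_ball)
    have Sp: "S \<subseteq> R\<^sub>p x t l"
      using Bsub by (auto simp: S_def cylinder_plus_def a_def b_def L_def)
    have Sm: "S \<subseteq> R\<^sub>m x' t' l"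
      using ball_mono[OF r(2)] by (auto simp: S_def cylinder_minus_def a_def b_def L_def)
    have mass: "L * measure mu (B x l) \<le> (2 * D / (1 - \<gamma>)) * m"
    proof -
      have "measure mu (B x l) \<le> D * measure mu (B x' r)"
      proof -
        have "r \<le> 2 * K0 * r"
          using r by linarith
        then have "rho x x' \<le> 2 * K0 * r"
          using xx by (simp add: r_def[symmetric])
        from cmp[OF r(1) this] show ?thesis
          by (simp only: r(3)[symmetric])
      qed
      then have "L * measure mu (B x l) \<le> L * (D * measure mu (B x' r))"
        using L by (intro mult_left_mono) auto
      also have "\<dots> = (2 * D / (1 - \<gamma>)) * (measure mu (B x' r) * ((1 - \<gamma>) / 2 * L))"
        using \<gamma> by (simp add: field_simps)
      also have "\<dots> \<le> (2 * D / (1 - \<gamma>)) * (measure mu (B x' r) * (b - a))"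
        using ab D \<gamma> by (intro mult_left_mono) auto
      finally show ?thesis by (simp add: m_def)
    qed
    have "ennreal (m powr q) * W (R\<^sub>m x t l) \<le> ennreal (A * (L * measure mu (B x l)) powr q) * W S"
      unfolding L_def by (rule tests_indicator[OF tests[OF l] S(1) Sp S(2) m0])
    also have "\<dots> \<le> ennreal (m powr q * C) * W S"
    proof (intro mult_right_mono ennreal_leI)
      have "(L * measure mu (B x l)) powr q \<le> ((2 * D / (1 - \<gamma>)) * m) powr q"
        using mass q L by (intro powr_mono2) auto
      also have "\<dots> = (2 * D / (1 - \<gamma>)) powr q * m powr q"
        by (rule powr_mult)
      finally show "A * (L * measure mu (B x l)) powr q \<le> m powr q * C"
        using A unfolding C_def by (simp add: mult_ac)
    qed auto
    also have "\<dots> = ennreal (m powr q) * (ennreal C * W S)"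
      by (simp add: ennreal_mult' mult.assoc)
    finally have "W (R\<^sub>m x t l) \<le> ennreal C * W S"
      using m0 by (subst (asm) ennreal_mult_le_mult_iff) auto
    also have "\<dots> \<le> ennreal (max 1 C) * W (R\<^sub>m x' t' l)"
      by (intro mult_mono ennreal_leI weighted_mono Sm) auto
    finally show "W (R\<^sub>m x t l) \<le> ennreal (max 1 C) * W (R\<^sub>m x' t' l)" .
  qed simp
qed

text \<open>Since \<open>p > 1\<close>, a geodesic chain of \<open>n\<close> balls of radius \<open>l\<close> costs the time \<open>n l\<^sup>p\<close>, which
  is small compared with \<open>(n l)\<^sup>p\<close>; hence any forward time shift above this threshold is possible.\<close>

lemma forward_transport:
  obtains C M where "1 \<le> C" "1 \<le> M"
    "\<And>x y t t' l T. 0 < l \<Longrightarrow> (M * rho x y / l + M) * l powr p \<le> t' - t \<Longrightarrow> t' - t \<le> T * l powr p \<Longrightarrow>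
       W (R\<^sub>m x t l) \<le> ennreal (C powr (T + 1)) * W (R\<^sub>m y t' l)"
proof -
  obtain C where C: "1 \<le> C" and step: "\<And>x x' t t' l. 0 < l \<Longrightarrow> rho x x' \<le> l / (2 * K0) \<Longrightarrow>
       \<bar>t' - t - (1 + \<gamma>) * l powr p\<bar> \<le> (1 - \<gamma>) / 2 * l powr p \<Longrightarrow>
       W (R\<^sub>m x t l) \<le> ennreal C * W (R\<^sub>m x' t' l)"
    by (rule forward_step) (rule that)
  obtain N where N: "1 \<le> N" and chain: "\<And>x y l. 0 < l \<Longrightarrow> \<exists>m w. w 0 = x \<and> w m = y
       \<and> real m \<le> N * rho x y / l + 1 \<and> (\<forall>i<m. rho (w i) (w (Suc i)) \<le> l / (2 * K0))"
    by (rule chain_of_balls) (rule that)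
  have iter: "W (R\<^sub>m (w 0) t l) \<le> ennreal (C ^ n) * W (R\<^sub>m (w n) (t + real n * h) l)"
    if l: "0 < l" and w: "\<And>i. i < n \<Longrightarrow> rho (w i) (w (Suc i)) \<le> l / (2 * K0)"
      and h: "\<bar>h - (1 + \<gamma>) * l powr p\<bar> \<le> (1 - \<gamma>) / 2 * l powr p" for w n t l h
    using w
  proof (induction n)
    case (Suc n)
    have "W (R\<^sub>m (w 0) t l) \<le> ennreal (C ^ n) * W (R\<^sub>m (w n) (t + real n * h) l)"
      using Suc by simp
    also have "\<dots> \<le> ennreal (C ^ n) * (ennreal C * W (R\<^sub>m (w (Suc n)) (t + real (Suc n) * h) l))"
      using h by (intro mult_left_mono step l Suc.prems) (auto simp: algebra_simps)
    also have "\<dots> = ennreal (C ^ Suc n) * W (R\<^sub>m (w (Suc n)) (t + real (Suc n) * h) l)"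
      using C by (simp add: ennreal_mult' mult_ac)
    finally show ?case .
  qed simp
  define M where "M = 2 * N + 4 / (1 - \<gamma>)"
  have M: "1 \<le> M" "2 * N \<le> M"
    using N \<gamma> by (auto simp: M_def intro: add_increasing2)
  show ?thesis
  proof (rule that[OF C M(1)])
    fix x y and t t' l T :: real
    assume l: "0 < l" and lo: "(M * rho x y / l + M) * l powr p \<le> t' - t" and hi: "t' - t \<le> T * l powr p"
    define L where "L = l powr p"
    have L: "L > 0" using l by (simp add: L_def)
    define D where "D = (t' - t) / L"
    have D_hi: "D \<le> T" and D_lo: "M * rho x y / l + M \<le> D"
      using lo hi L unfolding L_def[symmetric] by (auto simp: D_def field_simps)
    have rho0: "0 \<le> rho x y / l"
      using l by simp
    define b where "b = (3 + \<gamma>) / 2"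
    define a where "a = (1 + 3 * \<gamma>) / 2"
    have ab: "0 < a" "1 \<le> b" "b \<le> 2" "b - a = 1 - \<gamma>" "a < b"
      using \<gamma> by (auto simp: a_def b_def field_simps)
    define n where "n = nat \<lceil>D / b\<rceil>"
    have D1: "1 \<le> D"
    proof -
      have "0 \<le> M * (rho x y / l)" using M rho0 by (intro mult_nonneg_nonneg) auto
      then show ?thesis using D_lo M by simp
    qed
    have n: "D / b \<le> real n" "real n < D / b + 1"
      using D1 ab by (auto simp: n_def) linarith+
    have n0: "0 < n"
    proof -
      have "0 < D / b" using D1 ab by simp
      with n show ?thesis by linarith
    qed
    have na: "real n * a \<le> D"
    proof -
      have "real n * a \<le> (D / b + 1) * a"
        using n ab by (intro mult_right_mono) auto
      also have "\<dots> = D - (D * (1 - \<gamma>) - a * b) / b"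
        using ab by (simp add: field_simps flip: ab(4))
      also have "\<dots> \<le> D"
      proof -
        have "a * b \<le> 2 * 2"
          using ab by (intro mult_mono) auto
        also have "4 / (1 - \<gamma>) \<le> D"
        proof -
          have "0 \<le> M * (rho x y / l)" using M rho0 by (intro mult_nonneg_nonneg) auto
          then show ?thesis using D_lo N by (simp add: M_def)
        qed
        then have "2 * 2 \<le> D * (1 - \<gamma>)"
          using \<gamma> by (simp add: field_simps)
        finally show ?thesis
          using ab by simp
      qed
      finally show ?thesis .
    qed
    define h where "h = (t' - t) / real n"
    have hD: "h = D / real n * L"
      using L by (simp add: h_def D_def)
    have h: "\<bar>h - (1 + \<gamma>) * L\<bar> \<le> (1 - \<gamma>) / 2 * L"
    proof -
      have "a \<le> D / real n" "D / real n \<le> b"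
        using na n n0 ab by (auto simp: field_simps)
      then have "a * L \<le> h" "h \<le> b * L"
        unfolding hD using L by (intro mult_right_mono; simp)+
      then show ?thesis
        by (intro abs_leI) (simp_all add: a_def b_def field_simps)
    qed
    obtain m w where w: "w 0 = x" "w m = y" "real m \<le> N * rho x y / l + 1"
      "\<forall>i<m. rho (w i) (w (Suc i)) \<le> l / (2 * K0)"
      using chain[OF l, of x y] by blast
    have "m \<le> n"
    proof -
      have "b * real m \<le> 2 * (N * (rho x y / l) + 1)"
        using w(3) ab by (intro mult_mono) auto
      also have "\<dots> \<le> (2 * N) * (rho x y / l) + 2 * N"
        using N by simp
      also have "\<dots> \<le> M * (rho x y / l) + M"
        using M rho0 by (intro add_mono mult_right_mono) auto
      also have "\<dots> \<le> D"
        using D_lo by simp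
      finally have "real m \<le> D / b"
        using ab by (simp add: field_simps)
      with n show ?thesis by linarith
    qed
    have "W (R\<^sub>m (w (min 0 m)) t l) \<le> ennreal (C ^ n) * W (R\<^sub>m (w (min n m)) (t + real n * h) l)"
    proof (rule iter[OF l, where w = "\<lambda>i. w (min i m)"])
      fix i
      show "rho (w (min i m)) (w (min (Suc i) m)) \<le> l / (2 * K0)"
      proof (cases "i < m")
        case True
        with w(4) show ?thesis by (simp add: min_def)
      next
        case False
        then show ?thesis using l K0 by simp
      qed
    qed (use h in \<open>simp add: L_def\<close>)
    then have "W (R\<^sub>m x t l) \<le> ennreal (C ^ n) * W (R\<^sub>m y t' l)"
      using w(1,2) \<open>m \<le> n\<close> n0 by (simp add: h_def)
    also have "\<dots> \<le> ennreal (C powr (T + 1)) * W (R\<^sub>m y t' l)"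
    proof (intro mult_right_mono ennreal_leI)
      have "D / b \<le> D"
        using ab D1 by (simp add: field_simps)
      then have "real n \<le> T + 1"
        using n D_hi by linarith
      then have "C powr real n \<le> C powr (T + 1)"
        using C by (intro powr_mono)
      then show "C ^ n \<le> C powr (T + 1)"
        using C by (simp add: powr_realpow)
    qed simp
    finally show "W (R\<^sub>m x t l) \<le> ennreal (C powr (T + 1)) * W (R\<^sub>m y t' l)" .
  qed
qed

end

section \<open>The testing condition for dyadic rectangles\<close>

lemma disjoint_family_finite_card:
  assumes disj: "disjoint_family_on A J" and sets: "\<And>j. j \<in> J \<Longrightarrow> A j \<in> sets M"
    and sub: "\<And>j. j \<in> J \<Longrightarrow> A j \<subseteq> S" and S: "S \<in> sets M" "emeasure M S \<le> ennreal s" "0 \<le> s"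
    and e: "\<And>j. j \<in> J \<Longrightarrow> ennreal e \<le> emeasure M (A j)" "0 < e"
  shows "finite J \<and> real (card J) \<le> s / e"
proof -
  have F: "real (card F) \<le> s / e" if F: "F \<subseteq> J" "finite F" for F
  proof -
    have "ennreal (card F * e) = (\<Sum>j\<in>F. ennreal e)"
      using e by (simp only: ennreal_mult' of_nat_0_le_iff sum_constant ennreal_of_nat_eq_real_of_nat)
    also have "\<dots> \<le> (\<Sum>j\<in>F. emeasure M (A j))"
      using F e by (intro sum_mono) auto
    also have "\<dots> = emeasure M (\<Union>j\<in>F. A j)"
      using F disj sets by (intro sum_emeasure) (auto intro: disjoint_family_on_mono)
    also have "\<dots> \<le> emeasure M S"
      using F sub S by (intro emeasure_mono) auto
    also have "\<dots> \<le> ennreal s"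
      by (rule S)
    finally have "card F * e \<le> s"
      using S by simp
    then show ?thesis
      using e by (simp add: field_simps)
  qed
  have "finite J \<and> card J \<le> nat \<lfloor>s / e\<rfloor>"
  proof (rule finite_if_finite_subsets_card_bdd)
    fix F assume "F \<subseteq> J" "finite F"
    from F[OF this] show "card F \<le> nat \<lfloor>s / e\<rfloor>"
      by (simp add: le_nat_floor)
  qed
  with F[of J] show ?thesis by blast
qed

locale dyadic_weight = one_sided_weight K0 rho mu Cd p \<omega> q \<gamma>
  for K0 :: real and rho :: "'a \<Rightarrow> 'a \<Rightarrow> real" and mu Cd p \<omega> q \<gamma> +
  fixes \<delta> c1 C1 :: real and I :: "int \<Rightarrow> 'i set" and z :: "int \<Rightarrow> 'i \<Rightarrow> 'a" and Q :: "int \<Rightarrow> 'i \<Rightarrow> 'a set"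
  assumes \<delta>: "0 < \<delta>" "\<delta> \<le> 1 / 2" and c1: "0 < c1" and C1: "0 < C1"
    and sets_cube: "\<alpha> \<in> I k \<Longrightarrow> Q k \<alpha> \<in> sets mu"
    and nested: "k \<le> l \<Longrightarrow> \<alpha> \<in> I k \<Longrightarrow> \<beta> \<in> I l \<Longrightarrow> Q l \<beta> \<inter> Q k \<alpha> \<noteq> {} \<Longrightarrow> Q l \<beta> \<subseteq> Q k \<alpha>"
    and cubes_cover: "(\<Union>\<alpha>\<in>I k. Q k \<alpha>) = UNIV"
    and cubes_disjoint: "disjoint_family_on (Q k) (I k)"
    and cube_inner: "\<alpha> \<in> I k \<Longrightarrow> qball rho (z k \<alpha>) (c1 * \<delta> powr k) \<subseteq> Q k \<alpha>"
    and cube_outer: "\<alpha> \<in> I k \<Longrightarrow> Q k \<alpha> \<subseteq> qball rho (z k \<alpha>) (C1 * \<delta> powr k)"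
begin

definition L :: "int \<Rightarrow> real" where "L k = \<delta> powr (k * p)"

lemma L_pos [simp]: "0 < L k"
  using \<delta> by (simp add: L_def)

lemma L_nonneg [simp]: "0 \<le> L k"
  by (rule less_imp_le) simp

lemma scale_pos [simp]: "0 < \<delta> powr k"
  using \<delta> by simp

lemma scale_powr: "0 \<le> a \<Longrightarrow> (a * \<delta> powr real_of_int k) powr p = a powr p * L k"
  by (simp add: L_def powr_mult powr_powr)

abbreviation "cubem k \<alpha> \<equiv> measure mu (Q k \<alpha>)"

lemma center_in_cube: "\<alpha> \<in> I k \<Longrightarrow> z k \<alpha> \<in> Q k \<alpha>"
  using cube_inner[of \<alpha> k] c1 scale_pos[of k] by (force simp: qball_def)

lemma emeasure_cube:
  assumes "\<alpha> \<in> I k"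
  shows "emeasure mu (Q k \<alpha>) = ennreal (cubem k \<alpha>)" "0 < cubem k \<alpha>"
proof -
  have "emeasure mu (Q k \<alpha>) \<le> emeasure mu (B (z k \<alpha>) (C1 * \<delta> powr k))"
    using C1 \<delta> by (intro emeasure_mono cube_outer assms sets_ball) auto
  also have "\<dots> < \<infinity>"
    using C1 \<delta> by (intro ball_finite) auto
  finally show fin: "emeasure mu (Q k \<alpha>) = ennreal (cubem k \<alpha>)"
    by (simp add: emeasure_eq_ennreal_measure)
  have "0 < emeasure mu (B (z k \<alpha>) (c1 * \<delta> powr k))"
    using c1 \<delta> by (intro ball_pos) auto
  also have "\<dots> \<le> emeasure mu (Q k \<alpha>)"
    using assms by (intro emeasure_mono cube_inner sets_cube) auto
  finally show "0 < cubem k \<alpha>"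
    by (simp add: fin)
qed

lemma cube_mono:
  assumes "\<alpha> \<in> I k" "\<beta> \<in> I l" "Q l \<beta> \<subseteq> Q k \<alpha>"
  shows "cubem l \<beta> \<le> cubem k \<alpha>"
  using emeasure_mono[OF assms(3) sets_cube[OF assms(1)]] emeasure_cube[OF assms(1)] emeasure_cube[OF assms(2)]
  by simp

lemma ball_le_subcube:
  fixes a :: real
  assumes "C1 \<le> a"
  obtains C where "1 \<le> C"
    "\<And>k \<alpha> \<beta>. \<alpha> \<in> I k \<Longrightarrow> \<beta> \<in> I (k + int N) \<Longrightarrow> Q (k + int N) \<beta> \<subseteq> Q k \<alpha> \<Longrightarrow>
       measure mu (B (z k \<alpha>) (a * \<delta> powr k)) \<le> C * cubem (k + int N) \<beta>"
proof -
  define e where "e = a / (c1 * \<delta> powr real N)"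
  have e: "0 < e"
    using assms C1 c1 \<delta> by (simp add: e_def)
  obtain C where C: "1 \<le> C" and cmp: "\<And>x y r. 0 < r \<Longrightarrow> rho x y \<le> e * r \<Longrightarrow>
      measure mu (B x (e * r)) \<le> C * measure mu (B y r)"
    using e by (rule ball_comparison) (rule that)
  show ?thesis
  proof (rule that[OF C])
    fix k \<alpha> \<beta> assume ab: "\<alpha> \<in> I k" "\<beta> \<in> I (k + int N)" "Q (k + int N) \<beta> \<subseteq> Q k \<alpha>"
    define r where "r = c1 * \<delta> powr (k + int N)"
    have r: "0 < r"
      using c1 \<delta> by (simp add: r_def)
    have er: "e * r = a * \<delta> powr k"
      using c1 \<delta> by (simp add: e_def r_def powr_add)
    have "z (k + int N) \<beta> \<in> B (z k \<alpha>) (C1 * \<delta> powr k)"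
      using center_in_cube[OF ab(2)] ab(3) cube_outer[OF ab(1)] by blast
    then have "rho (z k \<alpha>) (z (k + int N) \<beta>) < C1 * \<delta> powr k"
      by (simp add: qball_def)
    also have "\<dots> \<le> a * \<delta> powr k"
      using assms by (intro mult_right_mono) auto
    finally have "measure mu (B (z k \<alpha>) (e * r)) \<le> C * measure mu (B (z (k + int N) \<beta>) r)"
      by (intro cmp r) (simp add: er)
    also have "measure mu (B (z (k + int N) \<beta>) r) \<le> cubem (k + int N) \<beta>"
      using emeasure_mono[OF cube_inner[OF ab(2)] sets_cube[OF ab(2)]] r
      by (simp add: emeasure_cube[OF ab(2)] emeasure_ball r_def)
    finally show "measure mu (B (z k \<alpha>) (a * \<delta> powr k)) \<le> C * cubem (k + int N) \<beta>"
      using C by (simp add: er)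
  qed
qed

definition subcubes :: "nat \<Rightarrow> int \<Rightarrow> 'i \<Rightarrow> 'i set" where
  "subcubes N k \<alpha> = {\<beta> \<in> I (k + int N). Q (k + int N) \<beta> \<subseteq> Q k \<alpha>}"

lemma cube_subset_subcubes:
  assumes "\<alpha> \<in> I k"
  shows "Q k \<alpha> \<subseteq> (\<Union>\<beta>\<in>subcubes N k \<alpha>. Q (k + int N) \<beta>)"
proof
  fix x assume x: "x \<in> Q k \<alpha>"
  obtain \<beta> where b: "\<beta> \<in> I (k + int N)" "x \<in> Q (k + int N) \<beta>"
    using cubes_cover[of "k + int N"] by blast
  with x nested[OF _ assms b(1)] have "Q (k + int N) \<beta> \<subseteq> Q k \<alpha>"
    by auto
  with b show "x \<in> (\<Union>\<beta>\<in>subcubes N k \<alpha>. Q (k + int N) \<beta>)"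
    by (auto simp: subcubes_def)
qed

lemma card_subcubes:
  obtains n :: real where "1 \<le> n" "\<And>k \<alpha>. \<alpha> \<in> I k \<Longrightarrow> finite (subcubes N k \<alpha>) \<and> real (card (subcubes N k \<alpha>)) \<le> n"
proof -
  obtain C where C: "1 \<le> C" and cmp: "\<And>k \<alpha> \<beta>. \<alpha> \<in> I k \<Longrightarrow> \<beta> \<in> I (k + int N) \<Longrightarrow> Q (k + int N) \<beta> \<subseteq> Q k \<alpha> \<Longrightarrow>
       measure mu (B (z k \<alpha>) (C1 * \<delta> powr k)) \<le> C * cubem (k + int N) \<beta>"
    using order_refl by (rule ball_le_subcube[where N = N]) (rule that)
  show ?thesis
  proof (rule that[OF C])
    fix k \<alpha> assume a: "\<alpha> \<in> I k"
    let ?m = "cubem k \<alpha>"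
    have m: "0 < ?m" "emeasure mu (Q k \<alpha>) = ennreal ?m"
      using emeasure_cube[OF a] by auto
    have le: "?m / C \<le> cubem (k + int N) \<beta>" if "\<beta> \<in> subcubes N k \<alpha>" for \<beta>
    proof -
      have "?m \<le> measure mu (B (z k \<alpha>) (C1 * \<delta> powr k))"
        using emeasure_mono[OF cube_outer[OF a] sets_ball] C1 \<delta> by (simp add: m emeasure_ball)
      also have "\<dots> \<le> C * cubem (k + int N) \<beta>"
        using that a by (intro cmp) (auto simp: subcubes_def)
      finally show ?thesis
        using C by (simp add: field_simps)
    qed
    have "finite (subcubes N k \<alpha>) \<and> real (card (subcubes N k \<alpha>)) \<le> ?m / (?m / C)"
    proof (rule disjoint_family_finite_card[where M = mu and S = "Q k \<alpha>" and A = "Q (k + int N)"])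
      show "disjoint_family_on (Q (k + int N)) (subcubes N k \<alpha>)"
        by (rule disjoint_family_on_mono[OF _ cubes_disjoint]) (auto simp: subcubes_def)
      show "ennreal (?m / C) \<le> emeasure mu (Q (k + int N) \<beta>)" if "\<beta> \<in> subcubes N k \<alpha>" for \<beta>
      proof -
        have "\<beta> \<in> I (k + int N)" using that by (simp add: subcubes_def)
        from emeasure_cube(1)[OF this] le[OF that] show ?thesis
          by (simp add: ennreal_leI)
      qed
    qed (use a m C in \<open>auto simp: subcubes_def sets_cube\<close>)
    with m show "finite (subcubes N k \<alpha>) \<and> real (card (subcubes N k \<alpha>)) \<le> C"
      by simp
  qed
qed

lemma countable_cubes: "countable (I k)"
proof -
  obtain x0 :: 'a where True by blast
  define J where "J n = {\<alpha> \<in> I k. rho x0 (z k \<alpha>) \<le> real n}" for n :: nat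
  define r where "r = c1 * \<delta> powr k"
  have r: "0 < r"
    using c1 \<delta> by (simp add: r_def)
  have fin: "finite (J n)" for n
  proof -
    define e where "e = K0 * (real n + r) / r"
    define S where "S = B x0 (K0 * (real n + r))"
    have Kp: "0 < K0 * (real n + r)"
      using K0 r by (intro mult_pos_pos) auto
    have e: "0 < e" "e * r = K0 * (real n + r)"
      using Kp r by (auto simp: e_def)
    obtain C where C: "1 \<le> C" and cmp: "\<And>x y r. 0 < r \<Longrightarrow> rho x y \<le> e * r \<Longrightarrow>
        measure mu (B x (e * r)) \<le> C * measure mu (B y r)"
      using e(1) by (rule ball_comparison) (rule that)
    have mS: "emeasure mu S = ennreal (measure mu S)" "0 < measure mu S"
      unfolding S_def using Kp by (auto simp: emeasure_ball measure_ball_pos)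
    have "finite (J n) \<and> real (card (J n)) \<le> measure mu S / (measure mu S / C)"
    proof (rule disjoint_family_finite_card[where M = mu and S = S and A = "\<lambda>\<alpha>. B (z k \<alpha>) r"])
      show "disjoint_family_on (\<lambda>\<alpha>. B (z k \<alpha>) r) (J n)"
        using cubes_disjoint[of k] cube_inner[of _ k] unfolding disjoint_family_on_def J_def r_def by blast
      fix \<alpha> assume a: "\<alpha> \<in> J n"
      then have rho: "rho x0 (z k \<alpha>) \<le> real n" by (simp add: J_def)
      show "B (z k \<alpha>) r \<subseteq> S"
        unfolding S_def using rho K0 by (intro ball_subset_ball mult_left_mono) auto
      have "rho x0 (z k \<alpha>) \<le> e * r"
      proof -
        have "rho x0 (z k \<alpha>) \<le> 1 * (real n + r)"
          using rho r by simp
        also have "\<dots> \<le> K0 * (real n + r)"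
          using K0 r by (intro mult_right_mono) auto
        finally show ?thesis
          by (simp only: e(2))
      qed
      from cmp[OF r this] have "measure mu S \<le> C * measure mu (B (z k \<alpha>) r)"
        by (simp add: S_def e)
      then show "ennreal (measure mu S / C) \<le> emeasure mu (B (z k \<alpha>) r)"
        using C r by (simp add: emeasure_ball ennreal_leI field_simps)
    qed (use r C mS Kp in \<open>auto simp: S_def intro: sets_ball\<close>)
    then show ?thesis ..
  qed
  have "I k \<subseteq> (\<Union>n. J n)"
  proof
    fix \<alpha> assume "\<alpha> \<in> I k"
    then show "\<alpha> \<in> (\<Union>n. J n)"
      using real_arch_simple[of "rho x0 (z k \<alpha>)"] by (auto simp: J_def)
  qed
  then show ?thesis
    by (rule countable_subset) (auto intro: countable_finite fin)
qed

lemma rectangle_tests_no_lag: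
  assumes g: "\<gamma> = 0"
  obtains C where "0 < C" "\<And>k \<alpha> t. \<alpha> \<in> I k \<Longrightarrow>
      tests lam \<omega> q (Q k \<alpha> \<times> {t - L k<..<t}) (Q k \<alpha> \<times> {t + \<gamma> * L k<..<t + L k}) (C * (L k * cubem k \<alpha>) powr q)"
proof -
  obtain A where A: "0 < A" and tests: "\<And>x t l. 0 < l \<Longrightarrow>
      tests lam \<omega> q (R\<^sub>m x t l) (R\<^sub>p x t l) (A * (l powr p * measure mu (B x l)) powr q)"
    by (rule cylinder_tests) (rule that)
  define a where "a = max C1 1"
  have a: "C1 \<le> a" "1 \<le> a" by (auto simp: a_def)
  obtain D where D: "1 \<le> D" and cmp: "\<And>k \<alpha> \<beta>. \<alpha> \<in> I k \<Longrightarrow> \<beta> \<in> I (k + int 0) \<Longrightarrow> Q (k + int 0) \<beta> \<subseteq> Q k \<alpha> \<Longrightarrow>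
       measure mu (B (z k \<alpha>) (a * \<delta> powr k)) \<le> D * cubem (k + int 0) \<beta>"
    using a(1) by (rule ball_le_subcube[where N = 0]) (rule that)
  show ?thesis
  proof (rule that[of "A * (a powr p * D) powr q"])
    show "0 < A * (a powr p * D) powr q" using A a D by simp
    fix k \<alpha> and t :: real assume al: "\<alpha> \<in> I k"
    define l where "l = a * \<delta> powr k"
    have l: "0 < l" using a \<delta> by (simp add: l_def)
    have lp: "l powr p = a powr p * L k"
      unfolding l_def using a by (intro scale_powr) auto
    have "1 \<le> a powr p"
      using a p by (simp add: ge_one_powr_ge_zero)
    then have Ll: "L k \<le> l powr p"
      using mult_right_mono[of 1 "a powr p" "L k"] L_pos[of k] by (simp add: lp)
    have Ql: "Q k \<alpha> \<subseteq> B (z k \<alpha>) l"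
      using cube_outer[OF al] ball_mono[of "C1 * \<delta> powr k" l] mult_right_mono[OF a(1)] by (auto simp: l_def)
    show "tests lam \<omega> q (Q k \<alpha> \<times> {t - L k<..<t}) (Q k \<alpha> \<times> {t + \<gamma> * L k<..<t + L k})
        (A * (a powr p * D) powr q * (L k * cubem k \<alpha>) powr q)"
    proof (rule tests_mono[OF tests[OF l, of "z k \<alpha>" t]])
      show "Q k \<alpha> \<times> {t - L k<..<t} \<subseteq> R\<^sub>m (z k \<alpha>) t l" "Q k \<alpha> \<times> {t + \<gamma> * L k<..<t + L k} \<subseteq> R\<^sub>p (z k \<alpha>) t l"
        using Ql Ll unfolding cylinder_minus_def cylinder_plus_def by (auto simp: g)
      show "Q k \<alpha> \<times> {t + \<gamma> * L k<..<t + L k} \<in> sets lam"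
        using al by (intro sets_times sets_cube) auto
      have "l powr p * measure mu (B (z k \<alpha>) l) \<le> (a powr p * L k) * (D * cubem k \<alpha>)"
        using cmp[OF al, of \<alpha>] al L_pos[of k] by (intro mult_mono) (auto simp: l_def lp[unfolded l_def] intro: less_imp_le)
      then have "(l powr p * measure mu (B (z k \<alpha>) l)) powr q \<le> ((a powr p * D) * (L k * cubem k \<alpha>)) powr q"
        using q by (intro powr_mono2) (auto simp: mult_ac)
      also have "\<dots> = (a powr p * D) powr q * (L k * cubem k \<alpha>) powr q"
        by (rule powr_mult)
      finally show "A * (l powr p * measure mu (B (z k \<alpha>) l)) powr q \<le> A * (a powr p * D) powr q * (L k * cubem k \<alpha>) powr q"
        using A by (simp add: mult.assoc)
    qed
  qed
qed

lemma rectangle_tests_lag: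
  assumes g: "0 < \<gamma>"
  obtains b C where "0 < b" "b \<le> 1" "0 < C" "\<And>k \<alpha> t. \<alpha> \<in> I k \<Longrightarrow>
      tests lam \<omega> q (Q k \<alpha> \<times> {t - b * L k<..<t}) (Q k \<alpha> \<times> {t + \<gamma> * L k<..<t + L k}) (C * (L k * cubem k \<alpha>) powr q)"
proof -
  obtain A where A: "0 < A" and tests: "\<And>x t l. 0 < l \<Longrightarrow>
      tests lam \<omega> q (R\<^sub>m x t l) (R\<^sub>p x t l) (A * (l powr p * measure mu (B x l)) powr q)"
    by (rule cylinder_tests) (rule that)
  obtain E M where E: "1 \<le> E" and M: "1 \<le> M" and transport:
    "\<And>x y t t' l T. 0 < l \<Longrightarrow> (M * rho x y / l + M) * l powr p \<le> t' - t \<Longrightarrow> t' - t \<le> T * l powr p \<Longrightarrow>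
       W (R\<^sub>m x t l) \<le> ennreal (E powr (T + 1)) * W (R\<^sub>m y t' l)"
    by (rule forward_transport) (rule that)
  obtain D where D: "1 \<le> D" and cmp: "\<And>k \<alpha> \<beta>. \<alpha> \<in> I k \<Longrightarrow> \<beta> \<in> I (k + int 0) \<Longrightarrow> Q (k + int 0) \<beta> \<subseteq> Q k \<alpha> \<Longrightarrow>
       measure mu (B (z k \<alpha>) (C1 * \<delta> powr k)) \<le> D * cubem (k + int 0) \<beta>"
    using order_refl by (rule ball_le_subcube[where N = 0]) (rule that)
  have "\<exists>N. 2 * K0 * C1 * M * (C1 * \<delta> powr real N) powr (p - 1) + (M + 2) * (C1 * \<delta> powr real N) powr p < \<gamma>"
  proof -
    have "(\<lambda>N. \<delta> ^ N) \<longlonglongrightarrow> 0"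
      using \<delta> by (intro LIMSEQ_realpow_zero) auto
    then have t0: "(\<lambda>N. C1 * \<delta> powr real N) \<longlonglongrightarrow> 0"
      using \<delta> by (intro tendsto_mult_right_zero) (simp add: powr_realpow)
    have tp: "(\<lambda>N. (C1 * \<delta> powr real N) powr e) \<longlonglongrightarrow> 0" if "0 < e" for e
      using C1 \<delta> by (intro tendsto_zero_powrI[OF t0 tendsto_const _ that]) (auto intro!: always_eventually)
    have "(\<lambda>N. 2 * K0 * C1 * M * (C1 * \<delta> powr real N) powr (p - 1) + (M + 2) * (C1 * \<delta> powr real N) powr p) \<longlonglongrightarrow> 0"
      using p by (intro tendsto_add_zero tendsto_mult_right_zero tp) auto
    from order_tendstoD(2)[OF this g] show ?thesis
      by (rule eventually_sequentially[THEN iffD1, THEN exE]) auto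
  qed
  then obtain N where N: "2 * K0 * C1 * M * (C1 * \<delta> powr real N) powr (p - 1) + (M + 2) * (C1 * \<delta> powr real N) powr p < \<gamma>"
    by blast
  define \<eta> where "\<eta> = C1 * \<delta> powr real N"
  have \<eta>: "0 < \<eta>"
    using C1 \<delta> by (simp add: \<eta>_def)
  define h where "h = \<eta> powr p"
  have h: "0 < h"
    using \<eta> by (simp add: h_def)
  have h1: "(2 * K0 * C1 * M / \<eta> + M + 2) * h < \<gamma>"
  proof -
    have "\<eta> powr (p - 1) = h / \<eta>"
      using \<eta> by (simp add: h_def powr_diff)
    then show ?thesis
      using N unfolding \<eta>_def[symmetric] h_def[symmetric] by (simp add: field_simps)
  qed
  obtain n where n: "1 \<le> n" "\<And>k \<alpha>. \<alpha> \<in> I k \<Longrightarrow> finite (subcubes N k \<alpha>) \<and> real (card (subcubes N k \<alpha>)) \<le> n"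
    by (rule card_subcubes) (rule that)
  define b where "b = min 1 ((1 - \<gamma>) * h)"
  have b: "0 < b" "b \<le> 1" "b \<le> (1 - \<gamma>) * h"
    using \<gamma> h by (auto simp: b_def)
  define v where "v = (1 - \<gamma>) / 2 * h"
  have v: "0 < v"
    using \<gamma> h by (simp add: v_def)
  define J where "J = {..nat \<lfloor>1 / v\<rfloor>}"
  define C3 where "C3 = E powr (2 / h + 1) * (A * (h * D) powr q)"
  define n2 where "n2 = n * real (card J)"
  have J: "finite J" "card J \<noteq> 0"
    by (auto simp: J_def)
  have n2: "0 < n2"
    using n J unfolding n2_def by (intro mult_pos_pos) auto
  have C3: "0 < C3"
    using E A h D by (simp add: C3_def)
  show ?thesis
  proof (rule that[OF b(1,2)])
    show "0 < n * (n2 powr q * C3)"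
      using n n2 C3 by simp
    fix k \<alpha> and t :: real assume al: "\<alpha> \<in> I k"
    let ?k = "k + int N"
    define X where "X = (L k * cubem k \<alpha>) powr q"
    define l where "l = C1 * \<delta> powr real_of_int ?k"
    have l: "0 < l" "l = \<eta> * \<delta> powr k"
      using C1 \<delta> by (simp_all add: l_def \<eta>_def powr_add)
    have lp: "l powr p = h * L k"
      unfolding l(2) h_def using \<eta> by (intro scale_powr) auto
    note Lk = L_pos[of k]
    have sub: "\<beta> \<in> I ?k" "Q ?k \<beta> \<subseteq> Q k \<alpha>" "Q ?k \<beta> \<subseteq> B (z ?k \<beta>) l" if "\<beta> \<in> subcubes N k \<alpha>" for \<beta>
      using that cube_outer[of \<beta> ?k] by (auto simp: subcubes_def l_def)
    define s where "s j = t + \<gamma> * L k + real j * (v * L k)" for j :: nat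
    have s: "t + \<gamma> * L k \<le> s j" "j \<in> J \<Longrightarrow> s j \<le> t + \<gamma> * L k + L k" for j
    proof -
      show "t + \<gamma> * L k \<le> s j"
        using v Lk by (simp add: s_def)
      assume "j \<in> J"
      then have "real j \<le> 1 / v"
        using v by (simp add: J_def le_nat_iff le_floor_iff)
      then have "real j * v \<le> 1"
        using v by (simp add: field_simps)
      then have "real j * v * L k \<le> 1 * L k"
        using Lk by (intro mult_right_mono) auto
      then show "s j \<le> t + \<gamma> * L k + L k"
        by (simp add: s_def mult.assoc)
    qed
    define U where "U \<beta> = Q ?k \<beta> \<times> {t - b * L k<..<t}" for \<beta>
    define V where "V = (\<lambda>(\<beta>, j). Q ?k \<beta> \<times> {s j - v * L k<..<s j + v * L k})"
    define t1 where "t1 = t + \<gamma> * l powr p"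
    have piece: "tests lam \<omega> q (U \<beta>) (V (\<beta>', j)) (C3 * X)"
      if beta: "\<beta> \<in> subcubes N k \<alpha>" "\<beta>' \<in> subcubes N k \<alpha>" and j: "j \<in> J" for \<beta> \<beta>' j
    proof -
      define t2 where "t2 = s j - (1 + \<gamma>) / 2 * l powr p"
      have dist: "rho (z ?k \<beta>) (z ?k \<beta>') \<le> 2 * K0 * C1 / \<eta> * l"
      proof -
        have "z ?k \<beta> \<in> B (z k \<alpha>) (C1 * \<delta> powr k)" "z ?k \<beta>' \<in> B (z k \<alpha>) (C1 * \<delta> powr k)"
          using center_in_cube[OF sub(1)[OF beta(1)]] center_in_cube[OF sub(1)[OF beta(2)]]
            sub(2)[OF beta(1)] sub(2)[OF beta(2)] cube_outer[OF al] by blast+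
        then have "K0 * (rho (z ?k \<beta>) (z k \<alpha>) + rho (z k \<alpha>) (z ?k \<beta>')) \<le> K0 * (C1 * \<delta> powr k + C1 * \<delta> powr k)"
          using K0 by (intro mult_left_mono add_mono) (auto simp: qball_def rho_sym)
        then have "rho (z ?k \<beta>) (z ?k \<beta>') \<le> K0 * (C1 * \<delta> powr k + C1 * \<delta> powr k)"
          using rho_triangle order_trans by blast
        also have "\<dots> = 2 * K0 * C1 / \<eta> * l"
          using \<eta> by (simp add: l(2))
        finally show ?thesis .
      qed
      have t12: "t2 - t1 = s j - t - (1 + 3 * \<gamma>) / 2 * (h * L k)"
        by (simp add: t1_def t2_def lp field_simps)
      have W: "W (R\<^sub>m (z ?k \<beta>) t1 l) \<le> ennreal (E powr (2 / h + 1)) * W (R\<^sub>m (z ?k \<beta>') t2 l)"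
      proof (rule transport[OF l(1)])
        have "M * rho (z ?k \<beta>) (z ?k \<beta>') / l + M \<le> M * (2 * K0 * C1 / \<eta> * l) / l + M"
          using M l dist by (intro add_right_mono divide_right_mono mult_left_mono) auto
        also have "\<dots> = 2 * K0 * C1 * M / \<eta> + M"
          using l(1) by simp
        finally have "(M * rho (z ?k \<beta>) (z ?k \<beta>') / l + M) * (h * L k) \<le> (2 * K0 * C1 * M / \<eta> + M) * (h * L k)"
          using h Lk by (intro mult_right_mono) auto
        also have "\<dots> = ((2 * K0 * C1 * M / \<eta> + M + 2) * h) * L k - 2 * (h * L k)"
          by (simp add: algebra_simps)
        also have "\<dots> \<le> \<gamma> * L k - (1 + 3 * \<gamma>) / 2 * (h * L k)"
          using h1 h Lk \<gamma> by (intro diff_mono mult_right_mono) auto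
        also have "\<dots> \<le> t2 - t1"
          using s(1)[of j] by (simp add: t12)
        finally show "(M * rho (z ?k \<beta>) (z ?k \<beta>') / l + M) * l powr p \<le> t2 - t1"
          by (simp add: lp)
        have "\<gamma> * L k + L k - (1 + 3 * \<gamma>) / 2 * (h * L k) \<le> (2 / h) * (h * L k)"
        proof -
          have "\<gamma> * L k \<le> 1 * L k"
            using \<gamma> by (intro mult_right_mono) auto
          moreover have "0 \<le> (1 + 3 * \<gamma>) / 2 * (h * L k)"
            using \<gamma> h by simp
          ultimately have "\<gamma> * L k + L k - (1 + 3 * \<gamma>) / 2 * (h * L k) \<le> 2 * L k"
            by linarith
          then show ?thesis
            using h by simp
        qed
        then show "t2 - t1 \<le> 2 / h * l powr p"
          using s(2)[OF j] by (simp add: t12 lp)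
      qed
      have "tests lam \<omega> q (R\<^sub>m (z ?k \<beta>) t1 l) (R\<^sub>p (z ?k \<beta>') t2 l)
         (E powr (2 / h + 1) * (A * (l powr p * measure mu (B (z ?k \<beta>') l)) powr q))"
        by (rule tests_trans[OF tests[OF l(1)] W]) simp
      then show ?thesis
      proof (rule tests_mono)
        have "b * L k \<le> (1 - \<gamma>) * h * L k"
          using b Lk by (intro mult_right_mono) auto
        then show "U \<beta> \<subseteq> R\<^sub>m (z ?k \<beta>) t1 l"
          using sub(3)[OF beta(1)] unfolding U_def cylinder_minus_def t1_def lp
          by (auto simp: algebra_simps)
        show "V (\<beta>', j) \<subseteq> R\<^sub>p (z ?k \<beta>') t2 l"
          using sub(3)[OF beta(2)] unfolding V_def cylinder_plus_def t2_def lp v_def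
          by (auto simp: field_simps)
        show "V (\<beta>', j) \<in> sets lam"
          unfolding V_def using sub(1)[OF beta(2)] by (auto intro!: sets_times sets_cube)
        have "measure mu (B (z ?k \<beta>') l) \<le> D * cubem ?k \<beta>'"
          using cmp[OF sub(1)[OF beta(2)], of \<beta>'] sub(1)[OF beta(2)] by (simp add: l_def)
        also have "\<dots> \<le> D * cubem k \<alpha>"
          using D al beta sub by (intro mult_left_mono cube_mono) auto
        finally have "l powr p * measure mu (B (z ?k \<beta>') l) \<le> (h * D) * (L k * cubem k \<alpha>)"
          using mult_left_mono[of "measure mu (B (z ?k \<beta>') l)" "D * cubem k \<alpha>" "h * L k"] h Lk
          by (simp add: lp mult_ac)
        then have "(l powr p * measure mu (B (z ?k \<beta>') l)) powr q \<le> ((h * D) * (L k * cubem k \<alpha>)) powr q"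
          using q by (intro powr_mono2) auto
        also have "\<dots> = (h * D) powr q * X"
          unfolding X_def by (rule powr_mult)
        finally show "E powr (2 / h + 1) * (A * (l powr p * measure mu (B (z ?k \<beta>') l)) powr q) \<le> C3 * X"
          using A E unfolding C3_def by (simp add: mult.assoc mult_left_mono)
      qed
    qed
    have X: "0 \<le> X" by (simp add: X_def)
    have fin: "finite (subcubes N k \<alpha>)" "real (card (subcubes N k \<alpha>)) \<le> n"
      using n(2)[OF al] by auto
    let ?P = "Q k \<alpha> \<times> {t + \<gamma> * L k<..<t + L k}"
    have right: "tests lam \<omega> q (U \<beta>) ?P (n2 powr q * (C3 * X))" if "\<beta> \<in> subcubes N k \<alpha>" for \<beta>
    proof (rule tests_UN_right[where J = "subcubes N k \<alpha> \<times> J" and A = V])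
      show "tests lam \<omega> q (U \<beta>) (V i) (C3 * X)" if "i \<in> subcubes N k \<alpha> \<times> J" for i
        using that piece[OF \<open>\<beta> \<in> subcubes N k \<alpha>\<close>] by auto
      show "finite (subcubes N k \<alpha> \<times> J)" "real (card (subcubes N k \<alpha> \<times> J)) \<le> n2"
        using fin J(1) by (simp_all add: n2_def card_cartesian_product mult_right_mono)
      show "V i \<in> sets lam" if "i \<in> subcubes N k \<alpha> \<times> J" for i
        using that sub(1) unfolding V_def by (auto intro!: sets_times sets_cube)
      show "?P \<subseteq> (\<Union>i\<in>subcubes N k \<alpha> \<times> J. V i)"
      proof
        fix y assume "y \<in> ?P"
        then obtain x u where y: "y = (x, u)" "x \<in> Q k \<alpha>" "t + \<gamma> * L k < u" "u < t + L k"
          by auto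
        obtain \<beta>' where b': "\<beta>' \<in> subcubes N k \<alpha>" "x \<in> Q ?k \<beta>'"
          using cube_subset_subcubes[OF al] y(2) by blast
        define w where "w = (u - t - \<gamma> * L k) / (v * L k)"
        define j where "j = nat \<lfloor>w\<rfloor>"
        have vL: "0 < v * L k" using v Lk by simp
        have w0: "0 \<le> w"
          using y vL by (simp add: w_def)
        have j: "real j \<le> w" "w < real j + 1"
          using w0 by (auto simp: j_def)
        have "w \<le> 1 / v"
        proof -
          have "w \<le> L k / (v * L k)"
          proof -
            have "0 \<le> \<gamma> * L k"
              using \<gamma> by simp
            then show ?thesis
              unfolding w_def using y vL by (intro divide_right_mono) auto
          qed
          then show ?thesis
            using Lk by simp
        qed
        then have "j \<in> J"
          unfolding J_def j_def by (auto intro!: nat_mono floor_mono)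
        moreover have "s j \<le> u" "u < s j + v * L k"
          using j vL by (auto simp: s_def w_def field_simps)
        ultimately show "y \<in> (\<Union>i\<in>subcubes N k \<alpha> \<times> J. V i)"
          using b' y vL by (intro UN_I[of "(\<beta>', j)"]) (auto simp: V_def)
      qed
    qed (use q X C3 al in \<open>auto intro!: sets_times sets_cube\<close>)
    have "tests lam \<omega> q (Q k \<alpha> \<times> {t - b * L k<..<t}) ?P (n * (n2 powr q * (C3 * X)))"
    proof (rule tests_UN_left[OF right])
      show "Q k \<alpha> \<times> {t - b * L k<..<t} \<subseteq> (\<Union>\<beta>\<in>subcubes N k \<alpha>. U \<beta>)"
        using cube_subset_subcubes[OF al, of N] by (auto simp: U_def)
    qed (use fin X C3 sub(1) in \<open>auto simp: U_def intro!: sets_times sets_cube\<close>)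
    then show "tests lam \<omega> q (Q k \<alpha> \<times> {t - b * L k<..<t}) ?P (n * (n2 powr q * C3) * (L k * cubem k \<alpha>) powr q)"
      by (simp add: X_def mult.assoc)
  qed
qed

lemma rectangle_tests:
  obtains b C where "0 < b" "b \<le> 1" "0 < C" "\<And>k \<alpha> t. \<alpha> \<in> I k \<Longrightarrow>
      tests lam \<omega> q (Q k \<alpha> \<times> {t - b * L k<..<t}) (Q k \<alpha> \<times> {t + \<gamma> * L k<..<t + L k}) (C * (L k * cubem k \<alpha>) powr q)"
proof (cases "\<gamma> = 0")
  case True
  obtain C where "0 < C" "\<And>k \<alpha> t. \<alpha> \<in> I k \<Longrightarrow>
      tests lam \<omega> q (Q k \<alpha> \<times> {t - L k<..<t}) (Q k \<alpha> \<times> {t + \<gamma> * L k<..<t + L k}) (C * (L k * cubem k \<alpha>) powr q)"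
    using True by (rule rectangle_tests_no_lag) (rule that)
  then show ?thesis
    by (intro that[of 1 C]) auto
next
  case False
  with \<gamma> have "0 < \<gamma>" by simp
  then show ?thesis
    by (rule rectangle_tests_lag) (rule that)
qed

end

section \<open>Selection and packing\<close>

text \<open>Largest cubes first. In every time cell of length \<open>h k\<close> the latest time that is not yet
  covered is selected; it exists because the admissible times are closed under suprema and the
  cover consists of left-open, right-closed intervals.\<close>

lemma greedy_selection:
  fixes I :: "int \<Rightarrow> 'i set" and Q :: "int \<Rightarrow> 'i \<Rightarrow> 'a set" and h :: "int \<Rightarrow> real"
    and bad :: "int \<Rightarrow> 'i \<Rightarrow> real \<Rightarrow> bool" and k0 :: int
  assumes nonempty: "\<And>k \<alpha>. \<alpha> \<in> I k \<Longrightarrow> Q k \<alpha> \<noteq> {}"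
    and nested: "\<And>k l \<alpha> \<beta>. k \<le> l \<Longrightarrow> \<alpha> \<in> I k \<Longrightarrow> \<beta> \<in> I l \<Longrightarrow> Q l \<beta> \<inter> Q k \<alpha> \<noteq> {} \<Longrightarrow> Q l \<beta> \<subseteq> Q k \<alpha>"
    and h: "\<And>k. 0 < h k"
    and closed: "\<And>k \<alpha> A. \<alpha> \<in> I k \<Longrightarrow> A \<noteq> {} \<Longrightarrow> bdd_above A \<Longrightarrow> (\<And>t. t \<in> A \<Longrightarrow> bad k \<alpha> t) \<Longrightarrow> bad k \<alpha> (Sup A)"
  obtains Sel :: "(int \<times> 'i \<times> real) set" where
    "\<And>k \<alpha> t. (k, \<alpha>, t) \<in> Sel \<Longrightarrow> k0 \<le> k \<and> \<alpha> \<in> I k \<and> bad k \<alpha> t"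
    "\<And>k \<alpha> t. k0 \<le> k \<Longrightarrow> \<alpha> \<in> I k \<Longrightarrow> bad k \<alpha> t \<Longrightarrow>
       \<exists>k' \<alpha>' t'. (k', \<alpha>', t') \<in> Sel \<and> Q k \<alpha> \<subseteq> Q k' \<alpha>' \<and> t' - h k' < t \<and> t \<le> t'"
    "\<And>k \<alpha> t k' \<alpha>' t'. (k, \<alpha>, t) \<in> Sel \<Longrightarrow> (k', \<alpha>', t') \<in> Sel \<Longrightarrow> k' < k \<Longrightarrow> Q k \<alpha> \<inter> Q k' \<alpha>' \<noteq> {} \<Longrightarrow>
       t \<le> t' - h k' \<or> t' < t"
    "\<And>k \<alpha> t t'. (k, \<alpha>, t) \<in> Sel \<Longrightarrow> (k, \<alpha>, t') \<in> Sel \<Longrightarrow> \<lceil>t / h k\<rceil> = \<lceil>t' / h k\<rceil> \<Longrightarrow> t = t'"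
proof -
  define rem where "rem C k \<alpha> t \<longleftrightarrow> bad k \<alpha> t \<and> \<not> Q k \<alpha> \<times> {t} \<subseteq> C" for C k \<alpha> t
  define chosen where "chosen C k \<alpha> t \<longleftrightarrow> rem C k \<alpha> t \<and>
      (\<forall>t'. rem C k \<alpha> t' \<and> \<lceil>t' / h k\<rceil> = \<lceil>t / h k\<rceil> \<longrightarrow> t' \<le> t)" for C k \<alpha> t
  define ext where "ext n C = C \<union> {(x, s). \<exists>\<alpha>\<in>I (k0 + int n). x \<in> Q (k0 + int n) \<alpha> \<and>
      (\<exists>t. chosen C (k0 + int n) \<alpha> t \<and> t - h (k0 + int n) < s \<and> s \<le> t)}" for n C
  define cov where "cov = rec_nat {} ext"
  define Sel where "Sel = {(k, \<alpha>, t). k0 \<le> k \<and> \<alpha> \<in> I k \<and> chosen (cov (nat (k - k0))) k \<alpha> t}"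
  have cov_iff: "(x, s) \<in> cov n \<longleftrightarrow>
      (\<exists>k \<alpha> t. (k, \<alpha>, t) \<in> Sel \<and> k < k0 + int n \<and> x \<in> Q k \<alpha> \<and> t - h k < s \<and> s \<le> t)" for x s n
  proof (induction n)
    case 0
    then show ?case by (auto simp: cov_def Sel_def)
  next
    case (Suc n)
    have last: "(k < k0 + int n \<or> k = k0 + int n) \<longleftrightarrow> k < k0 + int (Suc n)" for k
      by auto
    have "cov (Suc n) = ext n (cov n)"
      by (simp add: cov_def)
    then have "(x, s) \<in> cov (Suc n) \<longleftrightarrow> (x, s) \<in> cov n \<or>
        (\<exists>\<alpha> t. (k0 + int n, \<alpha>, t) \<in> Sel \<and> x \<in> Q (k0 + int n) \<alpha> \<and> t - h (k0 + int n) < s \<and> s \<le> t)"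
      by (auto simp: ext_def Sel_def)
    also have "\<dots> \<longleftrightarrow> (\<exists>k \<alpha> t. (k, \<alpha>, t) \<in> Sel \<and> (k < k0 + int n \<or> k = k0 + int n) \<and> x \<in> Q k \<alpha> \<and> t - h k < s \<and> s \<le> t)"
      unfolding Suc by blast
    finally show ?case
      by (simp only: last)
  qed
  show ?thesis
  proof (rule that[of Sel])
    show "k0 \<le> k \<and> \<alpha> \<in> I k \<and> bad k \<alpha> t" if "(k, \<alpha>, t) \<in> Sel" for k \<alpha> t
      using that by (auto simp: Sel_def chosen_def rem_def)
  next
    fix k \<alpha> t assume k: "k0 \<le> k" and al: "\<alpha> \<in> I k" and bad: "bad k \<alpha> t"
    define n where "n = nat (k - k0)"
    obtain x where x: "x \<in> Q k \<alpha>"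
      using nonempty[OF al] by blast
    show "\<exists>k' \<alpha>' t'. (k', \<alpha>', t') \<in> Sel \<and> Q k \<alpha> \<subseteq> Q k' \<alpha>' \<and> t' - h k' < t \<and> t \<le> t'"
    proof (cases "Q k \<alpha> \<times> {t} \<subseteq> cov n")
      case True
      with x have "(x, t) \<in> cov n" by auto
      then obtain k' \<alpha>' t' where *: "(k', \<alpha>', t') \<in> Sel" "k' < k0 + int n" "x \<in> Q k' \<alpha>'" "t' - h k' < t" "t \<le> t'"
        unfolding cov_iff by blast
      have "Q k \<alpha> \<subseteq> Q k' \<alpha>'"
        using * x al k by (intro nested) (auto simp: Sel_def n_def)
      with * show ?thesis by blast
    next
      case False
      define A where "A = {t'. rem (cov n) k \<alpha> t' \<and> \<lceil>t' / h k\<rceil> = \<lceil>t / h k\<rceil>}"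
      define T where "T = Sup A"
      have tA: "t \<in> A"
        using False bad by (simp add: A_def rem_def)
      have up: "t' \<le> of_int \<lceil>t / h k\<rceil> * h k" if "t' \<in> A" for t'
        using that h[of k] by (simp add: A_def flip: pos_divide_le_eq) (metis le_of_int_ceiling)
      have bdd: "bdd_above A"
        using up by (rule bdd_aboveI)
      have tT: "t' \<le> T" if "t' \<in> A" for t'
        unfolding T_def using that bdd by (rule cSup_upper)
      have Tup: "T \<le> of_int \<lceil>t / h k\<rceil> * h k"
        unfolding T_def using tA up by (intro cSup_least) auto
      have ceil: "\<lceil>T / h k\<rceil> = \<lceil>t / h k\<rceil>"
      proof (rule antisym)
        show "\<lceil>T / h k\<rceil> \<le> \<lceil>t / h k\<rceil>"
          using Tup h[of k] by (simp add: ceiling_le_iff pos_divide_le_eq)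
        show "\<lceil>t / h k\<rceil> \<le> \<lceil>T / h k\<rceil>"
          using tT[OF tA] h[of k] by (intro ceiling_mono divide_right_mono) auto
      qed
      have badT: "bad k \<alpha> T"
        unfolding T_def using tA bdd by (intro closed[OF al]) (auto simp: A_def rem_def)
      have "\<not> Q k \<alpha> \<times> {T} \<subseteq> cov n"
      proof
        assume "Q k \<alpha> \<times> {T} \<subseteq> cov n"
        with x have "(x, T) \<in> cov n" by auto
        then obtain k' \<alpha>' t' where *: "(k', \<alpha>', t') \<in> Sel" "k' < k0 + int n" "x \<in> Q k' \<alpha>'" "t' - h k' < T" "T \<le> t'"
          unfolding cov_iff by blast
        have sub: "Q k \<alpha> \<subseteq> Q k' \<alpha>'"
          using * x al k by (intro nested) (auto simp: Sel_def n_def)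
        obtain a where a: "a \<in> A" "t' - h k' < a"
          using *(4) tA unfolding T_def by (metis less_cSupE empty_iff)
        have "a \<le> t'"
          using tT[OF a(1)] *(5) by simp
        then have "(y, a) \<in> cov n" if "y \<in> Q k \<alpha>" for y
          using that sub * a(2) unfolding cov_iff by blast
        then have "Q k \<alpha> \<times> {a} \<subseteq> cov n"
          by auto
        then show False
          using a(1) by (simp add: A_def rem_def)
      qed
      with badT have "chosen (cov n) k \<alpha> T"
        using tT by (auto simp: chosen_def rem_def A_def ceil)
      then have "(k, \<alpha>, T) \<in> Sel"
        using k al by (simp add: Sel_def n_def)
      moreover have "T - h k < t"
      proof -
        have "of_int \<lceil>t / h k\<rceil> < t / h k + 1"
          by linarith
        then have "of_int \<lceil>t / h k\<rceil> * h k < (t / h k + 1) * h k"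
          using h[of k] by (rule mult_strict_right_mono)
        also have "\<dots> = t + h k"
          using h[of k] by (simp add: distrib_right)
        finally show ?thesis
          using Tup by simp
      qed
      ultimately show ?thesis
        using tT[OF tA] by blast
    qed
  next
    fix k \<alpha> t k' \<alpha>' t'
    assume S: "(k, \<alpha>, t) \<in> Sel" and S': "(k', \<alpha>', t') \<in> Sel" and less: "k' < k" and meet: "Q k \<alpha> \<inter> Q k' \<alpha>' \<noteq> {}"
    have sub: "Q k \<alpha> \<subseteq> Q k' \<alpha>'"
      using S S' less meet by (intro nested) (auto simp: Sel_def)
    show "t \<le> t' - h k' \<or> t' < t"
    proof (rule ccontr)
      assume "\<not> ?thesis"
      then have *: "t' - h k' < t" "t \<le> t'" by auto
      have "k' < k0 + int (nat (k - k0))"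
        using S less by (simp add: Sel_def)
      then have "(y, t) \<in> cov (nat (k - k0))" if "y \<in> Q k \<alpha>" for y
        using that sub * S' unfolding cov_iff by blast
      then have "Q k \<alpha> \<times> {t} \<subseteq> cov (nat (k - k0))"
        by auto
      then show False
        using S by (simp add: Sel_def chosen_def rem_def)
    qed
  next
    fix k \<alpha> t t'
    assume "(k, \<alpha>, t) \<in> Sel" "(k, \<alpha>, t') \<in> Sel" "\<lceil>t / h k\<rceil> = \<lceil>t' / h k\<rceil>"
    then show "t = t'"
      by (intro antisym) (auto simp: Sel_def chosen_def)
  qed
qed

text \<open>A Carleson-type packing condition allows removing from each set the points with too many smaller
  sets on top, at the cost of at most half of its mass.\<close>

lemma packing_bounded_overlap:
  fixes P :: "'j \<Rightarrow> 'b set" and gen :: "'j \<Rightarrow> int" and v :: "'b \<Rightarrow> ennreal" and n :: real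
  assumes J: "countable J" and gen: "\<And>j. j \<in> J \<Longrightarrow> k0 \<le> gen j"
    and P: "\<And>j. j \<in> J \<Longrightarrow> P j \<in> sets M" and v [measurable]: "v \<in> borel_measurable M" and n: "0 < n"
    and fin: "\<And>j. j \<in> J \<Longrightarrow> (\<integral>\<^sup>+y\<in>P j. v y \<partial>M) < \<infinity>"
    and pack: "\<And>j. j \<in> J \<Longrightarrow>
      (\<integral>\<^sup>+i. (\<integral>\<^sup>+y\<in>P i. v y \<partial>M) * indicator {i. gen j \<le> gen i \<and> P i \<inter> P j \<noteq> {}} i \<partial>count_space J)
        \<le> ennreal n * (\<integral>\<^sup>+y\<in>P j. v y \<partial>M)"
  obtains S where "\<And>j. j \<in> J \<Longrightarrow> S j \<in> sets M" "\<And>j. j \<in> J \<Longrightarrow> S j \<subseteq> P j"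
    "\<And>j. j \<in> J \<Longrightarrow> (\<integral>\<^sup>+y\<in>P j. v y \<partial>M) \<le> 2 * (\<integral>\<^sup>+y\<in>S j. v y \<partial>M)"
    "\<And>y. (\<integral>\<^sup>+j. indicator (S j) y \<partial>count_space J) \<le> ennreal (2 * n)"
proof -
  define F where "F j = {i. gen j \<le> gen i \<and> P i \<inter> P j \<noteq> {}}" for j
  define N where "N j y = (\<integral>\<^sup>+i. indicator (P i) y * indicator (F j) i \<partial>count_space J)" for j y
  interpret J: sigma_finite_measure "count_space J"
    by (rule sigma_finite_measure_count_space_countable[OF J])
  have N [measurable]: "N j \<in> borel_measurable M" for j
    unfolding N_def
  proof (rule J.borel_measurable_nn_integral)
    have "(\<lambda>x. (\<lambda>(i, y). indicator (P i) y * indicator (F j) i :: ennreal) x) \<in> borel_measurable (count_space J \<Otimes>\<^sub>M M)"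
      by (rule measurable_pair_measure_countable1[OF J]) (use P in simp)
    from measurable_compose[OF measurable_pair_swap' this]
    show "(\<lambda>(y, i). indicator (P i) y * indicator (F j) i :: ennreal) \<in> borel_measurable (M \<Otimes>\<^sub>M count_space J)"
      by (simp add: case_prod_beta')
  qed
  define S where "S j = {y \<in> P j. N j y \<le> ennreal (2 * n)}" for j
  show ?thesis
  proof (rule that[of S])
    show S: "S j \<in> sets M" if "j \<in> J" for j
    proof -
      have "S j = P j \<inter> {y \<in> space M. N j y \<le> ennreal (2 * n)}"
        using sets.sets_into_space[OF P[OF that]] by (auto simp: S_def)
      then show ?thesis using P[OF that] by simp
    qed
    show "S j \<subseteq> P j" for j
      by (auto simp: S_def)
    show "(\<integral>\<^sup>+y\<in>P j. v y \<partial>M) \<le> 2 * (\<integral>\<^sup>+y\<in>S j. v y \<partial>M)" if j: "j \<in> J" for j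
    proof -
      note [measurable] = P[OF j] S[OF j]
      have "ennreal (2 * n) * (\<integral>\<^sup>+y\<in>P j - S j. v y \<partial>M) = (\<integral>\<^sup>+y. ennreal (2 * n) * (v y * indicator (P j - S j) y) \<partial>M)"
        by (simp add: nn_integral_cmult)
      also have "\<dots> \<le> (\<integral>\<^sup>+y. (\<integral>\<^sup>+i. v y * indicator (P i) y * indicator (F j) i \<partial>count_space J) \<partial>M)"
      proof (rule nn_integral_mono)
        fix y
        have "(\<integral>\<^sup>+i. v y * indicator (P i) y * indicator (F j) i \<partial>count_space J) = v y * N j y"
          unfolding N_def by (simp add: nn_integral_cmult mult.assoc)
        moreover have "ennreal (2 * n) * (v y * indicator (P j - S j) y) \<le> v y * N j y"
          by (auto simp: indicator_def S_def mult.commute[of "v y"] not_le intro!: mult_right_mono)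
        ultimately show "ennreal (2 * n) * (v y * indicator (P j - S j) y) \<le> (\<integral>\<^sup>+i. v y * indicator (P i) y * indicator (F j) i \<partial>count_space J)"
          by simp
      qed
      also have "\<dots> = (\<integral>\<^sup>+i. (\<integral>\<^sup>+y. v y * indicator (P i) y * indicator (F j) i \<partial>M) \<partial>count_space J)"
        by (rule nn_integral_count_space_nn_integral[OF J]) (use P in measurable)
      also have "\<dots> = (\<integral>\<^sup>+i. (\<integral>\<^sup>+y\<in>P i. v y \<partial>M) * indicator (F j) i \<partial>count_space J)"
        using P by (intro nn_integral_cong) (simp add: nn_integral_multc)
      also have "\<dots> \<le> ennreal n * (\<integral>\<^sup>+y\<in>P j. v y \<partial>M)"
        using pack[OF j] by (simp add: F_def)
      finally have "ennreal n * (2 * (\<integral>\<^sup>+y\<in>P j - S j. v y \<partial>M)) \<le> ennreal n * (\<integral>\<^sup>+y\<in>P j. v y \<partial>M)"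
        using n by (simp add: ennreal_mult' mult_ac)
      then have half: "2 * (\<integral>\<^sup>+y\<in>P j - S j. v y \<partial>M) \<le> (\<integral>\<^sup>+y\<in>P j. v y \<partial>M)"
        using n by (subst (asm) ennreal_mult_le_mult_iff) auto
      have split: "(\<integral>\<^sup>+y\<in>P j. v y \<partial>M) = (\<integral>\<^sup>+y\<in>S j. v y \<partial>M) + (\<integral>\<^sup>+y\<in>P j - S j. v y \<partial>M)"
        by (subst nn_integral_add[symmetric])
           (auto intro!: nn_integral_cong simp: indicator_def S_def)
      obtain a b where ab: "(\<integral>\<^sup>+y\<in>S j. v y \<partial>M) = ennreal a" "(\<integral>\<^sup>+y\<in>P j - S j. v y \<partial>M) = ennreal b" "0 \<le> a" "0 \<le> b"
        using fin[OF j] unfolding split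
        by (cases "\<integral>\<^sup>+y\<in>S j. v y \<partial>M"; cases "\<integral>\<^sup>+y\<in>P j - S j. v y \<partial>M") auto
      have two: "2 * ennreal x = ennreal (2 * x)" for x
        by (simp add: ennreal_mult')
      have "2 * b \<le> a + b"
        using half ab unfolding split ab(1,2) two by (simp flip: ennreal_plus)
      then show ?thesis
        using ab unfolding split ab(1,2) two by (simp flip: ennreal_plus)
    qed
    show "(\<integral>\<^sup>+j. indicator (S j) y \<partial>count_space J) \<le> ennreal (2 * n)" for y
    proof (cases "\<exists>j\<in>J. y \<in> S j")
      case False
      then have "(\<integral>\<^sup>+j. indicator (S j) y \<partial>count_space J) = (\<integral>\<^sup>+j. 0 \<partial>count_space J)"
        by (intro nn_integral_cong) auto
      then show ?thesis by simp
    next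
      case True
      then obtain m where m: "m \<in> J" "y \<in> S m"
        and min: "\<And>j. j \<in> J \<Longrightarrow> y \<in> S j \<Longrightarrow> nat (gen m - k0) \<le> nat (gen j - k0)"
        using ex_has_least_nat[of "\<lambda>j. j \<in> J \<and> y \<in> S j" _ "\<lambda>j. nat (gen j - k0)"] by blast
      have "(\<integral>\<^sup>+j. indicator (S j) y \<partial>count_space J) \<le> N m y"
        unfolding N_def
      proof (rule nn_integral_mono)
        fix j assume "j \<in> space (count_space J)"
        then have j: "j \<in> J" by simp
        have "gen m \<le> gen j" if "y \<in> S j"
          using min[OF j that] gen[OF j] gen[OF m(1)] by simp
        then show "indicator (S j) y \<le> (indicator (P j) y * indicator (F m) j :: ennreal)"
          using m by (auto simp: indicator_def F_def S_def)
      qed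
      also have "\<dots> \<le> ennreal (2 * n)"
        using m by (simp add: S_def)
      finally show ?thesis .
    qed
  qed
qed

context dyadic_weight
begin

abbreviation "Pp k \<alpha> t \<equiv> Q k \<alpha> \<times> {t + \<gamma> * L k<..<t + L k}"

lemma sets_Pp: "\<alpha> \<in> I k \<Longrightarrow> Pp k \<alpha> t \<in> sets lam"
  by (intro sets_times sets_cube) auto

lemma emeasure_cube_times_Ioo:
  assumes "\<alpha> \<in> I k" "a \<le> b"
  shows "emeasure lam (Q k \<alpha> \<times> {a<..<b}) = ennreal (cubem k \<alpha> * (b - a))"
  using assms emeasure_cube[OF assms(1)] by (simp add: emeasure_times_Ioo sets_cube ennreal_mult)

lemma lag_le: "\<gamma> * L k \<le> L k"
  using \<gamma> mult_right_mono[of \<gamma> 1 "L k"] by simp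

lemma emeasure_Pp: "\<alpha> \<in> I k \<Longrightarrow> emeasure lam (Pp k \<alpha> t) = ennreal (cubem k \<alpha> * ((1 - \<gamma>) * L k))"
  using lag_le[of k] by (simp add: emeasure_cube_times_Ioo algebra_simps)

lemma null_slice:
  assumes "\<alpha> \<in> I k"
  shows "Q k \<alpha> \<times> {t} \<in> null_sets lam"
  using assms by (intro null_setsI sets_times sets_cube) (auto simp: emeasure_times sets_cube)

lemma finite_on_Pp:
  assumes f [measurable]: "f \<in> borel_measurable lam" and Lq: "(\<integral>\<^sup>+y. ennreal (\<bar>f y\<bar> powr q * \<omega> y) \<partial>lam) < \<infinity>"
    and al: "\<alpha> \<in> I k"
  shows "(\<integral>\<^sup>+y\<in>Pp k \<alpha> t. ennreal \<bar>f y\<bar> \<partial>lam) < \<infinity>"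
proof (rule ccontr)
  assume "\<not> ?thesis"
  then have inf: "(\<integral>\<^sup>+y\<in>Pp k \<alpha> t. ennreal \<bar>f y\<bar> \<partial>lam) = \<infinity>"
    by (simp add: less_top[symmetric])
  obtain b C where b: "0 < b" "b \<le> 1" and tests: "\<And>k \<alpha> t. \<alpha> \<in> I k \<Longrightarrow>
      tests lam \<omega> q (Q k \<alpha> \<times> {t - b * L k<..<t}) (Pp k \<alpha> t) (C * (L k * cubem k \<alpha>) powr q)"
    by (rule rectangle_tests) (rule that)
  let ?U = "Q k \<alpha> \<times> {t - b * L k<..<t}"
  define c where "c = C * (L k * cubem k \<alpha>) powr q"
  define Y where "Y = ennreal c * (\<integral>\<^sup>+y. ennreal (\<bar>f y\<bar> powr q * \<omega> y) \<partial>lam)"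
  have Y: "Y < \<infinity>"
    unfolding Y_def using Lq by (simp add: ennreal_mult_less_top)
  have le: "ennreal (m powr q) * W ?U \<le> Y" if "0 < m" for m :: real
  proof -
    have "ennreal (m powr q) * W ?U \<le> ennreal c * (\<integral>\<^sup>+y\<in>Pp k \<alpha> t. ennreal (\<bar>f y\<bar> powr q * \<omega> y) \<partial>lam)"
      using that inf unfolding c_def by (intro testsD[OF tests[OF al] f]) auto
    also have "\<dots> \<le> Y"
      unfolding Y_def by (intro mult_left_mono nn_integral_mono) (auto simp: indicator_def)
    finally show ?thesis .
  qed
  have "0 < W ?U"
    using al b emeasure_cube[OF al] by (intro W_pos sets_times sets_cube) (auto simp: emeasure_cube_times_Ioo)
  moreover have "W ?U < \<infinity>"
    using le[of 1] Y by (simp add: order_le_less_trans)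
  ultimately obtain w where w: "W ?U = ennreal w" "0 < w"
    by (cases "W ?U") auto
  obtain y where y: "Y = ennreal y" "0 \<le> y"
    using Y by (cases Y) auto
  define m where "m = ((y + 1) / w) powr (1 / q)"
  have "m powr q = (y + 1) / w"
    using y w q by (simp add: m_def powr_powr)
  moreover have "0 < m"
    using y w by (simp add: m_def)
  ultimately have "ennreal ((y + 1) / w) * ennreal w \<le> ennreal y"
    using le[of m] by (simp add: w y)
  then have "(y + 1) / w * w \<le> y"
    using y w by (simp add: ennreal_mult'[symmetric])
  then show False
    using w by simp
qed

definition level :: "('a \<times> real \<Rightarrow> real) \<Rightarrow> real \<Rightarrow> int \<Rightarrow> 'i \<Rightarrow> real \<Rightarrow> bool" where
  "level f \<xi> k \<alpha> t \<longleftrightarrow>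
     ennreal \<xi> * emeasure lam (Pp k \<alpha> t) \<le> (\<integral>\<^sup>+y\<in>Pp k \<alpha> t. ennreal \<bar>f y\<bar> \<partial>lam)
     \<and> (\<integral>\<^sup>+y\<in>Pp k \<alpha> t. ennreal \<bar>f y\<bar> \<partial>lam) \<le> ennreal (2 * \<xi>) * emeasure lam (Pp k \<alpha> t)"

lemma level_Sup:
  assumes f [measurable]: "f \<in> borel_measurable lam" and Lq: "(\<integral>\<^sup>+y. ennreal (\<bar>f y\<bar> powr q * \<omega> y) \<partial>lam) < \<infinity>"
    and al: "\<alpha> \<in> I k" and A: "A \<noteq> {}" "bdd_above A" "\<And>t. t \<in> A \<Longrightarrow> level f \<xi> k \<alpha> t"
  shows "level f \<xi> k \<alpha> (Sup A)"
proof -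
  define T where "T = Sup A"
  define e where "e = (1 - \<gamma>) * L k / 2"
  have e: "0 < e"
    using \<gamma> by (simp add: e_def)
  have "T \<in> closure A"
    unfolding T_def using A by (intro closure_contains_Sup)
  then obtain s0 where s0: "\<And>n. s0 n \<in> A" "s0 \<longlonglongrightarrow> T"
    unfolding closure_sequential by blast
  obtain n0 where n0: "\<And>n. n0 \<le> n \<Longrightarrow> T - e < s0 n"
    using order_tendstoD(1)[OF s0(2), of "T - e"] e unfolding eventually_sequentially by auto
  define s where "s n = s0 (n + n0)" for n
  have s: "s n \<in> A" "s n \<le> T" "T - e < s n" "s \<longlonglongrightarrow> T" for n
  proof -
    show "s n \<in> A" using s0 by (simp add: s_def)
    then show "s n \<le> T" unfolding T_def using A by (intro cSup_upper)
    show "T - e < s n" using n0 by (simp add: s_def)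
    show "s \<longlonglongrightarrow> T" unfolding s_def by (rule LIMSEQ_ignore_initial_segment[OF s0(2)])
  qed
  let ?g = "\<lambda>t y. ennreal \<bar>f y\<bar> * indicator (Pp k \<alpha> t) y"
  have m [measurable]: "?g t \<in> borel_measurable lam" for t
    using f sets_Pp[OF al] by measurable
  have lim: "(\<lambda>n. integral\<^sup>N lam (?g (s n))) \<longlonglongrightarrow> integral\<^sup>N lam (?g T)"
  proof (rule nn_integral_dominated_convergence[where w = "\<lambda>y. ?g (T - e) y + ?g T y"])
    show "AE y in lam. ?g (s n) y \<le> ?g (T - e) y + ?g T y" for n
    proof (rule AE_I2)
      fix y :: "'a \<times> real"
      have "y \<in> Pp k \<alpha> (T - e) \<or> y \<in> Pp k \<alpha> T" if "y \<in> Pp k \<alpha> (s n)"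
      proof -
        have "T + \<gamma> * L k < T - e + L k"
          using e by (simp add: e_def field_simps)
        then show ?thesis
          using that s(2,3)[of n] by (cases y) auto
      qed
      then show "?g (s n) y \<le> ?g (T - e) y + ?g T y"
        by (auto simp: indicator_def)
    qed
    show "(\<integral>\<^sup>+y. ?g (T - e) y + ?g T y \<partial>lam) < \<infinity>"
      using finite_on_Pp[OF f Lq al] by (simp add: nn_integral_add)
    show "AE y in lam. (\<lambda>n. ?g (s n) y) \<longlonglongrightarrow> ?g T y"
      using AE_not_in[OF null_slice[OF al, of "T + \<gamma> * L k"]]
    proof eventually_elim
      fix y assume y: "y \<notin> Q k \<alpha> \<times> {T + \<gamma> * L k}"
      obtain x u where xu: "y = (x, u)" by (cases y)
      have "eventually (\<lambda>n. y \<in> Pp k \<alpha> (s n) \<longleftrightarrow> y \<in> Pp k \<alpha> T) sequentially"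
      proof (cases "x \<in> Q k \<alpha>")
        case True
        with y xu consider "u < T + \<gamma> * L k" | "T + \<gamma> * L k < u" "u < T + L k" | "T + L k \<le> u"
          by force
        then show ?thesis
        proof cases
          case 1
          then have "eventually (\<lambda>n. u - \<gamma> * L k < s n) sequentially"
            by (intro order_tendstoD(1)[OF s(4)]) simp
          then show ?thesis
            by eventually_elim (use 1 xu in auto)
        next
          case 2
          then have "eventually (\<lambda>n. u - L k < s n) sequentially"
            by (intro order_tendstoD(1)[OF s(4)]) simp
          then show ?thesis
          proof eventually_elim
            case (elim n)
            with 2 xu s(2)[of n] show ?case by auto
          qed
        next
          case 3
          have "y \<notin> Pp k \<alpha> (s n)" for n
            using s(2)[of n] 3 xu by auto
          then show ?thesis
            using 3 xu by simp
        qed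
      qed (use xu in simp)
      then have "eventually (\<lambda>n. ?g T y = ?g (s n) y) sequentially"
        by eventually_elim (auto simp: indicator_def)
      then show "(\<lambda>n. ?g (s n) y) \<longlonglongrightarrow> ?g T y"
        by (rule Lim_transform_eventually[OF tendsto_const])
    qed
  qed measurable
  have lev: "level f \<xi> k \<alpha> (s n)" for n
    using A(3) s(1) by blast
  have "ennreal \<xi> * emeasure lam (Pp k \<alpha> T) \<le> integral\<^sup>N lam (?g T)"
    by (rule LIMSEQ_le_const[OF lim]) (use lev al in \<open>simp add: level_def emeasure_Pp\<close>)
  moreover have "integral\<^sup>N lam (?g T) \<le> ennreal (2 * \<xi>) * emeasure lam (Pp k \<alpha> T)"
    by (rule LIMSEQ_le_const2[OF lim]) (use lev al in \<open>simp add: level_def emeasure_Pp\<close>)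
  ultimately show ?thesis
    by (simp add: level_def T_def)
qed

lemma L_antimono: "k \<le> l \<Longrightarrow> L l \<le> L k"
  using \<delta> p unfolding L_def by (intro powr_mono') auto

lemma L_half:
  assumes "k < l"
  shows "L l \<le> L k / 2"
proof -
  have "L l \<le> L (k + 1)"
    using assms by (intro L_antimono) simp
  also have "\<dots> = L k * \<delta> powr p"
    by (simp add: L_def powr_add[symmetric] distrib_right)
  also have "\<delta> powr p \<le> \<delta> powr 1"
    using \<delta> p by (intro powr_mono') auto
  also have "\<delta> powr 1 \<le> 1 / 2"
    using \<delta> by simp
  finally show ?thesis
    by simp
qed

lemma overlap_le_2:
  fixes b :: real
  defines "U \<equiv> \<lambda>(k, \<alpha>, t). Q k \<alpha> \<times> {t - b * L k<..<t - b * L k / 2}"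
  assumes b: "0 < b"
    and mem: "\<And>k \<alpha> t. (k, \<alpha>, t) \<in> Sel \<Longrightarrow> \<alpha> \<in> I k"
    and sep: "\<And>k \<alpha> t k' \<alpha>' t'. (k, \<alpha>, t) \<in> Sel \<Longrightarrow> (k', \<alpha>', t') \<in> Sel \<Longrightarrow> k' < k \<Longrightarrow>
       Q k \<alpha> \<inter> Q k' \<alpha>' \<noteq> {} \<Longrightarrow> t \<le> t' - b * L k' \<or> t' < t"
    and cell: "\<And>k \<alpha> t t'. (k, \<alpha>, t) \<in> Sel \<Longrightarrow> (k, \<alpha>, t') \<in> Sel \<Longrightarrow>
       \<lceil>t / (b * L k)\<rceil> = \<lceil>t' / (b * L k)\<rceil> \<Longrightarrow> t = t'"
  shows "(\<integral>\<^sup>+i. indicator (U i) y \<partial>count_space Sel) \<le> 2"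
proof -
  define D where "D = {i \<in> Sel. y \<in> U i}"
  have "finite D \<and> card D \<le> 2"
  proof (cases "D = {}")
    case False
    obtain x s where y: "y = (x, s)" by (cases y)
    have gen: "\<not> k' < k" if "(k, \<alpha>, t) \<in> D" "(k', \<alpha>', t') \<in> D" for k \<alpha> t k' \<alpha>' t'
    proof
      assume less: "k' < k"
      have S: "(k, \<alpha>, t) \<in> Sel" "(k', \<alpha>', t') \<in> Sel" and x: "x \<in> Q k \<alpha> \<inter> Q k' \<alpha>'"
        and s: "t - b * L k < s" "s < t - b * L k / 2" "t' - b * L k' < s" "s < t' - b * L k' / 2"
        using that by (auto simp: D_def U_def y)
      have "b * L k \<le> b * (L k' / 2)"
        using b L_half[OF less] by (intro mult_left_mono) auto
      moreover have "0 < b * L k"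
        using b by simp
      ultimately show False
        using sep[OF S less] x s by auto
    qed
    obtain k \<alpha> t where i: "(k, \<alpha>, t) \<in> D"
      using False by auto
    have same: "k' = k \<and> \<alpha>' = \<alpha>" if "(k', \<alpha>', t') \<in> D" for k' \<alpha>' t'
    proof -
      have k: "k' = k"
        using gen[OF i that] gen[OF that i] by simp
      have "\<alpha>' \<in> I k" "\<alpha> \<in> I k" "x \<in> Q k \<alpha>'" "x \<in> Q k \<alpha>"
        using i that mem k by (auto simp: D_def U_def y)
      with cubes_disjoint[of k] have "\<alpha>' = \<alpha>"
        by (auto simp: disjoint_family_on_def)
      with k show ?thesis ..
    qed
    let ?c = "\<lambda>(k :: int, \<alpha> :: 'i, t). \<lceil>t / (b * L k)\<rceil>"
    have inj: "inj_on ?c D"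
    proof (rule inj_onI)
      fix i j assume "i \<in> D" "j \<in> D" and eq: "?c i = ?c j"
      moreover obtain k1 a1 t1 k2 a2 t2 where ij: "i = (k1, a1, t1)" "j = (k2, a2, t2)"
        by (cases i, cases j)
      ultimately show "i = j"
        using same[of k1 a1 t1] same[of k2 a2 t2] cell[of k \<alpha> t1 t2] by (auto simp: D_def)
    qed
    have img: "?c ` D \<subseteq> {\<lceil>s / (b * L k)\<rceil>, \<lceil>s / (b * L k)\<rceil> + 1}"
    proof
      fix c assume "c \<in> ?c ` D"
      then obtain t' where t': "(k, \<alpha>, t') \<in> D" "c = \<lceil>t' / (b * L k)\<rceil>"
        using same by fastforce
      have h: "0 < b * L k" using b by simp
      have "s \<le> t'" "t' \<le> s + b * L k"
        using t'(1) h by (auto simp: D_def U_def y)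
      then have "s / (b * L k) \<le> t' / (b * L k)" "t' / (b * L k) \<le> s / (b * L k) + 1"
        using h by (auto simp: field_simps)
      then have "\<lceil>s / (b * L k)\<rceil> \<le> c" "c \<le> \<lceil>s / (b * L k)\<rceil> + 1"
        unfolding t'(2) by linarith+
      then show "c \<in> {\<lceil>s / (b * L k)\<rceil>, \<lceil>s / (b * L k)\<rceil> + 1}"
        by auto
    qed
    have "finite D" "card D \<le> card {\<lceil>s / (b * L k)\<rceil>, \<lceil>s / (b * L k)\<rceil> + 1}"
      using inj_on_finite[OF inj img] card_inj_on_le[OF inj img] by auto
    moreover have "card {\<lceil>s / (b * L k)\<rceil>, \<lceil>s / (b * L k)\<rceil> + 1} \<le> 2"
      by simp
    ultimately show ?thesis by linarith
  qed simp
  moreover have "(\<integral>\<^sup>+i. indicator (U i) y \<partial>count_space Sel) = (\<integral>\<^sup>+i. indicator D i \<partial>count_space Sel)"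
    by (intro nn_integral_cong) (auto simp: D_def indicator_def)
  moreover have "\<dots> = emeasure (count_space Sel) D"
    by (intro nn_integral_indicator) (auto simp: D_def)
  moreover have "emeasure (count_space Sel) D = of_nat (card D)" if "finite D"
    using that by (intro emeasure_count_space_finite) (auto simp: D_def)
  ultimately show ?thesis
    by (metis of_nat_le_iff of_nat_numeral)
qed

lemma selected_packing:
  fixes b \<xi> :: real and Sel :: "(int \<times> 'i \<times> real) set"
  defines "P \<equiv> \<lambda>(k, \<alpha>, t). Pp k \<alpha> t"
  assumes b: "0 < b" "b \<le> 1" and \<xi>: "0 < \<xi>" and Sel: "countable Sel"
    and mem: "\<And>k \<alpha> t. (k, \<alpha>, t) \<in> Sel \<Longrightarrow> \<alpha> \<in> I k \<and> level f \<xi> k \<alpha> t"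
    and sep: "\<And>k \<alpha> t k' \<alpha>' t'. (k, \<alpha>, t) \<in> Sel \<Longrightarrow> (k', \<alpha>', t') \<in> Sel \<Longrightarrow> k' < k \<Longrightarrow>
       Q k \<alpha> \<inter> Q k' \<alpha>' \<noteq> {} \<Longrightarrow> t \<le> t' - b * L k' \<or> t' < t"
    and cell: "\<And>k \<alpha> t t'. (k, \<alpha>, t) \<in> Sel \<Longrightarrow> (k, \<alpha>, t') \<in> Sel \<Longrightarrow>
       \<lceil>t / (b * L k)\<rceil> = \<lceil>t' / (b * L k)\<rceil> \<Longrightarrow> t = t'"
    and j: "j \<in> Sel"
  shows "(\<integral>\<^sup>+i. (\<integral>\<^sup>+y\<in>P i. ennreal \<bar>f y\<bar> \<partial>lam) * indicator {i. fst j \<le> fst i \<and> P i \<inter> P j \<noteq> {}} i \<partial>count_space Sel)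
     \<le> ennreal (48 / b) * (\<integral>\<^sup>+y\<in>P j. ennreal \<bar>f y\<bar> \<partial>lam)"
proof -
  define U where "U = (\<lambda>(k, \<alpha>, t). Q k \<alpha> \<times> {t - b * L k<..<t - b * L k / 2})"
  obtain k \<alpha> t where jk: "j = (k, \<alpha>, t)"
    by (cases j)
  have al: "\<alpha> \<in> I k" and lev: "level f \<xi> k \<alpha> t"
    using mem j jk by auto
  define X where "X = Q k \<alpha> \<times> {t - 3 * L k<..<t + 3 * L k}"
  define c where "c = 4 * \<xi> * (1 - \<gamma>) / b"
  have c: "0 \<le> c" using \<xi> \<gamma> b by (simp add: c_def)
  have [measurable]: "X \<in> sets lam"
    unfolding X_def using al by (intro sets_times sets_cube) auto
  have sets_U: "U i \<in> sets lam" if i: "i \<in> Sel" for i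
  proof -
    obtain k' \<alpha>' t' where "i = (k', \<alpha>', t')"
      by (cases i)
    then show ?thesis
      using i mem by (auto simp: U_def intro!: sets_times sets_cube)
  qed
  have "(\<integral>\<^sup>+i. (\<integral>\<^sup>+y\<in>P i. ennreal \<bar>f y\<bar> \<partial>lam) * indicator {i. fst j \<le> fst i \<and> P i \<inter> P j \<noteq> {}} i \<partial>count_space Sel)
     \<le> (\<integral>\<^sup>+i. (\<integral>\<^sup>+y. ennreal c * (indicator (U i) y * indicator X y) \<partial>lam) \<partial>count_space Sel)"
  proof (rule nn_integral_mono)
    fix i assume "i \<in> space (count_space Sel)"
    then have i: "i \<in> Sel" by simp
    obtain k' \<alpha>' t' where ik: "i = (k', \<alpha>', t')"
      by (cases i)
    have al': "\<alpha>' \<in> I k'" and lev': "level f \<xi> k' \<alpha>' t'"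
      using mem i ik by auto
    show "(\<integral>\<^sup>+y\<in>P i. ennreal \<bar>f y\<bar> \<partial>lam) * indicator {i. fst j \<le> fst i \<and> P i \<inter> P j \<noteq> {}} i
      \<le> (\<integral>\<^sup>+y. ennreal c * (indicator (U i) y * indicator X y) \<partial>lam)"
    proof (cases "k \<le> k' \<and> Pp k' \<alpha>' t' \<inter> Pp k \<alpha> t \<noteq> {}")
      case True
      then obtain x s where xs: "x \<in> Q k' \<alpha>'" "x \<in> Q k \<alpha>" "t' + \<gamma> * L k' < s" "s < t' + L k'" "t + \<gamma> * L k < s" "s < t + L k"
        by auto
      have sub: "Q k' \<alpha>' \<subseteq> Q k \<alpha>"
        using True xs al al' by (intro nested) auto
      have LL: "L k' \<le> L k"
        using True by (intro L_antimono) simp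
      have pos: "0 \<le> \<gamma> * L k'" "0 \<le> \<gamma> * L k" "0 < b * L k'" "b * L k' \<le> L k'"
        using \<gamma> b by (auto simp: mult_left_le_one_le)
      have UX: "U i \<subseteq> X"
      proof -
        define h where "h = b * L k'"
        have "0 < h" "h \<le> L k'"
          using pos by (auto simp: h_def)
        then show ?thesis
          using sub xs LL pos(1,2) unfolding ik U_def X_def by (auto simp: h_def[symmetric])
      qed
      have "(\<integral>\<^sup>+y\<in>P i. ennreal \<bar>f y\<bar> \<partial>lam) \<le> ennreal (2 * \<xi>) * ennreal (cubem k' \<alpha>' * ((1 - \<gamma>) * L k'))"
        using lev' al' by (simp add: level_def ik P_def emeasure_Pp)
      also have "\<dots> = ennreal (c * (cubem k' \<alpha>' * (b * L k' / 2)))"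
      proof -
        have "2 * \<xi> * (cubem k' \<alpha>' * ((1 - \<gamma>) * L k')) = c * (cubem k' \<alpha>' * (b * L k' / 2))"
          using b by (simp add: c_def)
        moreover have "0 \<le> 2 * \<xi>"
          using \<xi> by simp
        ultimately show ?thesis
          by (simp only: ennreal_mult'[symmetric])
      qed
      also have "\<dots> = ennreal c * emeasure lam (U i)"
      proof -
        have "emeasure lam (U i) = ennreal (cubem k' \<alpha>' * (b * L k' / 2))"
          using al' pos by (simp add: ik U_def emeasure_cube_times_Ioo)
        then show ?thesis
          by (simp only: ennreal_mult'[OF c])
      qed
      also have "\<dots> = (\<integral>\<^sup>+y. ennreal c * indicator (U i) y \<partial>lam)"
        using sets_U[OF i] by (simp add: nn_integral_cmult)
      also have "\<dots> = (\<integral>\<^sup>+y. ennreal c * (indicator (U i) y * indicator X y) \<partial>lam)"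
        using UX by (intro nn_integral_cong) (auto simp: indicator_def)
      finally show ?thesis
        by (auto simp: indicator_def)
    qed (auto simp: ik jk P_def indicator_def)
  qed
  also have "\<dots> = (\<integral>\<^sup>+y. (\<integral>\<^sup>+i. ennreal c * (indicator (U i) y * indicator X y) \<partial>count_space Sel) \<partial>lam)"
    by (rule nn_integral_count_space_nn_integral[OF Sel, symmetric]) (use sets_U in measurable)
  also have "\<dots> \<le> (\<integral>\<^sup>+y. ennreal c * (2 * indicator X y) \<partial>lam)"
  proof (rule nn_integral_mono)
    fix y
    have "(\<integral>\<^sup>+i. ennreal c * (indicator (U i) y * indicator X y) \<partial>count_space Sel)
        = ennreal c * ((\<integral>\<^sup>+i. indicator (U i) y \<partial>count_space Sel) * indicator X y)"
      by (simp add: nn_integral_cmult nn_integral_multc)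
    also have "\<dots> \<le> ennreal c * (2 * indicator X y)"
      unfolding U_def using b mem sep cell by (intro mult_left_mono mult_right_mono overlap_le_2) auto
    finally show "(\<integral>\<^sup>+i. ennreal c * (indicator (U i) y * indicator X y) \<partial>count_space Sel) \<le> ennreal c * (2 * indicator X y)" .
  qed
  also have "\<dots> = ennreal c * (2 * emeasure lam X)"
    by (simp add: nn_integral_cmult)
  also have "\<dots> = ennreal (c * (2 * (cubem k \<alpha> * (6 * L k))))"
  proof -
    have "emeasure lam X = ennreal (cubem k \<alpha> * (6 * L k))"
      using al by (simp add: X_def emeasure_cube_times_Ioo)
    moreover have "2 * ennreal x = ennreal (2 * x)" for x
      by (simp add: ennreal_mult')
    ultimately show ?thesis
      by (simp only: ennreal_mult'[OF c])
  qed
  also have "\<dots> = ennreal (48 / b) * (ennreal \<xi> * ennreal (cubem k \<alpha> * ((1 - \<gamma>) * L k)))"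
    using \<xi> b by (simp add: c_def ennreal_mult'[symmetric] field_simps)
  also have "\<dots> \<le> ennreal (48 / b) * (\<integral>\<^sup>+y\<in>P j. ennreal \<bar>f y\<bar> \<partial>lam)"
    using lev al by (intro mult_left_mono) (simp_all add: level_def jk P_def emeasure_Pp)
  finally show ?thesis .
qed

lemma level_set_bound:
  obtains C where "0 < C" "\<And>f \<xi> k0. f \<in> borel_measurable lam \<Longrightarrow>
      (\<integral>\<^sup>+y. ennreal (\<bar>f y\<bar> powr q * \<omega> y) \<partial>lam) < \<infinity> \<Longrightarrow> 0 < \<xi> \<Longrightarrow>
      \<exists>G \<in> sets lam. (\<forall>k \<alpha> t. k0 \<le> k \<longrightarrow> \<alpha> \<in> I k \<longrightarrow> level f \<xi> k \<alpha> t \<longrightarrow> Q k \<alpha> \<times> {t} \<subseteq> G) \<and>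
        W G \<le> ennreal (C * \<xi> powr (- q)) * (\<integral>\<^sup>+y. ennreal (\<bar>f y\<bar> powr q * \<omega> y) \<partial>lam)"
proof -
  obtain b C0 where b: "0 < b" "b \<le> 1" and C0: "0 < C0" and tests: "\<And>k \<alpha> t. \<alpha> \<in> I k \<Longrightarrow>
      tests lam \<omega> q (Q k \<alpha> \<times> {t - b * L k<..<t}) (Pp k \<alpha> t) (C0 * (L k * cubem k \<alpha>) powr q)"
    by (rule rectangle_tests) (rule that)
  define n where "n = 48 / b"
  have n: "0 < n" using b by (simp add: n_def)
  define C where "C = C0 * (2 / (1 - \<gamma>)) powr q"
  have C: "0 < C" using C0 \<gamma> by (simp add: C_def)
  show ?thesis
  proof (rule that[of "2 * n * C"])
    show "0 < 2 * n * C" using n C by simp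
    fix f and \<xi> :: real and k0
    assume f [measurable]: "f \<in> borel_measurable lam" and Lq: "(\<integral>\<^sup>+y. ennreal (\<bar>f y\<bar> powr q * \<omega> y) \<partial>lam) < \<infinity>"
      and \<xi>: "0 < \<xi>"
    let ?F = "\<lambda>y. ennreal (\<bar>f y\<bar> powr q * \<omega> y)"
    have nonempty: "Q k \<alpha> \<noteq> {}" if "\<alpha> \<in> I k" for k \<alpha>
      using center_in_cube[OF that] by auto
    have h: "0 < b * L k" for k
      using b by simp
    note closed = level_Sup[OF f Lq, of _ _ _ \<xi>]
    obtain Sel where
      mem: "\<And>k \<alpha> t. (k, \<alpha>, t) \<in> Sel \<Longrightarrow> k0 \<le> k \<and> \<alpha> \<in> I k \<and> level f \<xi> k \<alpha> t" and
      cover: "\<And>k \<alpha> t. k0 \<le> k \<Longrightarrow> \<alpha> \<in> I k \<Longrightarrow> level f \<xi> k \<alpha> t \<Longrightarrow>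
       \<exists>k' \<alpha>' t'. (k', \<alpha>', t') \<in> Sel \<and> Q k \<alpha> \<subseteq> Q k' \<alpha>' \<and> t' - b * L k' < t \<and> t \<le> t'" and
      sep: "\<And>k \<alpha> t k' \<alpha>' t'. (k, \<alpha>, t) \<in> Sel \<Longrightarrow> (k', \<alpha>', t') \<in> Sel \<Longrightarrow> k' < k \<Longrightarrow>
       Q k \<alpha> \<inter> Q k' \<alpha>' \<noteq> {} \<Longrightarrow> t \<le> t' - b * L k' \<or> t' < t" and
      cell: "\<And>k \<alpha> t t'. (k, \<alpha>, t) \<in> Sel \<Longrightarrow> (k, \<alpha>, t') \<in> Sel \<Longrightarrow>
       \<lceil>t / (b * L k)\<rceil> = \<lceil>t' / (b * L k)\<rceil> \<Longrightarrow> t = t'"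
      by (rule greedy_selection[where I = I and Q = Q and h = "\<lambda>k. b * L k" and bad = "level f \<xi>" and ?k0.0 = k0, OF nonempty nested h closed])
         (assumption | rule that)+
    have countable: "countable Sel"
    proof -
      define J where "J = (SIGMA k:UNIV. I k \<times> (UNIV :: int set))"
      have 1: "countable J"
        unfolding J_def by (intro countable_SIGMA countable_cubes) auto
      have 2: "(\<lambda>(k, \<alpha>, t). (k, \<alpha>, \<lceil>t / (b * L k)\<rceil>)) ` Sel \<subseteq> J"
        using mem by (auto simp: J_def)
      have 3: "inj_on (\<lambda>(k, \<alpha>, t). (k, \<alpha>, \<lceil>t / (b * L k)\<rceil>)) Sel"
        using cell by (auto simp: inj_on_def)
      show ?thesis
        by (rule countable_image_inj_on[OF countable_subset[OF 2 1] 3])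
    qed
    define P where "P = (\<lambda>(k, \<alpha>, t). Pp k \<alpha> t)"
    define U where "U = (\<lambda>(k, \<alpha>, t). Q k \<alpha> \<times> {t - b * L k<..t})"
    have sets_P: "P j \<in> sets lam" if "j \<in> Sel" for j
        using that mem sets_Pp by (cases j) (auto simp: P_def)
    have gen: "k0 \<le> fst j" if "j \<in> Sel" for j
        using that mem by (cases j) auto
    have fin: "(\<integral>\<^sup>+y\<in>P j. ennreal \<bar>f y\<bar> \<partial>lam) < \<infinity>" if "j \<in> Sel" for j
        using that mem finite_on_Pp[OF f Lq] by (cases j) (auto simp: P_def)
    have pack: "(\<integral>\<^sup>+i. (\<integral>\<^sup>+y\<in>P i. ennreal \<bar>f y\<bar> \<partial>lam) * indicator {i. fst j \<le> fst i \<and> P i \<inter> P j \<noteq> {}} i \<partial>count_space Sel)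
          \<le> ennreal n * (\<integral>\<^sup>+y\<in>P j. ennreal \<bar>f y\<bar> \<partial>lam)" if "j \<in> Sel" for j
        unfolding P_def n_def
        by (rule selected_packing[OF b \<xi> countable _ sep cell that]) (use mem in auto)
    have v: "(\<lambda>y. ennreal \<bar>f y\<bar>) \<in> borel_measurable lam"
      by measurable
    obtain S where S: "\<And>j. j \<in> Sel \<Longrightarrow> S j \<in> sets lam" "\<And>j. j \<in> Sel \<Longrightarrow> S j \<subseteq> P j"
      and S_mass: "\<And>j. j \<in> Sel \<Longrightarrow> (\<integral>\<^sup>+y\<in>P j. ennreal \<bar>f y\<bar> \<partial>lam) \<le> 2 * (\<integral>\<^sup>+y\<in>S j. ennreal \<bar>f y\<bar> \<partial>lam)"
      and S_overlap: "\<And>y. (\<integral>\<^sup>+j. indicator (S j) y \<partial>count_space Sel) \<le> ennreal (2 * n)"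
      by (rule packing_bounded_overlap[OF countable gen sets_P v n fin pack]) (assumption | rule that)+
    have sets_U: "U j \<in> sets lam" if "j \<in> Sel" for j
      using that mem by (cases j) (auto simp: U_def intro!: sets_times sets_cube)
    define d where "d = C * \<xi> powr (- q)"
    have d: "0 \<le> d" using C by (simp add: d_def)
    have W_U: "W (U j) \<le> ennreal d * (\<integral>\<^sup>+y\<in>S j. ?F y \<partial>lam)" if j: "j \<in> Sel" for j
    proof -
      obtain k \<alpha> t where jk: "j = (k, \<alpha>, t)" by (cases j)
      have al: "\<alpha> \<in> I k" and lev: "level f \<xi> k \<alpha> t"
        using mem j jk by auto
      define a where "a = L k * cubem k \<alpha>"
      have a: "0 < a"
        using emeasure_cube[OF al] by (simp add: a_def)
      define m where "m = \<xi> * (1 - \<gamma>) / 2 * a"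
      have m: "0 < m"
        using \<xi> \<gamma> a by (simp add: m_def)
      have "2 * ennreal m = ennreal (2 * m)"
        by (simp add: ennreal_mult')
      also have "\<dots> = ennreal \<xi> * ennreal (cubem k \<alpha> * ((1 - \<gamma>) * L k))"
        using \<xi> by (simp add: m_def a_def ennreal_mult'[symmetric] mult_ac)
      also have "\<dots> \<le> (\<integral>\<^sup>+y\<in>P j. ennreal \<bar>f y\<bar> \<partial>lam)"
        using lev al by (simp add: level_def jk P_def emeasure_Pp)
      also have "\<dots> \<le> 2 * (\<integral>\<^sup>+y\<in>S j. ennreal \<bar>f y\<bar> \<partial>lam)"
        by (rule S_mass[OF j])
      finally have mS: "ennreal m \<le> (\<integral>\<^sup>+y\<in>S j. ennreal \<bar>f y\<bar> \<partial>lam)"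
        by (subst (asm) ennreal_mult_le_mult_iff) auto
      have "ennreal (m powr q) * W (Q k \<alpha> \<times> {t - b * L k<..<t}) \<le> ennreal (C0 * a powr q) * (\<integral>\<^sup>+y\<in>S j. ?F y \<partial>lam)"
        unfolding a_def
        by (rule testsD_subset[OF tests[OF al] f S(1)[OF j] _ m mS]) (use S(2)[OF j] in \<open>simp add: jk P_def\<close>)
      also have "C0 * a powr q = m powr q * d"
      proof -
        have "m powr q = \<xi> powr q * (1 - \<gamma>) powr q / 2 powr q * a powr q"
          unfolding m_def by (simp only: powr_mult powr_divide)
        moreover have "d = C0 * (2 powr q / (1 - \<gamma>) powr q) * (1 / \<xi> powr q)"
          unfolding d_def C_def by (simp only: powr_divide powr_minus_divide)
        ultimately show ?thesis
          using \<xi> \<gamma> by simp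
      qed
      also have "ennreal (m powr q * d) * (\<integral>\<^sup>+y\<in>S j. ?F y \<partial>lam) = ennreal (m powr q) * (ennreal d * (\<integral>\<^sup>+y\<in>S j. ?F y \<partial>lam))"
        by (simp add: ennreal_mult' mult.assoc)
      finally have "W (Q k \<alpha> \<times> {t - b * L k<..<t}) \<le> ennreal d * (\<integral>\<^sup>+y\<in>S j. ?F y \<partial>lam)"
        using m by (subst (asm) ennreal_mult_le_mult_iff) auto
      moreover have "W (U j) \<le> W (Q k \<alpha> \<times> {t - b * L k<..<t})"
        unfolding weighted_def
      proof (rule nn_integral_mono_AE)
        show "AE y in lam. ennreal (\<omega> y) * indicator (U j) y \<le> ennreal (\<omega> y) * indicator (Q k \<alpha> \<times> {t - b * L k<..<t}) y"
          using AE_not_in[OF null_slice[OF al, of t]]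
          by eventually_elim (auto simp: U_def jk indicator_def)
      qed
      ultimately show ?thesis by simp
    qed
    have F [measurable]: "?F \<in> borel_measurable lam"
      by measurable
    have "(\<integral>\<^sup>+j. (\<integral>\<^sup>+y\<in>S j. ?F y \<partial>lam) \<partial>count_space Sel) = (\<integral>\<^sup>+y. (\<integral>\<^sup>+j. ?F y * indicator (S j) y \<partial>count_space Sel) \<partial>lam)"
      by (rule nn_integral_count_space_nn_integral[OF countable, symmetric]) (use S(1) in measurable)
    also have "\<dots> \<le> (\<integral>\<^sup>+y. ?F y * ennreal (2 * n) \<partial>lam)"
      using S_overlap by (intro nn_integral_mono) (simp add: nn_integral_cmult mult_left_mono)
    also have "\<dots> = (\<integral>\<^sup>+y. ?F y \<partial>lam) * ennreal (2 * n)"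
      by (rule nn_integral_multc[OF F])
    finally have overlap: "(\<integral>\<^sup>+j. (\<integral>\<^sup>+y\<in>S j. ?F y \<partial>lam) \<partial>count_space Sel) \<le> (\<integral>\<^sup>+y. ?F y \<partial>lam) * ennreal (2 * n)" .
    define G where "G = (\<Union>j\<in>Sel. U j)"
    have "W G \<le> (\<integral>\<^sup>+y. (\<integral>\<^sup>+j. ennreal (\<omega> y) * indicator (U j) y \<partial>count_space Sel) \<partial>lam)"
      unfolding weighted_def
    proof (rule nn_integral_mono)
      fix y
      show "ennreal (\<omega> y) * indicator G y \<le> (\<integral>\<^sup>+j. ennreal (\<omega> y) * indicator (U j) y \<partial>count_space Sel)"
      proof (cases "y \<in> G")
        case True
        then obtain j where j: "j \<in> Sel" "y \<in> U j"
          by (auto simp: G_def)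
        have "ennreal (\<omega> y) * indicator (U j) y \<le> (\<integral>\<^sup>+j. ennreal (\<omega> y) * indicator (U j) y \<partial>count_space Sel)"
          by (rule nn_integral_ge_point[OF j(1)])
        with True j show ?thesis by simp
      qed simp
    qed
    also have "\<dots> = (\<integral>\<^sup>+j. W (U j) \<partial>count_space Sel)"
      unfolding weighted_def
      by (rule nn_integral_count_space_nn_integral[OF countable]) (use sets_U in measurable)
    also have "\<dots> \<le> (\<integral>\<^sup>+j. ennreal d * (\<integral>\<^sup>+y\<in>S j. ?F y \<partial>lam) \<partial>count_space Sel)"
      using W_U by (intro nn_integral_mono) auto
    also have "\<dots> = ennreal d * (\<integral>\<^sup>+j. (\<integral>\<^sup>+y\<in>S j. ?F y \<partial>lam) \<partial>count_space Sel)"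
      by (simp add: nn_integral_cmult)
    also have "\<dots> \<le> ennreal d * ((\<integral>\<^sup>+y. ?F y \<partial>lam) * ennreal (2 * n))"
      by (intro mult_left_mono overlap) simp
    also have "\<dots> = ennreal (d * (2 * n)) * (\<integral>\<^sup>+y. ?F y \<partial>lam)"
      by (simp only: ennreal_mult'[OF d] mult_ac)
    also have "d * (2 * n) = 2 * n * C * \<xi> powr (- q)"
      by (simp add: d_def)
    finally have "W G \<le> ennreal (2 * n * C * \<xi> powr (- q)) * (\<integral>\<^sup>+y. ?F y \<partial>lam)" .
    moreover have "G \<in> sets lam"
      unfolding G_def using countable sets_U by (intro sets.countable_UN') auto
    moreover have "Q k \<alpha> \<times> {t} \<subseteq> G" if "k0 \<le> k" "\<alpha> \<in> I k" "level f \<xi> k \<alpha> t" for k \<alpha> t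
      using cover[OF that] by (force simp: G_def U_def)
    ultimately show "\<exists>G \<in> sets lam. (\<forall>k \<alpha> t. k0 \<le> k \<longrightarrow> \<alpha> \<in> I k \<longrightarrow> level f \<xi> k \<alpha> t \<longrightarrow> Q k \<alpha> \<times> {t} \<subseteq> G) \<and>
        W G \<le> ennreal (2 * n * C * \<xi> powr (- q)) * (\<integral>\<^sup>+y. ?F y \<partial>lam)"
      by blast
  qed
qed

section \<open>The weak type estimate\<close>

lemma one_system_bound:
  obtains C where "0 < C" "\<And>f \<xi>. f \<in> borel_measurable lam \<Longrightarrow>
      (\<integral>\<^sup>+y. ennreal (\<bar>f y\<bar> powr q * \<omega> y) \<partial>lam) < \<infinity> \<Longrightarrow> 0 < \<xi> \<Longrightarrow>
      \<exists>G \<in> sets lam. (\<forall>k \<alpha> t. \<alpha> \<in> I k \<longrightarrow> ennreal \<xi> < average lam (Pp k \<alpha> t) (\<lambda>y. \<bar>f y\<bar>) \<longrightarrow> Q k \<alpha> \<times> {t} \<subseteq> G) \<and>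
        W G \<le> ennreal (C * \<xi> powr (- q)) * (\<integral>\<^sup>+y. ennreal (\<bar>f y\<bar> powr q * \<omega> y) \<partial>lam)"
proof -
  obtain C where C: "0 < C" and bound: "\<And>f \<xi> k0. f \<in> borel_measurable lam \<Longrightarrow>
      (\<integral>\<^sup>+y. ennreal (\<bar>f y\<bar> powr q * \<omega> y) \<partial>lam) < \<infinity> \<Longrightarrow> 0 < \<xi> \<Longrightarrow>
      \<exists>G \<in> sets lam. (\<forall>k \<alpha> t. k0 \<le> k \<longrightarrow> \<alpha> \<in> I k \<longrightarrow> level f \<xi> k \<alpha> t \<longrightarrow> Q k \<alpha> \<times> {t} \<subseteq> G) \<and>
        W G \<le> ennreal (C * \<xi> powr (- q)) * (\<integral>\<^sup>+y. ennreal (\<bar>f y\<bar> powr q * \<omega> y) \<partial>lam)"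
    by (rule level_set_bound) (rule that)
  define r where "r = (2::real) powr (- q)"
  have r: "0 < r" "r < 1"
    using q by (auto simp: r_def powr_less_one)
  show ?thesis
  proof (rule that[of "C / (1 - r)"])
    show "0 < C / (1 - r)" using C r by simp
    fix f and \<xi> :: real
    assume f [measurable]: "f \<in> borel_measurable lam" and Lq: "(\<integral>\<^sup>+y. ennreal (\<bar>f y\<bar> powr q * \<omega> y) \<partial>lam) < \<infinity>"
      and \<xi>: "0 < \<xi>"
    define X where "X = (\<integral>\<^sup>+y. ennreal (\<bar>f y\<bar> powr q * \<omega> y) \<partial>lam)"
    define good where "good n N G \<longleftrightarrow> G \<in> sets lam \<and>
        (\<forall>k \<alpha> t. - int N \<le> k \<longrightarrow> \<alpha> \<in> I k \<longrightarrow> level f (2 ^ n * \<xi>) k \<alpha> t \<longrightarrow> Q k \<alpha> \<times> {t} \<subseteq> G) \<and>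
        W G \<le> ennreal (C * (2 ^ n * \<xi>) powr (- q)) * X" for n N G
    have "\<exists>G. good n N G" for n N
    proof -
      have "0 < 2 ^ n * \<xi>" using \<xi> by simp
      from bound[OF f Lq this, of "- int N"] show ?thesis
        by (simp only: good_def X_def Bex_def)
    qed
    then obtain G where good: "\<And>n N. good n N (G n N)"
      by metis
    have [measurable]: "G n N \<in> sets lam" for n N
      using good[of n N] by (simp add: good_def)
    have cover: "Q k \<alpha> \<times> {t} \<subseteq> G n N" if "- int N \<le> k" "\<alpha> \<in> I k" "level f (2 ^ n * \<xi>) k \<alpha> t" for n N k \<alpha> t
      using good[of n N] that unfolding good_def by blast
    have small: "W (G n N) \<le> ennreal (C * (2 ^ n * \<xi>) powr (- q)) * X" for n N
      using good[of n N] by (simp add: good_def)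
    define D where "D = density lam (\<lambda>y. ennreal (\<omega> y))"
    have W_D: "W A = emeasure D A" if "A \<in> sets lam" for A
      unfolding D_def using that by (intro weighted_eq_emeasure_density) auto
    have sets_D [measurable_cong]: "sets D = sets lam"
      by (simp add: D_def)
    define H where "H n = (\<Union>N. \<Inter>M\<in>{N..}. G n M)" for n
    have Hm [measurable]: "H n \<in> sets lam" for n
      unfolding H_def by measurable
    have H_le: "emeasure D (H n) \<le> ennreal (C * (2 ^ n * \<xi>) powr (- q)) * X" for n
    proof -
      have "emeasure D (H n) = (SUP N. emeasure D (\<Inter>M\<in>{N..}. G n M))"
        unfolding H_def
      proof (rule SUP_emeasure_incseq[symmetric])
        show "range (\<lambda>N. \<Inter>M\<in>{N..}. G n M) \<subseteq> sets D"
          by (auto simp: sets_D)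
        show "incseq (\<lambda>N. \<Inter>M\<in>{N..}. G n M)"
          by (rule incseq_SucI) auto
      qed
      also have "\<dots> \<le> ennreal (C * (2 ^ n * \<xi>) powr (- q)) * X"
      proof (rule SUP_least)
        fix N
        have "emeasure D (\<Inter>M\<in>{N..}. G n M) \<le> emeasure D (G n N)"
          by (intro emeasure_mono) (auto simp: sets_D)
        also have "\<dots> \<le> ennreal (C * (2 ^ n * \<xi>) powr (- q)) * X"
          using small[of n N] by (simp add: W_D)
        finally show "emeasure D (\<Inter>M\<in>{N..}. G n M) \<le> ennreal (C * (2 ^ n * \<xi>) powr (- q)) * X" .
      qed
      finally show ?thesis .
    qed
    have "W (\<Union>n. H n) = emeasure D (\<Union>n. H n)"
      by (intro W_D) measurable
    also have "\<dots> \<le> (\<Sum>n. emeasure D (H n))"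
      by (intro emeasure_subadditive_countably) (auto simp: sets_D)
    also have "\<dots> \<le> (\<Sum>n. ennreal (C * \<xi> powr (- q) * r ^ n) * X)"
    proof (intro suminf_le)
      fix n
      have "(2 ^ n :: real) powr (- q) = r ^ n"
      proof -
        have "(2 ^ n :: real) powr (- q) = 2 powr (real n * (- q))"
          by (simp add: powr_realpow[symmetric] powr_powr)
        also have "\<dots> = r powr real n"
          by (simp add: r_def powr_powr mult.commute)
        finally show ?thesis
          using r by (simp add: powr_realpow)
      qed
      then have "C * (2 ^ n * \<xi>) powr (- q) = C * \<xi> powr (- q) * r ^ n"
        by (simp only: powr_mult mult_ac)
      then show "emeasure D (H n) \<le> ennreal (C * \<xi> powr (- q) * r ^ n) * X"
        using H_le[of n] by (simp only:)
    qed auto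
    also have "\<dots> = (\<Sum>n. ennreal (C * \<xi> powr (- q) * r ^ n)) * X"
      by simp
    also have "(\<Sum>n. ennreal (C * \<xi> powr (- q) * r ^ n)) = ennreal (C * \<xi> powr (- q) * (1 / (1 - r)))"
      using C r by (intro suminf_ennreal_eq sums_mult geometric_sums) auto
    also have "C * \<xi> powr (- q) * (1 / (1 - r)) = C / (1 - r) * \<xi> powr (- q)"
      by simp
    finally have W_le: "W (\<Union>n. H n) \<le> ennreal (C / (1 - r) * \<xi> powr (- q)) * X" .
    have "Q k \<alpha> \<times> {t} \<subseteq> (\<Union>n. H n)"
      if al: "\<alpha> \<in> I k" and av: "ennreal \<xi> < average lam (Pp k \<alpha> t) (\<lambda>y. \<bar>f y\<bar>)" for k \<alpha> t
    proof -
      define m where "m = cubem k \<alpha> * ((1 - \<gamma>) * L k)"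
      have m: "0 < m" "emeasure lam (Pp k \<alpha> t) = ennreal m"
        using \<gamma> emeasure_cube[OF al] al by (auto simp: m_def emeasure_Pp)
      obtain i where i: "(\<integral>\<^sup>+y\<in>Pp k \<alpha> t. ennreal \<bar>f y\<bar> \<partial>lam) = ennreal i" "0 \<le> i"
        using finite_on_Pp[OF f Lq al, of t] by (cases "\<integral>\<^sup>+y\<in>Pp k \<alpha> t. ennreal \<bar>f y\<bar> \<partial>lam") auto
      define a where "a = i / m"
      have a: "\<xi> < a" "i = a * m"
      proof -
        have "average lam (Pp k \<alpha> t) (\<lambda>y. \<bar>f y\<bar>) = ennreal a"
          using m i by (simp add: average_def a_def divide_ennreal)
        then show "\<xi> < a"
          using av \<xi> by (simp add: ennreal_less_iff)
        show "i = a * m"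
          using m by (simp add: a_def)
      qed
      define n where "n = (LEAST n. a \<le> 2 ^ n * \<xi>)"
      obtain n1 :: nat where "a / \<xi> < 2 ^ n1"
        using real_arch_pow[of 2 "a / \<xi>"] by auto
      then have "a \<le> 2 ^ n1 * \<xi>"
        using \<xi> by (simp add: field_simps)
      then have n: "a \<le> 2 ^ n * \<xi>"
        unfolding n_def by (rule LeastI)
      then have "n \<noteq> 0"
        using a by (intro notI) simp
      then obtain n' where n': "n = Suc n'"
        using not0_implies_Suc by blast
      have lower: "\<not> a \<le> 2 ^ n' * \<xi>"
        using n' unfolding n_def by (intro not_less_Least) simp
      have lev: "level f (2 ^ n' * \<xi>) k \<alpha> t"
      proof -
        have "(2 ^ n' * \<xi>) * m \<le> i" "i \<le> 2 * (2 ^ n' * \<xi>) * m"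
          using lower n m(1) unfolding a(2) n' by (auto intro!: mult_right_mono)
        then show ?thesis
          using \<xi> m(1) by (simp add: level_def m(2) i ennreal_mult'[symmetric] ennreal_leI)
      qed
      have "Q k \<alpha> \<times> {t} \<subseteq> (\<Inter>M\<in>{nat (- k)..}. G n' M)"
        using cover[OF _ al lev] by (intro INT_greatest) auto
      also have "\<dots> \<subseteq> H n'"
        by (auto simp: H_def)
      finally show ?thesis by blast
    qed
    with W_le show "\<exists>G \<in> sets lam. (\<forall>k \<alpha> t. \<alpha> \<in> I k \<longrightarrow> ennreal \<xi> < average lam (Pp k \<alpha> t) (\<lambda>y. \<bar>f y\<bar>) \<longrightarrow> Q k \<alpha> \<times> {t} \<subseteq> G) \<and>
        W G \<le> ennreal (C / (1 - r) * \<xi> powr (- q)) * (\<integral>\<^sup>+y. ennreal (\<bar>f y\<bar> powr q * \<omega> y) \<partial>lam)"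
      unfolding X_def by (intro bexI[of _ "\<Union>n. H n"]) auto
  qed
qed

end

lemma dyadic_weightI:
  fixes rho :: "'a \<Rightarrow> 'a \<Rightarrow> real" and I :: "nat \<Rightarrow> int \<Rightarrow> 'i set"
  assumes hom: "homogeneous_type K0 rho mu" and basic: "basic_assumptions rho mu"
    and geo: "monotone_geodesic rho" and p: "1 < p" and dy: "adjacent_dyadic_systems K0 rho mu \<delta> c0 C0 K I z Q"
    and q: "1 < q" and g: "0 \<le> \<gamma>" "\<gamma> < 1" and w: "\<omega> \<in> A_plus p rho mu q \<gamma>" and \<tau>: "\<tau> \<in> {1..K}"
  shows "\<exists>Cd. dyadic_weight K0 rho mu Cd p \<omega> q \<gamma> \<delta> (c0 / (3 * K0\<^sup>2)) (2 * K0 * C0) (I \<tau>) (z \<tau>) (Q \<tau>)"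
proof -
  have K0: "1 \<le> K0"
    using hom unfolding homogeneous_type_def quasi_metric_def by blast
  obtain Cmu :: real where Cmu: "\<And>x r. 0 < r \<Longrightarrow> emeasure mu (qball rho x (2 * r)) \<le> ennreal Cmu * emeasure mu (qball rho x r)"
    using hom unfolding homogeneous_type_def by blast
  have d: "0 < \<delta>" "96 * K0 ^ 6 * \<delta> \<le> 1" "0 < c0" "c0 \<le> C0"
    using dy unfolding adjacent_dyadic_systems_def by blast+
  have "1 \<le> K0 ^ 6"
    using K0 by (rule one_le_power)
  then have "96 * 1 * \<delta> \<le> 96 * K0 ^ 6 * \<delta>"
    using d by (intro mult_right_mono) auto
  with d have d2: "\<delta> \<le> 1 / 2" by linarith
  have powi: "\<delta> powi k = \<delta> powr real_of_int k" for k :: int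
    using d by (simp add: powr_real_of_int')
  note dy' = bspec[OF dy[unfolded adjacent_dyadic_systems_def Let_def powi, THEN conjunct2, THEN conjunct2,
      THEN conjunct2, THEN conjunct2, THEN conjunct2, THEN conjunct2, THEN conjunct1] \<tau>,
      THEN conjunct2, THEN conjunct2]
  note sets = dy'[THEN conjunct1, rule_format]
  note nested = dy'[THEN conjunct2, THEN conjunct1, rule_format]
  note cover = dy'[THEN conjunct2, THEN conjunct2, THEN conjunct1, rule_format]
  note balls = dy'[THEN conjunct2, THEN conjunct2, THEN conjunct2, THEN conjunct1, rule_format]
  show ?thesis
  proof (intro exI[of _ "max 1 Cmu"], unfold_locales)
    show "quasi_metric K0 rho" "space mu = UNIV" "\<And>r x. 0 < r \<Longrightarrow> qball rho x r \<in> sets mu"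
      using hom unfolding homogeneous_type_def by blast+
    show "emeasure mu (qball rho x (2 * r)) \<le> ennreal (max 1 Cmu) * emeasure mu (qball rho x r)" if "0 < r" for x r
      using Cmu[OF that, of x] by (rule order_trans) (intro mult_right_mono ennreal_leI; simp)
    show "1 \<le> max 1 Cmu" by simp
    show "0 < emeasure mu (qball rho x r)" "emeasure mu (qball rho x r) < \<infinity>" if "0 < r" for x r
      using basic that unfolding basic_assumptions_def by blast+
    show "0 < c0 / (3 * K0\<^sup>2)" "0 < 2 * K0 * C0"
      using K0 d by auto
    show "Q \<tau> l \<beta> \<subseteq> Q \<tau> k \<alpha>" if "k \<le> l" "\<alpha> \<in> I \<tau> k" "\<beta> \<in> I \<tau> l" "Q \<tau> l \<beta> \<inter> Q \<tau> k \<alpha> \<noteq> {}" for k l \<alpha> \<beta>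
      using nested[OF that(1-3)] that(4) by blast
  qed (use geo p q g w d d2 sets cover balls in auto)
qed

theorem theorem5p8:
  fixes rho :: "'a \<Rightarrow> 'a \<Rightarrow> real" and mu :: "'a measure"
    and I :: "nat \<Rightarrow> int \<Rightarrow> 'i set"
    and z :: "nat \<Rightarrow> int \<Rightarrow> 'i \<Rightarrow> 'a" and Q :: "nat \<Rightarrow> int \<Rightarrow> 'i \<Rightarrow> 'a set"
    and \<omega> :: "'a \<times> real \<Rightarrow> real"
    and K0 p q \<gamma> \<delta> c0 C0 :: real and K :: nat
  assumes "homogeneous_type K0 rho mu"
    and "basic_assumptions rho mu"
    and "monotone_geodesic rho"
    and "1 < p"
    and "basic_assumptions (parabolic_dist p rho) (parabolic_measure mu)"
    and "adjacent_dyadic_systems K0 rho mu \<delta> c0 C0 K I z Q"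
    and "1 < q" and "0 \<le> \<gamma>" and "\<gamma> < 1"
    and "\<omega> \<in> A_plus p rho mu q \<gamma>"
  shows "\<exists>C::real. 0 < C \<and>
    (\<forall>f \<in> weighted_Lq (parabolic_measure mu) q \<omega>. \<forall>\<xi>::real. 0 < \<xi> \<longrightarrow>
       weighted (parabolic_measure mu) \<omega> {y. ennreal \<xi> < maximal_plus p mu \<delta> K I Q \<gamma> f y}
       \<le> ennreal (C * \<xi> powr (- q)) * (\<integral>\<^sup>+y. ennreal (\<bar>f y\<bar> powr q * \<omega> y) \<partial>parabolic_measure mu))"
proof -
  let ?lam = "parabolic_measure mu"
  let ?I = "\<lambda>f. \<integral>\<^sup>+y. ennreal (\<bar>f y\<bar> powr q * \<omega> y) \<partial>?lam"
  define good where "good \<tau> C \<longleftrightarrow> 0 < C \<and> (\<forall>f \<in> weighted_Lq ?lam q \<omega>. \<forall>\<xi>>0. \<exists>G \<in> sets ?lam.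
      (\<forall>k \<alpha> t. \<alpha> \<in> I \<tau> k \<longrightarrow> ennreal \<xi> < average ?lam (rectangle_plus p \<delta> \<gamma> (Q \<tau> k \<alpha>) k t) (\<lambda>y. \<bar>f y\<bar>)
         \<longrightarrow> Q \<tau> k \<alpha> \<times> {t} \<subseteq> G) \<and>
      weighted ?lam \<omega> G \<le> ennreal (C * \<xi> powr (- q)) * ?I f)" for \<tau> C
  have "\<exists>C. good \<tau> C" if \<tau>: "\<tau> \<in> {1..K}" for \<tau>
  proof -
    obtain Cd where "dyadic_weight K0 rho mu Cd p \<omega> q \<gamma> \<delta> (c0 / (3 * K0\<^sup>2)) (2 * K0 * C0) (I \<tau>) (z \<tau>) (Q \<tau>)"
      using dyadic_weightI[OF assms(1-4,6-10) \<tau>] by blast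
    then interpret dyadic_weight K0 rho mu Cd p \<omega> q \<gamma> \<delta> "c0 / (3 * K0\<^sup>2)" "2 * K0 * C0" "I \<tau>" "z \<tau>" "Q \<tau>" .
    have rect: "rectangle_plus p \<delta> \<gamma> (Q \<tau> k \<alpha>) k t = Pp k \<alpha> t" for k \<alpha> t
      by (simp add: rectangle_plus_def L_def)
    obtain C where "0 < C" "\<And>f \<xi>. f \<in> borel_measurable ?lam \<Longrightarrow> ?I f < \<infinity> \<Longrightarrow> 0 < \<xi> \<Longrightarrow>
      \<exists>G \<in> sets ?lam. (\<forall>k \<alpha> t. \<alpha> \<in> I \<tau> k \<longrightarrow> ennreal \<xi> < average ?lam (Pp k \<alpha> t) (\<lambda>y. \<bar>f y\<bar>) \<longrightarrow> Q \<tau> k \<alpha> \<times> {t} \<subseteq> G) \<and>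
        W G \<le> ennreal (C * \<xi> powr (- q)) * ?I f"
      by (rule one_system_bound) (rule that)
    then have "good \<tau> C"
      unfolding good_def rect by (simp add: weighted_Lq_def)
    then show ?thesis ..
  qed
  then obtain C where good: "\<And>\<tau>. \<tau> \<in> {1..K} \<Longrightarrow> good \<tau> (C \<tau>)"
    by metis
  have C: "0 < C \<tau>" if "\<tau> \<in> {1..K}" for \<tau>
    using good[OF that] by (simp add: good_def)
  note G = good[unfolded good_def, THEN conjunct2, rule_format]
  have w: "\<omega> \<in> borel_measurable ?lam"
    using assms(10) by (simp add: A_plus_def weight_def)
  define C' where "C' = 1 + (\<Sum>\<tau>\<in>{1..K}. C \<tau>)"
  have C'0: "0 \<le> (\<Sum>\<tau>\<in>{1..K}. C \<tau>)"
    by (intro sum_nonneg less_imp_le C)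
  show ?thesis
  proof (intro exI[of _ C'] conjI ballI allI impI)
    show "0 < C'" using C'0 by (simp add: C'_def)
    fix f and \<xi> :: real assume f: "f \<in> weighted_Lq ?lam q \<omega>" and \<xi>: "0 < \<xi>"
    define controls where "controls \<tau> G \<longleftrightarrow> G \<in> sets ?lam \<and>
      (\<forall>k \<alpha> t. \<alpha> \<in> I \<tau> k \<longrightarrow> ennreal \<xi> < average ?lam (rectangle_plus p \<delta> \<gamma> (Q \<tau> k \<alpha>) k t) (\<lambda>y. \<bar>f y\<bar>)
         \<longrightarrow> Q \<tau> k \<alpha> \<times> {t} \<subseteq> G) \<and>
      weighted ?lam \<omega> G \<le> ennreal (C \<tau> * \<xi> powr (- q)) * ?I f" for \<tau> G
    have "\<exists>G. controls \<tau> G" if "\<tau> \<in> {1..K}" for \<tau>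
      using G[OF that f \<xi>] by (simp only: controls_def Bex_def)
    then obtain E where controls: "\<And>\<tau>. \<tau> \<in> {1..K} \<Longrightarrow> controls \<tau> (E \<tau>)"
      by metis
    have E: "E \<tau> \<in> sets ?lam" if "\<tau> \<in> {1..K}" for \<tau>
      using controls[OF that] by (simp add: controls_def)
    have cover: "Q \<tau> k \<alpha> \<times> {t} \<subseteq> E \<tau>" if "\<tau> \<in> {1..K}" "\<alpha> \<in> I \<tau> k"
         "ennreal \<xi> < average ?lam (rectangle_plus p \<delta> \<gamma> (Q \<tau> k \<alpha>) k t) (\<lambda>y. \<bar>f y\<bar>)" for \<tau> k \<alpha> t
      using controls[OF that(1)] that(2,3) unfolding controls_def by blast
    have small: "weighted ?lam \<omega> (E \<tau>) \<le> ennreal (C \<tau> * \<xi> powr (- q)) * ?I f" if "\<tau> \<in> {1..K}" for \<tau>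
      using controls[OF that] by (simp add: controls_def)
    have "{y. ennreal \<xi> < maximal_plus p mu \<delta> K I Q \<gamma> f y} \<subseteq> (\<Union>\<tau>\<in>{1..K}. E \<tau>)"
    proof
      fix y assume "y \<in> {y. ennreal \<xi> < maximal_plus p mu \<delta> K I Q \<gamma> f y}"
      moreover obtain x t where y: "y = (x, t)" by (cases y)
      ultimately obtain \<tau> k \<alpha> where *: "\<tau> \<in> {1..K}" "\<alpha> \<in> I \<tau> k" "(x, t) \<in> rectangle p \<delta> (Q \<tau> k \<alpha>) k t"
        "ennreal \<xi> < average ?lam (rectangle_plus p \<delta> \<gamma> (Q \<tau> k \<alpha>) k t) (\<lambda>y. \<bar>f y\<bar>)"
        by (auto simp: maximal_plus_def less_SUP_iff)
      have "x \<in> Q \<tau> k \<alpha>"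
        using *(3) by (simp add: rectangle_def)
      with cover[OF *(1,2,4)] * show "y \<in> (\<Union>\<tau>\<in>{1..K}. E \<tau>)"
        by (auto simp: y)
    qed
    then have "weighted ?lam \<omega> {y. ennreal \<xi> < maximal_plus p mu \<delta> K I Q \<gamma> f y} \<le> (\<Sum>\<tau>\<in>{1..K}. weighted ?lam \<omega> (E \<tau>))"
      using E by (intro weighted_UN_le w) auto
    also have "\<dots> \<le> (\<Sum>\<tau>\<in>{1..K}. ennreal (C \<tau> * \<xi> powr (- q)) * ?I f)"
      by (intro sum_mono small)
    also have "\<dots> = ennreal ((\<Sum>\<tau>\<in>{1..K}. C \<tau>) * \<xi> powr (- q)) * ?I f"
    proof -
      have eq: "(\<Sum>\<tau>\<in>{1..K}. ennreal (C \<tau> * \<xi> powr (- q))) = ennreal (\<Sum>\<tau>\<in>{1..K}. C \<tau> * \<xi> powr (- q))"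
        using C by (intro sum_ennreal) (simp add: less_imp_le)
      then show ?thesis
        by (simp only: sum_distrib_right[symmetric] eq[unfolded sum_distrib_right[symmetric]])
    qed
    also have "\<dots> \<le> ennreal (C' * \<xi> powr (- q)) * ?I f"
      by (intro mult_right_mono ennreal_leI) (auto simp: C'_def)
    finally show "weighted ?lam \<omega> {y. ennreal \<xi> < maximal_plus p mu \<delta> K I Q \<gamma> f y} \<le> ennreal (C' * \<xi> powr (- q)) * ?I f" .
  qed
qed

end
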